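(* The category $\mathrm{ECA}$ of equipped conic quantum spaces is rigid with respect to the monoidal structure $\boxtimes$, and has $\dagger$ as duality functor.
   Context: $\Bbbk$ is $\mathbb{R}$ or $\mathbb{C}$. For a finite dimensional $\Bbbk$-vector space $\mathbf{V}$, $\mathbf{V}^{\otimes}=\bigoplus_{n\ge 0}\mathbf{V}^{\otimes n}$ is its tensor algebra. The category $\mathrm{ECA}$ of equipped conic quantum spaces is described (up to equivalence) as follows. Objects are pairs $\mathfrak{V}=(\mathbf{V},R)$ with $\mathbf{V}$ a finite dimensional $\Bbbk$-vector space and $R$ a linear endomorphism of $\mathbf{V}^{\otimes}$ that is homogeneous of degree zero, i.e. $R$ is given by a family of linear maps $R_n:\mathbf{V}^{\otimes n}\to\mathbf{V}^{\otimes n}$, $n\ge 0$, such that $R_0=0$ and $R_1=0$. Arrows $(\mathbf{V},R)\to(\mathbf{W},S)$ are linear maps $l:\mathbf{V}\to\mathbf{W}$ with $l^{\otimes}R=S\,l^{\otimes}$, i.e. $l^{\otimes n}R_n=S_n\,l^{\otimes n}$ for all $n$. (The object $(\mathbf{V},R)$ corresponds to the graded algebra $\mathbf{V}^{\otimes}/I[\operatorname{Im}R]$, with generating space $\mathbf{V}$, equipped with $R$, where $I[\operatorname{Im}R]$ is the two-sided ideal generated by $\operatorname{Im}R$.) Monoidal structure: $(\mathbf{V},R)\boxtimes(\mathbf{W},S)=(\mathbf{V}\otimes\mathbf{W},R\boxtimes S)$, where $R\boxtimes S=\varphi_{\mathbf{V},\mathbf{W}}^{-1}(R\otimes\mathrm{id}+\mathrm{id}\otimes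 S)\varphi_{\mathbf{V},\mathbf{W}}$ and $\varphi_{\mathbf{V},\mathbf{W}}:[\mathbf{V}\otimes\mathbf{W}]^{\otimes}\to\bigoplus_{n\ge 0}\mathbf{V}^{\otimes n}\otimes\mathbf{W}^{\otimes n}$ is the canonical algebra isomorphism (regrouping of tensor factors); on arrows $k\boxtimes l=k\otimes l$. The unit object is $\mathfrak{K}=(\Bbbk,0)$. The associativity, unit and symmetry isomorphisms are the usual ones of vector spaces. The contravariant functor $\dagger$ is $(\mathbf{V},R)\mapsto(\mathbf{V}^{*},-R^{*})$, $l\mapsto l^{*}$, where $R^{*}$ is the degreewise transpose of $R$ with respect to the usual (factor by factor) pairings $(\mathbf{V}^{*})^{\otimes n}\otimes\mathbf{V}^{\otimes n}\to\Bbbk$, and $l^*$ is the transpose of $l$. "Rigid with duality functor $\dagger$" means: every object $\mathfrak{V}$ has $\mathfrak{V}^{\dagger}$ as a dual, with evaluation and coevaluation arrows $\mathfrak{V}^{\dagger}\boxtimes\mathfrak{V}\to\mathfrak{K}$ and $\mathfrak{K}\to\mathfrak{V}\boxtimes\mathfrak{V}^{\dagger}$ satisfying the triangle (zig-zag) identities, and the dual of an arrow $l$ induced by these is $l^{\dagger}$. *)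

theory Defs
  imports Complex_Main "Jordan_Normal_Form.VS_Connect"
begin

section \<open>Rigid symmetric monoidal categories\<close>

record ('o, 'm) monoidal_data =
  Ob :: "'o set"
  Ar :: "'m set"
  Dom :: "'m \<Rightarrow> 'o"
  Cod :: "'m \<Rightarrow> 'o"
  Ident :: "'o \<Rightarrow> 'm"
  Comp :: "'m \<Rightarrow> 'm \<Rightarrow> 'm"  (infixr \<open>\<cdot>\<index>\<close> 60)
  TensorOb :: "'o \<Rightarrow> 'o \<Rightarrow> 'o"  (infixr \<open>\<boxtimes>\<index>\<close> 75)
  TensorAr :: "'m \<Rightarrow> 'm \<Rightarrow> 'm"  (infixr \<open>\<boxdot>\<index>\<close> 75)
  UnitOb :: "'o"
  Assoc :: "'o \<Rightarrow> 'o \<Rightarrow> 'o \<Rightarrow> 'm"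
  LUnit :: "'o \<Rightarrow> 'm"
  RUnit :: "'o \<Rightarrow> 'm"
  Braid :: "'o \<Rightarrow> 'o \<Rightarrow> 'm"

text \<open>Composition is in applicative order: \<open>g \<cdot> f\<close> is \<open>f\<close> followed by \<open>g\<close>.\<close>

definition arrows :: "('o, 'm) monoidal_data \<Rightarrow> 'o \<Rightarrow> 'o \<Rightarrow> 'm set" where
  "arrows C A B = {f \<in> Ar C. Dom C f = A \<and> Cod C f = B}"

definition inverse_arrows :: "('o, 'm) monoidal_data \<Rightarrow> 'm \<Rightarrow> 'm \<Rightarrow> bool" where
  "inverse_arrows C f g \<longleftrightarrow> f \<in> Ar C \<and> g \<in> arrows C (Cod C f) (Dom C f) \<and>
     g \<cdot>\<^bsub>C\<^esub> f = Ident C (Dom C f) \<and> f \<cdot>\<^bsub>C\<^esub> g = Ident C (Cod C f)"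

definition iso_arrow :: "('o, 'm) monoidal_data \<Rightarrow> 'm \<Rightarrow> bool" where
  "iso_arrow C f \<longleftrightarrow> (\<exists>g. inverse_arrows C f g)"

definition inverse_arrow :: "('o, 'm) monoidal_data \<Rightarrow> 'm \<Rightarrow> 'm" where
  "inverse_arrow C f = (THE g. inverse_arrows C f g)"

locale category =
  fixes C :: "('o, 'm) monoidal_data" (structure)
  assumes dom_in_ob: "f \<in> Ar C \<Longrightarrow> Dom C f \<in> Ob C"
    and cod_in_ob: "f \<in> Ar C \<Longrightarrow> Cod C f \<in> Ob C"
    and id_arrow: "A \<in> Ob C \<Longrightarrow> Ident C A \<in> arrows C A A"
    and comp_arrow: "\<lbrakk>f \<in> Ar C; g \<in> Ar C; Dom C g = Cod C f\<rbrakk> \<Longrightarrow> g \<cdot> f \<in> arrows C (Dom C f) (Cod C g)"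
    and id_right: "f \<in> Ar C \<Longrightarrow> f \<cdot> Ident C (Dom C f) = f"
    and id_left: "f \<in> Ar C \<Longrightarrow> Ident C (Cod C f) \<cdot> f = f"
    and comp_assoc: "\<lbrakk>f \<in> Ar C; g \<in> Ar C; h \<in> Ar C; Dom C g = Cod C f; Dom C h = Cod C g\<rbrakk> \<Longrightarrow>
      (h \<cdot> g) \<cdot> f = h \<cdot> (g \<cdot> f)"

locale monoidal_category = category C
  for C :: "('o, 'm) monoidal_data" (structure) +
  assumes unit_ob: "UnitOb C \<in> Ob C"
    and tensor_ob: "\<lbrakk>A \<in> Ob C; B \<in> Ob C\<rbrakk> \<Longrightarrow> A \<boxtimes> B \<in> Ob C"
    and tensor_arrow: "\<lbrakk>f \<in> Ar C; g \<in> Ar C\<rbrakk> \<Longrightarrow>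
      f \<boxdot> g \<in> arrows C (Dom C f \<boxtimes> Dom C g) (Cod C f \<boxtimes> Cod C g)"
    and tensor_id: "\<lbrakk>A \<in> Ob C; B \<in> Ob C\<rbrakk> \<Longrightarrow> Ident C A \<boxdot> Ident C B = Ident C (A \<boxtimes> B)"
    and tensor_comp: "\<lbrakk>f \<in> Ar C; g \<in> Ar C; h \<in> Ar C; k \<in> Ar C; Dom C g = Cod C f; Dom C k = Cod C h\<rbrakk> \<Longrightarrow>
      (g \<cdot> f) \<boxdot> (k \<cdot> h) = (g \<boxdot> k) \<cdot> (f \<boxdot> h)"
    and assoc_arrow: "\<lbrakk>X \<in> Ob C; Y \<in> Ob C; Z \<in> Ob C\<rbrakk> \<Longrightarrow>
      Assoc C X Y Z \<in> arrows C ((X \<boxtimes> Y) \<boxtimes> Z) (X \<boxtimes> (Y \<boxtimes> Z)) \<and> iso_arrow C (Assoc C X Y Z)"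
    and assoc_natural: "\<lbrakk>f \<in> arrows C X X'; g \<in> arrows C Y Y'; h \<in> arrows C Z Z'\<rbrakk> \<Longrightarrow>
      Assoc C X' Y' Z' \<cdot> ((f \<boxdot> g) \<boxdot> h) = (f \<boxdot> (g \<boxdot> h)) \<cdot> Assoc C X Y Z"
    and lunit_arrow: "X \<in> Ob C \<Longrightarrow>
      LUnit C X \<in> arrows C (UnitOb C \<boxtimes> X) X \<and> iso_arrow C (LUnit C X)"
    and lunit_natural: "f \<in> arrows C X Y \<Longrightarrow>
      LUnit C Y \<cdot> (Ident C (UnitOb C) \<boxdot> f) = f \<cdot> LUnit C X"
    and runit_arrow: "X \<in> Ob C \<Longrightarrow>
      RUnit C X \<in> arrows C (X \<boxtimes> UnitOb C) X \<and> iso_arrow C (RUnit C X)"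
    and runit_natural: "f \<in> arrows C X Y \<Longrightarrow>
      RUnit C Y \<cdot> (f \<boxdot> Ident C (UnitOb C)) = f \<cdot> RUnit C X"
    and pentagon: "\<lbrakk>W \<in> Ob C; X \<in> Ob C; Y \<in> Ob C; Z \<in> Ob C\<rbrakk> \<Longrightarrow>
      (Ident C W \<boxdot> Assoc C X Y Z) \<cdot> Assoc C W (X \<boxtimes> Y) Z \<cdot> (Assoc C W X Y \<boxdot> Ident C Z)
        = Assoc C W X (Y \<boxtimes> Z) \<cdot> Assoc C (W \<boxtimes> X) Y Z"
    and triangle: "\<lbrakk>X \<in> Ob C; Y \<in> Ob C\<rbrakk> \<Longrightarrow>
      (Ident C X \<boxdot> LUnit C Y) \<cdot> Assoc C X (UnitOb C) Y = RUnit C X \<boxdot> Ident C Y"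

locale symmetric_monoidal_category = monoidal_category C
  for C :: "('o, 'm) monoidal_data" (structure) +
  assumes braid_arrow: "\<lbrakk>X \<in> Ob C; Y \<in> Ob C\<rbrakk> \<Longrightarrow> Braid C X Y \<in> arrows C (X \<boxtimes> Y) (Y \<boxtimes> X)"
    and braid_natural: "\<lbrakk>f \<in> arrows C X X'; g \<in> arrows C Y Y'\<rbrakk> \<Longrightarrow>
      Braid C X' Y' \<cdot> (f \<boxdot> g) = (g \<boxdot> f) \<cdot> Braid C X Y"
    and braid_involutive: "\<lbrakk>X \<in> Ob C; Y \<in> Ob C\<rbrakk> \<Longrightarrow> Braid C Y X \<cdot> Braid C X Y = Ident C (X \<boxtimes> Y)"
    and hexagon: "\<lbrakk>X \<in> Ob C; Y \<in> Ob C; Z \<in> Ob C\<rbrakk> \<Longrightarrow>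
      Assoc C Y Z X \<cdot> Braid C X (Y \<boxtimes> Z) \<cdot> Assoc C X Y Z
        = (Ident C Y \<boxdot> Braid C X Z) \<cdot> Assoc C Y X Z \<cdot> (Braid C X Y \<boxdot> Ident C Z)"

locale contravariant_functor = category C
  for C :: "('o, 'm) monoidal_data" (structure) +
  fixes F_ob :: "'o \<Rightarrow> 'o" and F_ar :: "'m \<Rightarrow> 'm"
  assumes F_ob: "A \<in> Ob C \<Longrightarrow> F_ob A \<in> Ob C"
    and F_ar: "f \<in> arrows C A B \<Longrightarrow> F_ar f \<in> arrows C (F_ob B) (F_ob A)"
    and F_id: "A \<in> Ob C \<Longrightarrow> F_ar (Ident C A) = Ident C (F_ob A)"
    and F_comp: "\<lbrakk>f \<in> Ar C; g \<in> Ar C; Dom C g = Cod C f\<rbrakk> \<Longrightarrow> F_ar (g \<cdot> f) = F_ar f \<cdot> F_ar g"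

definition is_dual ::
  "('o, 'm) monoidal_data \<Rightarrow> 'o \<Rightarrow> 'o \<Rightarrow> 'm \<Rightarrow> 'm \<Rightarrow> bool" where
  "is_dual C A D e c \<longleftrightarrow>
     e \<in> arrows C (D \<boxtimes>\<^bsub>C\<^esub> A) (UnitOb C) \<and> c \<in> arrows C (UnitOb C) (A \<boxtimes>\<^bsub>C\<^esub> D) \<and>
     RUnit C A \<cdot>\<^bsub>C\<^esub> (Ident C A \<boxdot>\<^bsub>C\<^esub> e) \<cdot>\<^bsub>C\<^esub> Assoc C A D A \<cdot>\<^bsub>C\<^esub> (c \<boxdot>\<^bsub>C\<^esub> Ident C A)
       \<cdot>\<^bsub>C\<^esub> inverse_arrow C (LUnit C A) = Ident C A \<and>
     LUnit C D \<cdot>\<^bsub>C\<^esub> (e \<boxdot>\<^bsub>C\<^esub> Ident C D) \<cdot>\<^bsub>C\<^esub> inverse_arrow C (Assoc C D A D) \<cdot>\<^bsub>C\<^esub> (Ident C D \<boxdot>\<^bsub>C\<^esub> c)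
       \<cdot>\<^bsub>C\<^esub> inverse_arrow C (RUnit C D) = Ident C D"

text \<open>The dual \<open>E \<rightarrow> D\<close> of \<open>f : A \<rightarrow> B\<close>, where \<open>D\<close>, \<open>E\<close> are duals of \<open>A\<close>, \<open>B\<close>,
  \<open>c\<close> is the coevaluation of \<open>A\<close> and \<open>e\<close> the evaluation of \<open>B\<close>.\<close>

definition induced_dual ::
  "('o, 'm) monoidal_data \<Rightarrow> 'o \<Rightarrow> 'o \<Rightarrow> 'm \<Rightarrow> 'm \<Rightarrow> 'm \<Rightarrow> 'm" where
  "induced_dual C D E c e f =
     LUnit C D \<cdot>\<^bsub>C\<^esub> (e \<boxdot>\<^bsub>C\<^esub> Ident C D) \<cdot>\<^bsub>C\<^esub> inverse_arrow C (Assoc C E (Cod C f) D)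
       \<cdot>\<^bsub>C\<^esub> (Ident C E \<boxdot>\<^bsub>C\<^esub> (f \<boxdot>\<^bsub>C\<^esub> Ident C D)) \<cdot>\<^bsub>C\<^esub> (Ident C E \<boxdot>\<^bsub>C\<^esub> c)
       \<cdot>\<^bsub>C\<^esub> inverse_arrow C (RUnit C E)"

text \<open>As the category is symmetric, left duals are also right duals.\<close>

locale rigid_category = symmetric_monoidal_category C + contravariant_functor C dual_ob dual_ar
  for C :: "('o, 'm) monoidal_data" (structure)
    and dual_ob :: "'o \<Rightarrow> 'o" and dual_ar :: "'m \<Rightarrow> 'm" +
  assumes rigid: "\<exists>ev coev.
    (\<forall>A\<in>Ob C. is_dual C A (dual_ob A) (ev A) (coev A)) \<and>
    (\<forall>f\<in>Ar C. induced_dual C (dual_ob (Dom C f)) (dual_ob (Cod C f))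
                 (coev (Dom C f)) (ev (Cod C f)) f = dual_ar f)"


section \<open>Finite-dimensional vector spaces\<close>

text \<open>A vector space is a module record over \<open>class_ring\<close>, the scalar field \<open>'k\<close> as a ring record;
  the \<open>mult\<close> and \<open>one\<close> fields of a module record carry no meaning.\<close>

definition fd_space :: "('k::field, 'v) module \<Rightarrow> bool" where
  "fd_space V \<longleftrightarrow> vectorspace class_ring V \<and> vectorspace.fin_dim class_ring V"

text \<open>Linear maps are made extensional, so that equality of functions is equality of linear maps.\<close>

definition lin_maps :: "('k::field, 'v) module \<Rightarrow> ('k, 'w) module \<Rightarrow> ('v \<Rightarrow> 'w) set" where
  "lin_maps V W = LinearCombinations.module_hom class_ring V W \<inter> extensional (carrier V)"

definition lin_iso :: "('k::field, 'v) module \<Rightarrow> ('k, 'w) module \<Rightarrow> ('v \<Rightarrow> 'w) \<Rightarrow> bool" where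
  "lin_iso V W f \<longleftrightarrow> f \<in> lin_maps V W \<and> bij_betw f (carrier V) (carrier W)"

definition id_map :: "('k::field, 'v) module \<Rightarrow> 'v \<Rightarrow> 'v" where
  "id_map V = (\<lambda>v\<in>carrier V. v)"

definition zero_map :: "('k::field, 'v) module \<Rightarrow> ('k, 'w) module \<Rightarrow> 'v \<Rightarrow> 'w" where
  "zero_map V W = (\<lambda>v\<in>carrier V. \<zero>\<^bsub>W\<^esub>)"

definition scalars :: "('k::field, 'k) module" where
  "scalars = \<lparr>carrier = UNIV, mult = (*), one = 1, zero = 0, add = (+), smult = (*)\<rparr>"

definition functionals :: "('k::field, 'v) module \<Rightarrow> ('k, 'v \<Rightarrow> 'k) module" where
  "functionals V = (ring.func_space class_ring (carrier V)) \<lparr>carrier := lin_maps V scalars\<rparr>"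


subsection \<open>Tensor products of lists of vector spaces\<close>

definition tuples :: "('k::field, 'v) module list \<Rightarrow> 'v list set" where
  "tuples Vs = {vs. list_all2 (\<lambda>v V. v \<in> carrier V) vs Vs}"

definition multilinear_maps ::
  "('k::field, 'v) module list \<Rightarrow> ('k, 'w) module \<Rightarrow> ('v list \<Rightarrow> 'w) set" where
  "multilinear_maps Vs W = {f \<in> tuples Vs \<rightarrow>\<^sub>E carrier W.
     \<forall>vs\<in>tuples Vs. \<forall>i<length Vs. (\<lambda>x. f (vs[i := x])) \<in> LinearCombinations.module_hom class_ring (Vs ! i) W}"

text \<open>\<open>V\<^sub>1 \<otimes> \<dots> \<otimes> V\<^sub>n\<close> is realised as the space spanned by the evaluations
  \<open>v\<^sub>1 \<otimes> \<dots> \<otimes> v\<^sub>n : \<beta> \<mapsto> \<beta>(v\<^sub>1, \<dots>, v\<^sub>n)\<close> inside the functions on multilinear forms.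
  This has the universal property, since multilinear forms separate the elements
  of the tensor product; for finite-dimensional spaces it is the whole dual space of the
  space of multilinear forms. The empty tensor product is a line.\<close>

definition pure :: "('k::field, 'v) module list \<Rightarrow> 'v list \<Rightarrow> ('v list \<Rightarrow> 'k) \<Rightarrow> 'k" where
  "pure Vs vs = (\<lambda>\<beta>\<in>multilinear_maps Vs scalars. \<beta> vs)"

definition tensor :: "('k::field, 'v) module list \<Rightarrow> ('k, ('v list \<Rightarrow> 'k) \<Rightarrow> 'k) module" where
  "tensor Vs = (let F = ring.func_space class_ring (multilinear_maps Vs scalars)
     in F \<lparr>carrier := LinearCombinations.module.span class_ring F (pure Vs ` tuples Vs)\<rparr>)"

definition tensor_map ::
  "('k::field, 'v) module list \<Rightarrow> ('k, 'w) module list \<Rightarrow> ('v \<Rightarrow> 'w) list \<Rightarrow>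
   (('v list \<Rightarrow> 'k) \<Rightarrow> 'k) \<Rightarrow> (('w list \<Rightarrow> 'k) \<Rightarrow> 'k)" where
  "tensor_map Vs Ws fs = (THE h. h \<in> lin_maps (tensor Vs) (tensor Ws) \<and>
     (\<forall>vs\<in>tuples Vs. h (pure Vs vs) = pure Ws (map2 (\<lambda>f v. f v) fs vs)))"

definition tpow :: "nat \<Rightarrow> ('k::field, 'v) module \<Rightarrow> ('k, ('v list \<Rightarrow> 'k) \<Rightarrow> 'k) module" where
  "tpow n V = tensor (replicate n V)"

definition tpow_pure :: "('k::field, 'v) module \<Rightarrow> 'v list \<Rightarrow> ('v list \<Rightarrow> 'k) \<Rightarrow> 'k" where
  "tpow_pure V vs = pure (replicate (length vs) V) vs"

definition tpow_map :: "nat \<Rightarrow> ('k::field, 'v) module \<Rightarrow> ('k, 'w) module \<Rightarrow> ('v \<Rightarrow> 'w) \<Rightarrow>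
   (('v list \<Rightarrow> 'k) \<Rightarrow> 'k) \<Rightarrow> (('w list \<Rightarrow> 'k) \<Rightarrow> 'k)" where
  "tpow_map n V W l = tensor_map (replicate n V) (replicate n W) (replicate n l)"


subsection \<open>Tensor products and duals within a fixed type of vectors\<close>

text \<open>The objects of a category must be of one type, so \<open>V \<otimes> W\<close> and \<open>V\<^sup>*\<close> are replaced by
  chosen isomorphic copies with vectors in the type of the vectors of \<open>V\<close> and \<open>W\<close>.
  Such copies exist if that type is large enough. The type \<open>'a + 'k list\<close> is: it contains all
  coordinate spaces, besides the vectors of an arbitrary type \<open>'a\<close>.\<close>

definition copy :: "('k::field, 'v) module \<Rightarrow> ('k, 'u) module" where
  "copy V = (SOME W. vectorspace class_ring W \<and> (\<exists>f. lin_iso V W f))"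

definition to_copy :: "('k::field, 'v) module \<Rightarrow> 'v \<Rightarrow> 'u" where
  "to_copy V = (SOME f. lin_iso V (copy V) f)"

definition tens :: "('k::field, 'u) module \<Rightarrow> ('k, 'u) module \<Rightarrow> ('k, 'u) module" where
  "tens V W = copy (tensor [V, W])"

definition tens_vec :: "('k::field, 'u) module \<Rightarrow> ('k, 'u) module \<Rightarrow> 'u \<Rightarrow> 'u \<Rightarrow> 'u" where
  "tens_vec V W v w = to_copy (tensor [V, W]) (pure [V, W] [v, w])"

definition tens_map :: "('k::field, 'u) module \<Rightarrow> ('k, 'u) module \<Rightarrow> ('k, 'u) module \<Rightarrow> ('k, 'u) module
    \<Rightarrow> ('u \<Rightarrow> 'u) \<Rightarrow> ('u \<Rightarrow> 'u) \<Rightarrow> 'u \<Rightarrow> 'u" where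
  "tens_map V V' W W' k l = (THE h. h \<in> lin_maps (tens V W) (tens V' W') \<and>
     (\<forall>v\<in>carrier V. \<forall>w\<in>carrier W. h (tens_vec V W v w) = tens_vec V' W' (k v) (l w)))"

definition unit_space :: "('k::field, 'u) module" where
  "unit_space = copy scalars"

definition unit_vec :: "'k::field \<Rightarrow> 'u" where
  "unit_vec = to_copy scalars"

definition dual :: "('k::field, 'u) module \<Rightarrow> ('k, 'u) module" where
  "dual V = copy (functionals V)"

definition pairing :: "('k::field, 'u) module \<Rightarrow> 'u \<Rightarrow> 'u \<Rightarrow> 'k" where
  "pairing V a v = inv_into (carrier (functionals V)) (to_copy (functionals V)) a v"

definition dual_map :: "('k::field, 'u) module \<Rightarrow> ('k, 'u) module \<Rightarrow> ('u \<Rightarrow> 'u) \<Rightarrow> 'u \<Rightarrow> 'u" where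
  "dual_map V W l = (THE h. h \<in> lin_maps (dual W) (dual V) \<and>
     (\<forall>b\<in>carrier (dual W). \<forall>v\<in>carrier V. pairing V (h b) v = pairing W b (l v)))"

definition assoc_map :: "('k::field, 'u) module \<Rightarrow> ('k, 'u) module \<Rightarrow> ('k, 'u) module \<Rightarrow> 'u \<Rightarrow> 'u" where
  "assoc_map U V W = (THE h. h \<in> lin_maps (tens (tens U V) W) (tens U (tens V W)) \<and>
     (\<forall>u\<in>carrier U. \<forall>v\<in>carrier V. \<forall>w\<in>carrier W.
        h (tens_vec (tens U V) W (tens_vec U V u v) w) = tens_vec U (tens V W) u (tens_vec V W v w)))"

definition lunit_map :: "('k::field, 'u) module \<Rightarrow> 'u \<Rightarrow> 'u" where
  "lunit_map V = (THE h. h \<in> lin_maps (tens unit_space V) V \<and>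
     (\<forall>c::'k. \<forall>v\<in>carrier V. h (tens_vec unit_space V (unit_vec c) v) = c \<odot>\<^bsub>V\<^esub> v))"

definition runit_map :: "('k::field, 'u) module \<Rightarrow> 'u \<Rightarrow> 'u" where
  "runit_map V = (THE h. h \<in> lin_maps (tens V unit_space) V \<and>
     (\<forall>c::'k. \<forall>v\<in>carrier V. h (tens_vec V unit_space v (unit_vec c)) = c \<odot>\<^bsub>V\<^esub> v))"

definition swap_map :: "('k::field, 'u) module \<Rightarrow> ('k, 'u) module \<Rightarrow> 'u \<Rightarrow> 'u" where
  "swap_map V W = (THE h. h \<in> lin_maps (tens V W) (tens W V) \<and>
     (\<forall>v\<in>carrier V. \<forall>w\<in>carrier W. h (tens_vec V W v w) = tens_vec W V w v))"


section \<open>Equipped conic quantum spaces\<close>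

text \<open>An object \<open>(V, R)\<close> carries the family of the homogeneous components \<open>R n\<close> of \<open>R\<close>.\<close>

type_synonym ('k, 'u) graded_endo = "nat \<Rightarrow> (('u list \<Rightarrow> 'k) \<Rightarrow> 'k) \<Rightarrow> (('u list \<Rightarrow> 'k) \<Rightarrow> 'k)"
type_synonym ('k, 'u) eca_ob = "('k, 'u) module \<times> ('k, 'u) graded_endo"
type_synonym ('k, 'u) eca_ar = "('k, 'u) eca_ob \<times> ('u \<Rightarrow> 'u) \<times> ('k, 'u) eca_ob"

definition eca_obs :: "('k::field, 'u) eca_ob set" where
  "eca_obs = {(V, R). fd_space V \<and> (\<forall>n. R n \<in> lin_maps (tpow n V) (tpow n V)) \<and>
     R 0 = zero_map (tpow 0 V) (tpow 0 V) \<and> R 1 = zero_map (tpow 1 V) (tpow 1 V)}"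

definition eca_ars :: "('k::field, 'u) eca_ar set" where
  "eca_ars = {((V, R), l, (W, S)) | V R l W S.
     (V, R) \<in> eca_obs \<and> (W, S) \<in> eca_obs \<and> l \<in> lin_maps V W \<and>
     (\<forall>n. \<forall>x\<in>carrier (tpow n V). tpow_map n V W l (R n x) = S n (tpow_map n V W l x))}"

definition eca_id :: "('k::field, 'u) eca_ob \<Rightarrow> ('k, 'u) eca_ar" where
  "eca_id A = (A, id_map (fst A), A)"

definition eca_comp :: "('k::field, 'u) eca_ar \<Rightarrow> ('k, 'u) eca_ar \<Rightarrow> ('k, 'u) eca_ar" where
  "eca_comp = (\<lambda>(B, k, D) (A, l, B'). (A, compose (carrier (fst A)) k l, D))"

text \<open>The component of degree \<open>n\<close> of the regrouping isomorphism,
  \<open>(v\<^sub>1 \<otimes> w\<^sub>1) \<otimes> \<dots> \<otimes> (v\<^sub>n \<otimes> w\<^sub>n) \<mapsto> (v\<^sub>1 \<otimes> \<dots> \<otimes> v\<^sub>n) \<otimes> (w\<^sub>1 \<otimes> \<dots> \<otimes> w\<^sub>n)\<close>.\<close>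

definition regroup :: "nat \<Rightarrow> ('k::field, 'u) module \<Rightarrow> ('k, 'u) module \<Rightarrow>
    (('u list \<Rightarrow> 'k) \<Rightarrow> 'k) \<Rightarrow> (((('u list \<Rightarrow> 'k) \<Rightarrow> 'k) list \<Rightarrow> 'k) \<Rightarrow> 'k)" where
  "regroup n V W = (THE h. h \<in> lin_maps (tpow n (tens V W)) (tensor [tpow n V, tpow n W]) \<and>
     (\<forall>vs\<in>tuples (replicate n V). \<forall>ws\<in>tuples (replicate n W).
        h (tpow_pure (tens V W) (map2 (tens_vec V W) vs ws))
          = pure [tpow n V, tpow n W] [tpow_pure V vs, tpow_pure W ws]))"

definition box_endo :: "('k::field, 'u) eca_ob \<Rightarrow> ('k, 'u) eca_ob \<Rightarrow> ('k, 'u) graded_endo" where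
  "box_endo = (\<lambda>(V, R) (W, S) n. \<lambda>x\<in>carrier (tpow n (tens V W)).
     let T = [tpow n V, tpow n W]; y = regroup n V W x in
       inv_into (carrier (tpow n (tens V W))) (regroup n V W)
         (tensor_map T T [R n, id_map (tpow n W)] y
            \<oplus>\<^bsub>tensor T\<^esub> tensor_map T T [id_map (tpow n V), S n] y))"

definition eca_tensor_ob :: "('k::field, 'u) eca_ob \<Rightarrow> ('k, 'u) eca_ob \<Rightarrow> ('k, 'u) eca_ob" where
  "eca_tensor_ob A B = (tens (fst A) (fst B), box_endo A B)"

definition eca_tensor_ar :: "('k::field, 'u) eca_ar \<Rightarrow> ('k, 'u) eca_ar \<Rightarrow> ('k, 'u) eca_ar" where
  "eca_tensor_ar = (\<lambda>(A, k, A') (B, l, B').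
     (eca_tensor_ob A B, tens_map (fst A) (fst A') (fst B) (fst B') k l, eca_tensor_ob A' B'))"

definition eca_unit :: "('k::field, 'u) eca_ob" where
  "eca_unit = (unit_space, \<lambda>n. zero_map (tpow n unit_space) (tpow n unit_space))"

definition ECA :: "(('k::field, 'u) eca_ob, ('k, 'u) eca_ar) monoidal_data" where
  "ECA = \<lparr>
     Ob = eca_obs,
     Ar = eca_ars,
     Dom = (\<lambda>(A, l, B). A),
     Cod = (\<lambda>(A, l, B). B),
     Ident = eca_id,
     Comp = eca_comp,
     TensorOb = eca_tensor_ob,
     TensorAr = eca_tensor_ar,
     UnitOb = eca_unit,
     Assoc = (\<lambda>A B D. (eca_tensor_ob (eca_tensor_ob A B) D, assoc_map (fst A) (fst B) (fst D),
                       eca_tensor_ob A (eca_tensor_ob B D))),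
     LUnit = (\<lambda>A. (eca_tensor_ob eca_unit A, lunit_map (fst A), A)),
     RUnit = (\<lambda>A. (eca_tensor_ob A eca_unit, runit_map (fst A), A)),
     Braid = (\<lambda>A B. (eca_tensor_ob A B, swap_map (fst A) (fst B), eca_tensor_ob B A))\<rparr>"


subsection \<open>The functor \<open>\<dagger>\<close>\<close>

text \<open>The factor by factor pairing of \<open>(V\<^sup>*)\<^sup>\<otimes>\<^sup>n\<close> with \<open>V\<^sup>\<otimes>\<^sup>n\<close>, as a bilinear map
  on two-element lists.\<close>

definition tpow_pairing :: "nat \<Rightarrow> ('k::field, 'u) module \<Rightarrow> (('u list \<Rightarrow> 'k) \<Rightarrow> 'k) list \<Rightarrow> 'k" where
  "tpow_pairing n V = (THE p. p \<in> multilinear_maps [tpow n (dual V), tpow n V] scalars \<and>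
     (\<forall>as\<in>tuples (replicate n (dual V)). \<forall>vs\<in>tuples (replicate n V).
        p [tpow_pure (dual V) as, tpow_pure V vs] = (\<Prod>i<n. pairing V (as ! i) (vs ! i))))"

definition transpose_endo :: "('k::field, 'u) module \<Rightarrow> ('k, 'u) graded_endo \<Rightarrow> ('k, 'u) graded_endo" where
  "transpose_endo V R n = (THE h. h \<in> lin_maps (tpow n (dual V)) (tpow n (dual V)) \<and>
     (\<forall>a\<in>carrier (tpow n (dual V)). \<forall>x\<in>carrier (tpow n V).
        tpow_pairing n V [h a, x] = tpow_pairing n V [a, R n x]))"

definition dagger_ob :: "('k::field, 'u) eca_ob \<Rightarrow> ('k, 'u) eca_ob" where
  "dagger_ob = (\<lambda>(V, R). (dual V,
     \<lambda>n. \<lambda>a\<in>carrier (tpow n (dual V)). \<ominus>\<^bsub>tpow n (dual V)\<^esub> transpose_endo V R n a))"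

definition dagger_ar :: "('k::field, 'u) eca_ar \<Rightarrow> ('k, 'u) eca_ar" where
  "dagger_ar = (\<lambda>(A, l, B). (dagger_ob B, dual_map (fst A) (fst B) l, dagger_ob A))"

end

theory Submission
  imports Defs
begin

text \<open>
  An arrow of \<open>ECA\<close> is a linear map with a property, so every identity between arrows is an identity between
  linear maps. The coherence laws, the zig-zag identities and the description of the dual of an arrow as its transpose
  are therefore those of finite-dimensional vector spaces. The content of the theorem is that the linear maps in
  question are arrows, that is, commute with the given endomorphisms of the tensor powers.

  In degree \<open>n\<close> the endomorphism of \<open>V \<otimes> W\<close> is \<open>R\<^sub>n \<otimes> id + id \<otimes> S\<^sub>n\<close> after regrouping
  \<open>(V \<otimes> W)\<^sup>\<otimes>\<^sup>n\<close> as \<open>V\<^sup>\<otimes>\<^sup>n \<otimes> W\<^sup>\<otimes>\<^sup>n\<close>. For the structural isomorphisms this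
  Leibniz form makes the claim immediate. The evaluation of \<open>V\<close> induces on tensor powers the factor by factor
  pairing, and for \<open>a\<close> in \<open>V\<^sup>*\<^sup>\<otimes>\<^sup>n\<close> and \<open>x\<close> in \<open>V\<^sup>\<otimes>\<^sup>n\<close> one has
  \<open>\<langle>- R\<^sup>* a, x\<rangle> + \<langle>a, R x\<rangle> = 0\<close>: the sign in \<open>\<dagger>\<close> is what makes the evaluation an arrow to the unit, whose
  endomorphism is zero. Dually, \<open>R \<otimes> id - id \<otimes> R\<^sup>*\<close> annihilates the canonical element of
  \<open>V\<^sup>\<otimes>\<^sup>n \<otimes> V\<^sup>*\<^sup>\<otimes>\<^sup>n\<close>, which stands for the identity of \<open>V\<^sup>\<otimes>\<^sup>n\<close> and hence commutes with
  \<open>R\<close>; so the coevaluation is an arrow (\<open>box_coev_zero\<close>).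

  Since \<open>R\<^sub>n\<close> is an arbitrary endomorphism, it need not map pure tensors to pure tensors, and computing on pure
  tensors of \<open>(V \<otimes> W)\<^sup>\<otimes>\<^sup>n\<close> is not enough. The bilinear map \<open>merge\<close> from \<open>V\<^sup>\<otimes>\<^sup>n\<close> and
  \<open>W\<^sup>\<otimes>\<^sup>n\<close> to \<open>(V \<otimes> W)\<^sup>\<otimes>\<^sup>n\<close>, inverse to regrouping, serves instead. It is again a
  tensor product (\<open>merge_tprod\<close>), the endomorphism acts on it by the Leibniz rule (\<open>box_merge\<close>), and the maps induced
  by the structural maps on tensor powers are compatible with it (\<open>tpow_map_tens\<close>, \<open>tpow_map_assoc\<close>,
  \<open>tpow_map_ev\<close> and their companions); these last statements involve no \<open>R\<close> and may be checked on pure tensors.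

  Maps between tensor products are produced from their values on generators by one principle, \<open>lin_extend\<close>: an assignment on
  generators extends linearly if enough functionals on the target, composed with the assignment, extend. Enough
  functionals are supplied by dual bases, which pass from spaces to their tensor products by taking products of
  functionals (\<open>tprod_dual_basis\<close>, \<open>tpow_dual_basis\<close>). This gives the universal property of the tensor product and,
  applied in both directions, the bijectivity of regrouping.
\<close>

section \<open>Linear algebra on module records\<close>

abbreviation is_vs :: "('k::field, 'v) module \<Rightarrow> bool" where
  "is_vs V \<equiv> vectorspace class_ring V"

text \<open>The vector space laws with the field operations written in the field itself instead of the record \<open>class_ring\<close>.\<close>

lemma
  fixes V :: "('k::field, 'v) module"
  assumes "is_vs V"
  shows vs_zero: "\<zero>\<^bsub>V\<^esub> \<in> carrier V"
    and vs_add: "\<And>x y. x \<in> carrier V \<Longrightarrow> y \<in> carrier V \<Longrightarrow> x \<oplus>\<^bsub>V\<^esub> y \<in> carrier V"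
    and vs_smult: "\<And>c x. x \<in> carrier V \<Longrightarrow> c \<odot>\<^bsub>V\<^esub> x \<in> carrier V"
    and vs_uminus: "\<And>x. x \<in> carrier V \<Longrightarrow> \<ominus>\<^bsub>V\<^esub> x \<in> carrier V"
    and vs_assoc: "\<And>x y z. x \<in> carrier V \<Longrightarrow> y \<in> carrier V \<Longrightarrow> z \<in> carrier V \<Longrightarrow>
          (x \<oplus>\<^bsub>V\<^esub> y) \<oplus>\<^bsub>V\<^esub> z = x \<oplus>\<^bsub>V\<^esub> (y \<oplus>\<^bsub>V\<^esub> z)"
    and vs_comm: "\<And>x y. x \<in> carrier V \<Longrightarrow> y \<in> carrier V \<Longrightarrow> x \<oplus>\<^bsub>V\<^esub> y = y \<oplus>\<^bsub>V\<^esub> x"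
    and vs_lcomm: "\<And>x y z. x \<in> carrier V \<Longrightarrow> y \<in> carrier V \<Longrightarrow> z \<in> carrier V \<Longrightarrow>
          x \<oplus>\<^bsub>V\<^esub> (y \<oplus>\<^bsub>V\<^esub> z) = y \<oplus>\<^bsub>V\<^esub> (x \<oplus>\<^bsub>V\<^esub> z)"
    and vs_lzero: "\<And>x. x \<in> carrier V \<Longrightarrow> \<zero>\<^bsub>V\<^esub> \<oplus>\<^bsub>V\<^esub> x = x"
    and vs_rzero: "\<And>x. x \<in> carrier V \<Longrightarrow> x \<oplus>\<^bsub>V\<^esub> \<zero>\<^bsub>V\<^esub> = x"
    and vs_smult_zero: "\<And>c. c \<odot>\<^bsub>V\<^esub> \<zero>\<^bsub>V\<^esub> = \<zero>\<^bsub>V\<^esub>"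
    and vs_zero_smult: "\<And>x. x \<in> carrier V \<Longrightarrow> 0 \<odot>\<^bsub>V\<^esub> x = \<zero>\<^bsub>V\<^esub>"
    and vs_one_smult: "\<And>x. x \<in> carrier V \<Longrightarrow> 1 \<odot>\<^bsub>V\<^esub> x = x"
    and vs_smult_add: "\<And>c x y. x \<in> carrier V \<Longrightarrow> y \<in> carrier V \<Longrightarrow>
          c \<odot>\<^bsub>V\<^esub> (x \<oplus>\<^bsub>V\<^esub> y) = c \<odot>\<^bsub>V\<^esub> x \<oplus>\<^bsub>V\<^esub> c \<odot>\<^bsub>V\<^esub> y"
    and vs_add_smult: "\<And>c d x. x \<in> carrier V \<Longrightarrow>
          (c + d) \<odot>\<^bsub>V\<^esub> x = c \<odot>\<^bsub>V\<^esub> x \<oplus>\<^bsub>V\<^esub> d \<odot>\<^bsub>V\<^esub> x"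
    and vs_smult_smult: "\<And>c d x. x \<in> carrier V \<Longrightarrow> c \<odot>\<^bsub>V\<^esub> (d \<odot>\<^bsub>V\<^esub> x) = (c * d) \<odot>\<^bsub>V\<^esub> x"
    and vs_uminus_eq: "\<And>x. x \<in> carrier V \<Longrightarrow> \<ominus>\<^bsub>V\<^esub> x = (- 1) \<odot>\<^bsub>V\<^esub> x"
proof -
  interpret vectorspace class_ring V by fact
  show "\<zero>\<^bsub>V\<^esub> \<in> carrier V" by simp
  show "\<And>x y. x \<in> carrier V \<Longrightarrow> y \<in> carrier V \<Longrightarrow> x \<oplus>\<^bsub>V\<^esub> y \<in> carrier V" by simp
  show sm: "\<And>c x. x \<in> carrier V \<Longrightarrow> c \<odot>\<^bsub>V\<^esub> x \<in> carrier V" using smult_closed by simp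
  show "\<And>x. x \<in> carrier V \<Longrightarrow> \<ominus>\<^bsub>V\<^esub> x \<in> carrier V" by simp
  show "\<And>x y z. x \<in> carrier V \<Longrightarrow> y \<in> carrier V \<Longrightarrow> z \<in> carrier V \<Longrightarrow>
          (x \<oplus>\<^bsub>V\<^esub> y) \<oplus>\<^bsub>V\<^esub> z = x \<oplus>\<^bsub>V\<^esub> (y \<oplus>\<^bsub>V\<^esub> z)" by (rule M.a_assoc)
  show "\<And>x y. x \<in> carrier V \<Longrightarrow> y \<in> carrier V \<Longrightarrow> x \<oplus>\<^bsub>V\<^esub> y = y \<oplus>\<^bsub>V\<^esub> x" by (rule M.a_comm)
  show "\<And>x y z. x \<in> carrier V \<Longrightarrow> y \<in> carrier V \<Longrightarrow> z \<in> carrier V \<Longrightarrow>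
          x \<oplus>\<^bsub>V\<^esub> (y \<oplus>\<^bsub>V\<^esub> z) = y \<oplus>\<^bsub>V\<^esub> (x \<oplus>\<^bsub>V\<^esub> z)" by (rule M.a_lcomm)
  show "\<And>x. x \<in> carrier V \<Longrightarrow> \<zero>\<^bsub>V\<^esub> \<oplus>\<^bsub>V\<^esub> x = x" by simp
  show "\<And>x. x \<in> carrier V \<Longrightarrow> x \<oplus>\<^bsub>V\<^esub> \<zero>\<^bsub>V\<^esub> = x" by simp
  show "\<And>c. c \<odot>\<^bsub>V\<^esub> \<zero>\<^bsub>V\<^esub> = \<zero>\<^bsub>V\<^esub>" using smult_r_null by simp
  show l0: "\<And>x. x \<in> carrier V \<Longrightarrow> 0 \<odot>\<^bsub>V\<^esub> x = \<zero>\<^bsub>V\<^esub>" using smult_l_null by simp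
  show one: "\<And>x. x \<in> carrier V \<Longrightarrow> 1 \<odot>\<^bsub>V\<^esub> x = x" using smult_one by simp
  show "\<And>c x y. x \<in> carrier V \<Longrightarrow> y \<in> carrier V \<Longrightarrow>
          c \<odot>\<^bsub>V\<^esub> (x \<oplus>\<^bsub>V\<^esub> y) = c \<odot>\<^bsub>V\<^esub> x \<oplus>\<^bsub>V\<^esub> c \<odot>\<^bsub>V\<^esub> y" using smult_r_distr by simp
  show ld: "\<And>c d x. x \<in> carrier V \<Longrightarrow> (c + d) \<odot>\<^bsub>V\<^esub> x = c \<odot>\<^bsub>V\<^esub> x \<oplus>\<^bsub>V\<^esub> d \<odot>\<^bsub>V\<^esub> x"
    using smult_l_distr by simp
  show "\<And>c d x. x \<in> carrier V \<Longrightarrow> c \<odot>\<^bsub>V\<^esub> (d \<odot>\<^bsub>V\<^esub> x) = (c * d) \<odot>\<^bsub>V\<^esub> x" using smult_assoc1 by simp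
  fix x assume x: "x \<in> carrier V"
  have "(- 1) \<odot>\<^bsub>V\<^esub> x \<oplus>\<^bsub>V\<^esub> x = \<zero>\<^bsub>V\<^esub>"
    using ld[OF x, of "-1" 1] one[OF x] l0[OF x] by simp
  then show "\<ominus>\<^bsub>V\<^esub> x = (- 1) \<odot>\<^bsub>V\<^esub> x"
    using M.minus_equality x sm by blast
qed

lemmas vs_closed = vs_zero vs_add vs_smult vs_uminus

lemma vsI:
  fixes V :: "('k::field, 'v) module"
  assumes zero: "\<zero>\<^bsub>V\<^esub> \<in> carrier V"
    and add: "\<And>x y. x \<in> carrier V \<Longrightarrow> y \<in> carrier V \<Longrightarrow> x \<oplus>\<^bsub>V\<^esub> y \<in> carrier V"
    and smult: "\<And>c x. x \<in> carrier V \<Longrightarrow> c \<odot>\<^bsub>V\<^esub> x \<in> carrier V"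
    and assoc: "\<And>x y z. x \<in> carrier V \<Longrightarrow> y \<in> carrier V \<Longrightarrow> z \<in> carrier V \<Longrightarrow>
          (x \<oplus>\<^bsub>V\<^esub> y) \<oplus>\<^bsub>V\<^esub> z = x \<oplus>\<^bsub>V\<^esub> (y \<oplus>\<^bsub>V\<^esub> z)"
    and comm: "\<And>x y. x \<in> carrier V \<Longrightarrow> y \<in> carrier V \<Longrightarrow> x \<oplus>\<^bsub>V\<^esub> y = y \<oplus>\<^bsub>V\<^esub> x"
    and lzero: "\<And>x. x \<in> carrier V \<Longrightarrow> \<zero>\<^bsub>V\<^esub> \<oplus>\<^bsub>V\<^esub> x = x"
    and zero_smult: "\<And>x. x \<in> carrier V \<Longrightarrow> 0 \<odot>\<^bsub>V\<^esub> x = \<zero>\<^bsub>V\<^esub>"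
    and one_smult: "\<And>x. x \<in> carrier V \<Longrightarrow> 1 \<odot>\<^bsub>V\<^esub> x = x"
    and smult_add: "\<And>c x y. x \<in> carrier V \<Longrightarrow> y \<in> carrier V \<Longrightarrow>
          c \<odot>\<^bsub>V\<^esub> (x \<oplus>\<^bsub>V\<^esub> y) = c \<odot>\<^bsub>V\<^esub> x \<oplus>\<^bsub>V\<^esub> c \<odot>\<^bsub>V\<^esub> y"
    and add_smult: "\<And>c d x. x \<in> carrier V \<Longrightarrow>
          (c + d) \<odot>\<^bsub>V\<^esub> x = c \<odot>\<^bsub>V\<^esub> x \<oplus>\<^bsub>V\<^esub> d \<odot>\<^bsub>V\<^esub> x"
    and smult_smult: "\<And>c d x. x \<in> carrier V \<Longrightarrow> c \<odot>\<^bsub>V\<^esub> (d \<odot>\<^bsub>V\<^esub> x) = (c * d) \<odot>\<^bsub>V\<^esub> x"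
  shows "is_vs V"
proof -
  have neg: "\<exists>y\<in>carrier V. y \<oplus>\<^bsub>V\<^esub> x = \<zero>\<^bsub>V\<^esub>" if "x \<in> carrier V" for x
    using add_smult[OF that, of "-1" 1] zero_smult[OF that] one_smult[OF that] smult[OF that, of "-1"]
    by (intro bexI[of _ "(-1) \<odot>\<^bsub>V\<^esub> x"]) auto
  have "abelian_group V"
    by (intro abelian_groupI add zero assoc comm lzero neg)
  then have "module class_ring V"
    using smult add_smult smult_add smult_smult one_smult class_cring.cring_axioms
    by (intro moduleI) auto
  then show ?thesis
    by (intro vectorspace.intro class_field)
qed

text \<open>Linearity without the extensionality of \<open>lin_maps\<close>, so that it applies to arbitrary terms
  such as \<open>\<lambda>x. f x \<oplus>\<^bsub>W\<^esub> g x\<close>.\<close>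

definition lin :: "('k::field, 'v) module \<Rightarrow> ('k, 'w) module \<Rightarrow> ('v \<Rightarrow> 'w) \<Rightarrow> bool" where
  "lin V W h \<longleftrightarrow> h \<in> LinearCombinations.module_hom class_ring V W"

lemma linI:
  assumes "\<And>x. x \<in> carrier V \<Longrightarrow> h x \<in> carrier W"
    and "\<And>x y. x \<in> carrier V \<Longrightarrow> y \<in> carrier V \<Longrightarrow> h (x \<oplus>\<^bsub>V\<^esub> y) = h x \<oplus>\<^bsub>W\<^esub> h y"
    and "\<And>c x. x \<in> carrier V \<Longrightarrow> h (c \<odot>\<^bsub>V\<^esub> x) = c \<odot>\<^bsub>W\<^esub> h x"
  shows "lin V W h"
  using assms by (auto simp: lin_def LinearCombinations.module_hom_def)

lemma
  assumes "lin V W h"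
  shows lin_closed: "\<And>x. x \<in> carrier V \<Longrightarrow> h x \<in> carrier W"
    and lin_add: "\<And>x y. x \<in> carrier V \<Longrightarrow> y \<in> carrier V \<Longrightarrow> h (x \<oplus>\<^bsub>V\<^esub> y) = h x \<oplus>\<^bsub>W\<^esub> h y"
    and lin_smult: "\<And>c x. x \<in> carrier V \<Longrightarrow> h (c \<odot>\<^bsub>V\<^esub> x) = c \<odot>\<^bsub>W\<^esub> h x"
  using assms by (auto simp: lin_def LinearCombinations.module_hom_def)

lemma lin_zero:
  assumes "lin V W h" "is_vs V" "is_vs W"
  shows "h \<zero>\<^bsub>V\<^esub> = \<zero>\<^bsub>W\<^esub>"
  using lin_smult[OF assms(1) vs_zero[OF assms(2)], of 0] assms
  by (simp add: vs_smult_zero vs_zero_smult lin_closed[OF assms(1)] vs_zero)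

lemma lin_cong:
  assumes "is_vs V" "lin V W h" "\<And>x. x \<in> carrier V \<Longrightarrow> h x = h' x"
  shows "lin V W h'"
proof (rule linI)
  fix x y c assume x: "x \<in> carrier V"
  show "h' x \<in> carrier W" using lin_closed[OF assms(2) x] assms(3)[OF x] by simp
  show "h' (c \<odot>\<^bsub>V\<^esub> x) = c \<odot>\<^bsub>W\<^esub> h' x"
    using lin_smult[OF assms(2) x] assms(3) x vs_smult[OF assms(1) x] by metis
  assume y: "y \<in> carrier V"
  show "h' (x \<oplus>\<^bsub>V\<^esub> y) = h' x \<oplus>\<^bsub>W\<^esub> h' y"
    using lin_add[OF assms(2) x y] assms(3) x y vs_add[OF assms(1) x y] by metis
qed

lemma lin_compose: "lin V W h \<Longrightarrow> lin W X k \<Longrightarrow> lin V X (\<lambda>x. k (h x))"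
  by (auto simp: lin_def LinearCombinations.module_hom_def Pi_iff)

lemma lin_id: "lin V V (\<lambda>x. x)"
  by (rule linI) simp_all

lemma lin_const_zero: "is_vs W \<Longrightarrow> lin V W (\<lambda>x. \<zero>\<^bsub>W\<^esub>)"
  by (rule linI) (simp_all add: vs_zero vs_lzero vs_smult_zero)

lemma lin_plus:
  assumes W: "is_vs W" and h: "lin V W h" and k: "lin V W k"
  shows "lin V W (\<lambda>x. h x \<oplus>\<^bsub>W\<^esub> k x)"
  by (rule linI)
     (simp_all add: vs_add[OF W] lin_closed[OF h] lin_closed[OF k] lin_add[OF h] lin_add[OF k]
       vs_assoc[OF W] vs_lcomm[OF W] lin_smult[OF h] lin_smult[OF k] vs_smult_add[OF W])

lemma lin_scale:
  assumes W: "is_vs W" and h: "lin V W h"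
  shows "lin V W (\<lambda>x. c \<odot>\<^bsub>W\<^esub> h x)"
  by (rule linI)
     (simp_all add: vs_smult[OF W] lin_closed[OF h] lin_add[OF h] lin_smult[OF h] vs_smult_add[OF W]
       vs_smult_smult[OF W] mult.commute)

lemma lin_neg:
  assumes W: "is_vs W" and V: "is_vs V" and h: "lin V W h"
  shows "lin V W (\<lambda>x. \<ominus>\<^bsub>W\<^esub> h x)"
  by (rule lin_cong[OF V lin_scale[OF W h, of "- 1"]]) (simp add: vs_uminus_eq[OF W] lin_closed[OF h])

lemma lin_maps_iff: "h \<in> lin_maps V W \<longleftrightarrow> lin V W h \<and> h \<in> extensional (carrier V)"
  by (simp add: lin_maps_def lin_def)

lemma lin_mapsD: "h \<in> lin_maps V W \<Longrightarrow> lin V W h"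
  by (simp add: lin_maps_iff)

lemma restrict_lin_maps:
  assumes "is_vs V" "lin V W h"
  shows "restrict h (carrier V) \<in> lin_maps V W"
  using lin_cong[OF assms, of "restrict h (carrier V)"] by (simp add: lin_maps_iff)

lemma lin_maps_eqI:
  assumes "h \<in> lin_maps V W" "h' \<in> lin_maps V W'" "\<And>x. x \<in> carrier V \<Longrightarrow> h x = h' x"
  shows "h = h'"
  using assms by (auto simp: lin_maps_iff intro: extensionalityI)

lemma compose_lin_maps:
  assumes "is_vs V" "lin V W h" "lin W X k"
  shows "compose (carrier V) k h \<in> lin_maps V X"
  unfolding compose_def by (rule restrict_lin_maps[OF assms(1) lin_compose[OF assms(2,3)]])

lemma id_map_lin_maps: "is_vs V \<Longrightarrow> id_map V \<in> lin_maps V V"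
  unfolding id_map_def by (rule restrict_lin_maps[OF _ lin_id])

lemma zero_map_lin_maps: "is_vs V \<Longrightarrow> is_vs W \<Longrightarrow> zero_map V W \<in> lin_maps V W"
  unfolding zero_map_def by (rule restrict_lin_maps[OF _ lin_const_zero])


subsection \<open>Finite sums\<close>

text \<open>Sums over lists rather than over finite sets: families of vectors with repetitions need no index set.\<close>

definition vsum :: "('k::field, 'v) module \<Rightarrow> 'v list \<Rightarrow> 'v" where
  "vsum V xs = foldr (\<lambda>x y. x \<oplus>\<^bsub>V\<^esub> y) xs \<zero>\<^bsub>V\<^esub>"

lemma vsum_simps [simp]: "vsum V [] = \<zero>\<^bsub>V\<^esub>" "vsum V (x # xs) = x \<oplus>\<^bsub>V\<^esub> vsum V xs"
  by (simp_all add: vsum_def)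

lemma vsum_closed: "is_vs V \<Longrightarrow> set xs \<subseteq> carrier V \<Longrightarrow> vsum V xs \<in> carrier V"
  by (induction xs) (simp_all add: vs_zero vs_add)

lemma vsum_append:
  "is_vs V \<Longrightarrow> set xs \<subseteq> carrier V \<Longrightarrow> set ys \<subseteq> carrier V \<Longrightarrow>
    vsum V (xs @ ys) = vsum V xs \<oplus>\<^bsub>V\<^esub> vsum V ys"
  by (induction xs) (simp_all add: vs_lzero vs_assoc vsum_closed)

lemma vsum_concat:
  "is_vs V \<Longrightarrow> \<forall>xs\<in>set xss. set xs \<subseteq> carrier V \<Longrightarrow> vsum V (concat xss) = vsum V (map (vsum V) xss)"
proof (induction xss)
  case (Cons xs xss)
  moreover have "set (concat xss) \<subseteq> carrier V" using Cons.prems by auto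
  ultimately show ?case by (simp add: vsum_append)
qed simp

lemma lin_vsum:
  assumes h: "lin V W h" and V: "is_vs V" and W: "is_vs W"
  shows "set xs \<subseteq> carrier V \<Longrightarrow> h (vsum V xs) = vsum W (map h xs)"
  by (induction xs) (simp_all add: lin_zero[OF assms] lin_add[OF h] vsum_closed[OF V])

lemma lin_vsum_fun:
  assumes "is_vs W" "\<And>p. p \<in> set ps \<Longrightarrow> lin V W (f p)"
  shows "lin V W (\<lambda>x. vsum W (map (\<lambda>p. f p x) ps))"
  using assms(2)
proof (induction ps)
  case Nil
  then show ?case using assms(1) by (simp add: lin_const_zero)
next
  case (Cons p ps)
  then show ?case using lin_plus[OF assms(1), of V "f p"] by simp
qed


subsection \<open>Generating sets\<close>

text \<open>The linear span as an inductive set: linear identities are proved on a spanning set by rule induction.\<close>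

inductive_set lspan :: "('k::field, 'v) module \<Rightarrow> 'v set \<Rightarrow> 'v set" for V S where
  lspan_zero: "\<zero>\<^bsub>V\<^esub> \<in> lspan V S"
| lspan_base: "x \<in> S \<Longrightarrow> x \<in> lspan V S"
| lspan_add: "x \<in> lspan V S \<Longrightarrow> y \<in> lspan V S \<Longrightarrow> x \<oplus>\<^bsub>V\<^esub> y \<in> lspan V S"
| lspan_smult: "x \<in> lspan V S \<Longrightarrow> c \<odot>\<^bsub>V\<^esub> x \<in> lspan V S"

definition generates :: "'v set \<Rightarrow> ('k::field, 'v) module \<Rightarrow> bool" where
  "generates S V \<longleftrightarrow> S \<subseteq> carrier V \<and> carrier V \<subseteq> lspan V S"

lemma lspan_closed: "is_vs V \<Longrightarrow> S \<subseteq> carrier V \<Longrightarrow> x \<in> lspan V S \<Longrightarrow> x \<in> carrier V"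
  by (rotate_tac 2, induction rule: lspan.induct) (auto simp: vs_closed)

lemma generatesD: "generates S V \<Longrightarrow> x \<in> S \<Longrightarrow> x \<in> carrier V"
  by (auto simp: generates_def)

lemma generates_induct [consumes 3, case_names zero base add smult]:
  assumes V: "is_vs V" and S: "generates S V" and x: "x \<in> carrier V"
    and zero: "P \<zero>\<^bsub>V\<^esub>"
    and base: "\<And>x. x \<in> S \<Longrightarrow> P x"
    and add: "\<And>x y. x \<in> carrier V \<Longrightarrow> y \<in> carrier V \<Longrightarrow> P x \<Longrightarrow> P y \<Longrightarrow> P (x \<oplus>\<^bsub>V\<^esub> y)"
    and smult: "\<And>c x. x \<in> carrier V \<Longrightarrow> P x \<Longrightarrow> P (c \<odot>\<^bsub>V\<^esub> x)"
  shows "P x"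
proof -
  have "x \<in> lspan V S" using S x by (auto simp: generates_def)
  then have "x \<in> carrier V \<and> P x"
  proof induction
    case (lspan_base x)
    then show ?case using S base by (auto simp: generates_def)
  qed (auto simp: vs_closed[OF V] zero add smult)
  then show ?thesis ..
qed

lemma lin_eq_on_generators:
  assumes "is_vs V" "is_vs W" "generates S V" "lin V W h" "lin V W k" "\<And>x. x \<in> S \<Longrightarrow> h x = k x"
    and "x \<in> carrier V"
  shows "h x = k x"
  using assms(1,3,7)
proof (induction rule: generates_induct)
  case zero
  show ?case using lin_zero[OF assms(4,1,2)] lin_zero[OF assms(5,1,2)] by simp
qed (simp_all add: assms(6) lin_add[OF assms(4)] lin_add[OF assms(5)] lin_smult[OF assms(4)] lin_smult[OF assms(5)])

lemma lin_maps_eq_on_generators: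
  assumes "is_vs V" "is_vs W" "generates S V" "h \<in> lin_maps V W" "k \<in> lin_maps V W"
    "\<And>x. x \<in> S \<Longrightarrow> h x = k x"
  shows "h = k"
  by (rule lin_maps_eqI[OF assms(4,5)])
     (rule lin_eq_on_generators[OF assms(1-3) lin_mapsD[OF assms(4)] lin_mapsD[OF assms(5)] assms(6)])

lemma generates_trans:
  assumes V: "is_vs V" and S: "generates S V" and T: "T \<subseteq> carrier V" and sub: "S \<subseteq> lspan V T"
  shows "generates T V"
  unfolding generates_def
proof (intro conjI T subsetI)
  fix x assume "x \<in> carrier V"
  with V S show "x \<in> lspan V T"
    by (induction rule: generates_induct) (use sub in \<open>auto intro: lspan.intros\<close>)
qed

lemma lin_image_lspan:
  assumes "lin V W h" "is_vs V" "is_vs W" "S \<subseteq> carrier V" "x \<in> lspan V S" "h ` S \<subseteq> lspan W T"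
  shows "h x \<in> lspan W T"
  using assms(5)
proof induction
  case lspan_zero
  show ?case using lin_zero[OF assms(1-3)] by (simp add: lspan.lspan_zero)
next
  case (lspan_base x)
  then show ?case using assms(6) by auto
next
  case (lspan_add x y)
  then show ?case
    using lin_add[OF assms(1)] lspan_closed[OF assms(2,4)] by (simp add: lspan.lspan_add)
next
  case (lspan_smult x c)
  then show ?case
    using lin_smult[OF assms(1)] lspan_closed[OF assms(2,4)] by (simp add: lspan.lspan_smult)
qed


subsection \<open>The scalars and spaces of functions\<close>

lemma scalars_simps [simp]:
  "carrier scalars = UNIV" "\<zero>\<^bsub>scalars\<^esub> = 0" "x \<oplus>\<^bsub>scalars\<^esub> y = x + y" "c \<odot>\<^bsub>scalars\<^esub> x = c * x"
  by (simp_all add: scalars_def)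

lemma scalars_vs: "is_vs (scalars :: ('k::field, 'k) module)"
  by (rule vsI) (simp_all add: algebra_simps)

lemma func_space_simps [simp]:
  "carrier (ring.func_space (class_ring :: 'k::field ring) S) = S \<rightarrow>\<^sub>E UNIV"
  "\<zero>\<^bsub>ring.func_space (class_ring :: 'k::field ring) S\<^esub> = (\<lambda>x\<in>S. 0)"
  "f \<oplus>\<^bsub>ring.func_space (class_ring :: 'k::field ring) S\<^esub> g = (\<lambda>x\<in>S. f x + g x)"
  "c \<odot>\<^bsub>ring.func_space (class_ring :: 'k::field ring) S\<^esub> f = (\<lambda>x\<in>S. c * f x)"
  by (simp_all add: class_ring.func_space_def)

lemma func_subspace_vs:
  fixes S :: "'z set" and U :: "('z \<Rightarrow> 'k::field) set"
  assumes U: "U \<subseteq> S \<rightarrow>\<^sub>E UNIV" and zero: "(\<lambda>x\<in>S. 0) \<in> U"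
    and add: "\<And>f g. f \<in> U \<Longrightarrow> g \<in> U \<Longrightarrow> (\<lambda>x\<in>S. f x + g x) \<in> U"
    and smult: "\<And>c f. f \<in> U \<Longrightarrow> (\<lambda>x\<in>S. c * f x) \<in> U"
  shows "is_vs ((ring.func_space class_ring S) \<lparr>carrier := U\<rparr>)"
proof -
  have E: "(\<lambda>x\<in>S. f x) = f" if "f \<in> U" for f
    using that U by (auto simp: PiE_def extensional_restrict)
  show ?thesis
    by (rule vsI) (simp_all add: zero add smult E algebra_simps cong: restrict_cong)
qed

lemma functionals_simps [simp]:
  "carrier (functionals V) = lin_maps V scalars"
  "\<zero>\<^bsub>functionals V\<^esub> = (\<lambda>x\<in>carrier V. 0)"
  "f \<oplus>\<^bsub>functionals V\<^esub> g = (\<lambda>x\<in>carrier V. f x + g x)"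
  "c \<odot>\<^bsub>functionals V\<^esub> f = (\<lambda>x\<in>carrier V. c * f x)"
  by (simp_all add: functionals_def)

lemma functionals_vs:
  assumes V: "is_vs V"
  shows "is_vs (functionals V)"
  unfolding functionals_def
proof (rule func_subspace_vs)
  show "lin_maps V scalars \<subseteq> carrier V \<rightarrow>\<^sub>E UNIV"
    by (auto simp: lin_maps_iff PiE_def)
  show "(\<lambda>x\<in>carrier V. 0) \<in> lin_maps V scalars"
    using restrict_lin_maps[OF V lin_const_zero[OF scalars_vs]] by simp
  show "(\<lambda>x\<in>carrier V. f x + g x) \<in> lin_maps V scalars"
    if "f \<in> lin_maps V scalars" "g \<in> lin_maps V scalars" for f g
    using restrict_lin_maps[OF V lin_plus[OF scalars_vs]] that by (simp add: lin_maps_iff)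
  show "(\<lambda>x\<in>carrier V. c * f x) \<in> lin_maps V scalars" if "f \<in> lin_maps V scalars" for c f
    using restrict_lin_maps[OF V lin_scale[OF scalars_vs]] that by (simp add: lin_maps_iff)
qed

lemma vsum_scalars [simp]: "vsum scalars xs = sum_list xs"
  by (induction xs) simp_all


subsection \<open>Extending maps from generators\<close>

text \<open>The graph of the linear extension of \<open>x i \<mapsto> y i\<close>, as the span of the pairs \<open>(x i, y i)\<close>.\<close>

inductive ext_graph ::
  "('k::field, 'v) module \<Rightarrow> ('k, 'w) module \<Rightarrow> 'i set \<Rightarrow> ('i \<Rightarrow> 'v) \<Rightarrow> ('i \<Rightarrow> 'w) \<Rightarrow> 'v \<Rightarrow> 'w \<Rightarrow> bool"
  for X Y I x y where
  "ext_graph X Y I x y \<zero>\<^bsub>X\<^esub> \<zero>\<^bsub>Y\<^esub>"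
| "i \<in> I \<Longrightarrow> ext_graph X Y I x y (x i) (y i)"
| "ext_graph X Y I x y a b \<Longrightarrow> ext_graph X Y I x y a' b' \<Longrightarrow>
    ext_graph X Y I x y (a \<oplus>\<^bsub>X\<^esub> a') (b \<oplus>\<^bsub>Y\<^esub> b')"
| "ext_graph X Y I x y a b \<Longrightarrow> ext_graph X Y I x y (c \<odot>\<^bsub>X\<^esub> a) (c \<odot>\<^bsub>Y\<^esub> b)"

text \<open>The functionals in \<open>F\<close> separate the points of \<open>Y\<close>, and each of them has a companion \<open>g\<close> on \<open>X\<close>
  with the same values on corresponding generators. The equation \<open>g a = f b\<close> then holds for all \<open>(a, b)\<close> in the span
  of the pairs \<open>(x i, y i)\<close>, so that \<open>a\<close> determines \<open>b\<close> and the span is the graph of a map.\<close>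

lemma lin_extend:
  assumes X: "is_vs X" and Y: "is_vs Y" and gen: "generates (x ` I) X"
    and y: "\<And>i. i \<in> I \<Longrightarrow> y i \<in> carrier Y"
    and sep: "\<And>b b'. b \<in> carrier Y \<Longrightarrow> b' \<in> carrier Y \<Longrightarrow> (\<And>f. f \<in> F \<Longrightarrow> f b = f b') \<Longrightarrow> b = b'"
    and comp: "\<And>f. f \<in> F \<Longrightarrow> lin Y scalars f \<and> (\<exists>g. lin X scalars g \<and> (\<forall>i\<in>I. g (x i) = f (y i)))"
  shows "\<exists>h\<in>lin_maps X Y. \<forall>i\<in>I. h (x i) = y i"
proof -
  let ?G = "ext_graph X Y I x y"
  have closed: "a \<in> carrier X \<and> b \<in> carrier Y" if "?G a b" for a b
    using that by induction (use gen in \<open>auto simp: vs_closed X Y y generates_def\<close>)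
  (* companion functionals agree along the graph *)
  have func: "g a = f b" if "?G a b" "lin Y scalars f" "lin X scalars g" "\<forall>i\<in>I. g (x i) = f (y i)" for a b f g
    using that(1)
  proof induction
    case 1
    then show ?case using lin_zero[OF that(2) Y scalars_vs] lin_zero[OF that(3) X scalars_vs] by simp
  next
    case (3 a b a' b')
    then show ?case using lin_add[OF that(2)] lin_add[OF that(3)] closed by simp
  next
    case (4 a b c)
    then show ?case using lin_smult[OF that(2)] lin_smult[OF that(3)] closed by simp
  qed (use that(4) in simp)
  have unique: "b = b'" if "?G a b" "?G a b'" for a b b'
    using that closed comp func by (intro sep) metis+
  have total: "\<exists>b. ?G a b" if "a \<in> carrier X" for a
    using X gen that
    by (induction rule: generates_induct) (auto intro: ext_graph.intros)
  define h where "h = (\<lambda>a\<in>carrier X. THE b. ?G a b)"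
  have h: "h a = b" if "?G a b" for a b
    using that closed unique by (auto simp: h_def intro!: the_equality)
  have hG: "?G a (h a)" if "a \<in> carrier X" for a
    using total[OF that] h by auto
  have "lin X Y h"
  proof (rule linI)
    show "h a \<in> carrier Y" if "a \<in> carrier X" for a
      using hG[OF that] closed by auto
    show "h (a \<oplus>\<^bsub>X\<^esub> a') = h a \<oplus>\<^bsub>Y\<^esub> h a'" if "a \<in> carrier X" "a' \<in> carrier X" for a a'
      by (intro h ext_graph.intros hG that)
    show "h (c \<odot>\<^bsub>X\<^esub> a) = c \<odot>\<^bsub>Y\<^esub> h a" if "a \<in> carrier X" for a c
      by (intro h ext_graph.intros hG that)
  qed
  then have "h \<in> lin_maps X Y"
    by (simp add: lin_maps_iff h_def)
  moreover have "\<forall>i\<in>I. h (x i) = y i"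
    by (intro ballI h ext_graph.intros)
  ultimately show ?thesis by blast
qed


subsection \<open>Dual bases\<close>

text \<open>Vectors \<open>b\<close> and functionals \<open>\<phi>\<close> with \<open>v = \<Sum> \<phi>(v) b\<close>. The expansion formula
  gives coordinates, separation of points by functionals and finite dimension, and it is inherited by
  duals and tensor products.\<close>

definition dual_basis :: "('k::field, 'v) module \<Rightarrow> ('v \<times> ('v \<Rightarrow> 'k)) list \<Rightarrow> bool" where
  "dual_basis V D \<longleftrightarrow> (\<forall>(b, \<phi>)\<in>set D. b \<in> carrier V \<and> lin V scalars \<phi>) \<and>
     (\<forall>v\<in>carrier V. v = vsum V (map (\<lambda>(b, \<phi>). \<phi> v \<odot>\<^bsub>V\<^esub> b) D))"

lemma dual_basisI:
  assumes "\<And>p. p \<in> set D \<Longrightarrow> fst p \<in> carrier V"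
    and "\<And>p. p \<in> set D \<Longrightarrow> lin V scalars (snd p)"
    and "\<And>v. v \<in> carrier V \<Longrightarrow> vsum V (map (\<lambda>p. snd p v \<odot>\<^bsub>V\<^esub> fst p) D) = v"
  shows "dual_basis V D"
  using assms by (fastforce simp: dual_basis_def case_prod_unfold)

lemma dual_basis_closed:
  "dual_basis V D \<Longrightarrow> (b, \<phi>) \<in> set D \<Longrightarrow> b \<in> carrier V \<and> lin V scalars \<phi>"
  by (auto simp: dual_basis_def)

lemma dual_basis_expand:
  "dual_basis V D \<Longrightarrow> v \<in> carrier V \<Longrightarrow> vsum V (map (\<lambda>(b, \<phi>). \<phi> v \<odot>\<^bsub>V\<^esub> b) D) = v"
  by (auto simp: dual_basis_def)

lemma dual_basis_separates:
  assumes "dual_basis V D" "v \<in> carrier V" "w \<in> carrier V"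
    and "\<And>b \<phi>. (b, \<phi>) \<in> set D \<Longrightarrow> \<phi> v = \<phi> w"
  shows "v = w"
proof -
  have "map (\<lambda>(b, \<phi>). \<phi> v \<odot>\<^bsub>V\<^esub> b) D = map (\<lambda>(b, \<phi>). \<phi> w \<odot>\<^bsub>V\<^esub> b) D"
  proof (rule map_cong[OF refl])
    fix p assume "p \<in> set D"
    then show "(case p of (b, \<phi>) \<Rightarrow> \<phi> v \<odot>\<^bsub>V\<^esub> b) = (case p of (b, \<phi>) \<Rightarrow> \<phi> w \<odot>\<^bsub>V\<^esub> b)"
      using assms(4)[of "fst p" "snd p"] by (simp add: case_prod_unfold)
  qed
  then show ?thesis
    using dual_basis_expand[OF assms(1,2)] dual_basis_expand[OF assms(1,3)] by metis
qed

lemma dual_basis_lin: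
  assumes D: "dual_basis V D" and V: "is_vs V" and W: "is_vs W" and h: "lin V W h" and v: "v \<in> carrier V"
  shows "h v = vsum W (map (\<lambda>(b, \<phi>). \<phi> v \<odot>\<^bsub>W\<^esub> h b) D)"
proof -
  have "h v = h (vsum V (map (\<lambda>(b, \<phi>). \<phi> v \<odot>\<^bsub>V\<^esub> b) D))"
    using dual_basis_expand[OF D v] by simp
  also have "\<dots> = vsum W (map h (map (\<lambda>(b, \<phi>). \<phi> v \<odot>\<^bsub>V\<^esub> b) D))"
    by (rule lin_vsum[OF h V W]) (use dual_basis_closed[OF D] vs_smult[OF V] in auto)
  also have "map h (map (\<lambda>(b, \<phi>). \<phi> v \<odot>\<^bsub>V\<^esub> b) D) = map (\<lambda>(b, \<phi>). \<phi> v \<odot>\<^bsub>W\<^esub> h b) D"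
    using dual_basis_closed[OF D] lin_smult[OF h] by auto
  finally show ?thesis .
qed

lemma vsum_combination_add:
  "is_vs V \<Longrightarrow> set xs \<subseteq> carrier V \<Longrightarrow>
    vsum V (map (\<lambda>b. (f b + g b) \<odot>\<^bsub>V\<^esub> b) xs) =
    vsum V (map (\<lambda>b. f b \<odot>\<^bsub>V\<^esub> b) xs) \<oplus>\<^bsub>V\<^esub> vsum V (map (\<lambda>b. g b \<odot>\<^bsub>V\<^esub> b) xs)"
proof (induction xs)
  case (Cons b xs)
  have "set (map (\<lambda>b. f b \<odot>\<^bsub>V\<^esub> b) xs) \<subseteq> carrier V" "set (map (\<lambda>b. g b \<odot>\<^bsub>V\<^esub> b) xs) \<subseteq> carrier V"
    using Cons.prems vs_smult[OF Cons.prems(1)] by auto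
  then show ?case
    using Cons by (simp add: vs_add_smult vs_assoc vs_lcomm vs_smult vs_add vsum_closed)
qed (simp add: vs_zero vs_lzero)

lemma vsum_combination_smult:
  "is_vs V \<Longrightarrow> set xs \<subseteq> carrier V \<Longrightarrow>
    vsum V (map (\<lambda>b. (c * f b) \<odot>\<^bsub>V\<^esub> b) xs) = c \<odot>\<^bsub>V\<^esub> vsum V (map (\<lambda>b. f b \<odot>\<^bsub>V\<^esub> b) xs)"
proof (induction xs)
  case (Cons b xs)
  have "set (map (\<lambda>b. f b \<odot>\<^bsub>V\<^esub> b) xs) \<subseteq> carrier V"
    using Cons.prems vs_smult[OF Cons.prems(1)] by auto
  then show ?case
    using Cons by (simp add: vs_smult_add vs_smult_smult vs_smult vsum_closed)
qed (simp add: vs_smult_zero)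

lemma fd_space_vs: "fd_space V \<Longrightarrow> is_vs V"
  by (simp add: fd_space_def)

text \<open>The coordinates with respect to a basis are functionals because they are unique.\<close>

lemma fd_space_dual_basis:
  fixes V :: "('k::field, 'v) module"
  assumes "fd_space V"
  shows "\<exists>D. dual_basis V D"
proof -
  have V: "is_vs V" using assms by (simp add: fd_space_def)
  interpret vectorspace class_ring V by (rule V)
  have "fin_dim" using assms by (simp add: fd_space_def)
  then obtain A where "finite A" and A: "basis A" using finite_basis_exists by blast
  then obtain xs where xs: "set xs = A" "distinct xs" using finite_distinct_list by blast
  have sub: "set xs \<subseteq> carrier V" using A xs by (simp add: basis_def)
  have fs: "finsum V f (set ys) = vsum V (map f ys)"
    if "distinct ys" "f ` set ys \<subseteq> carrier V" for f and ys :: "'v list"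
    using that by (induction ys) (simp_all add: Pi_iff image_subset_iff)
  have lc: "lincomb a A = vsum V (map (\<lambda>b. a b \<odot>\<^bsub>V\<^esub> b) xs)" for a :: "'v \<Rightarrow> 'k"
    unfolding lincomb_def xs(1)[symmetric] using sub vs_smult[OF V] by (intro fs xs(2)) auto
  have ex1: "\<exists>!a. a \<in> A \<rightarrow>\<^sub>E UNIV \<and> vsum V (map (\<lambda>b. a b \<odot>\<^bsub>V\<^esub> b) xs) = v" if "v \<in> carrier V" for v
  proof -
    have "\<forall>v. v \<in> carrier V \<longrightarrow> (\<exists>!a. a \<in> A \<rightarrow>\<^sub>E carrier class_ring \<and> lincomb a A = v)"
      using basis_criterion[of A] A \<open>finite A\<close> by (auto simp: basis_def)
    then show ?thesis using that by (simp add: lc)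
  qed
  define a where "a v = (THE a. a \<in> A \<rightarrow>\<^sub>E UNIV \<and> vsum V (map (\<lambda>b. a b \<odot>\<^bsub>V\<^esub> b) xs) = v)" for v
  have aE: "a v \<in> A \<rightarrow>\<^sub>E UNIV" and av: "vsum V (map (\<lambda>b. a v b \<odot>\<^bsub>V\<^esub> b) xs) = v"
    if "v \<in> carrier V" for v
    using theI'[OF ex1[OF that]] by (auto simp: a_def)
  have aI: "a v b = f b" if "v \<in> carrier V" "vsum V (map (\<lambda>b. f b \<odot>\<^bsub>V\<^esub> b) xs) = v" "b \<in> A" for v f b
  proof -
    have "vsum V (map (\<lambda>b. restrict f A b \<odot>\<^bsub>V\<^esub> b) xs) = v"
      using that(2) by (simp add: xs(1)[symmetric] cong: map_cong)
    then have "a v = restrict f A"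
      unfolding a_def by (intro the1_equality ex1 that(1)) auto
    then show ?thesis using that(3) by simp
  qed
  have "lin V scalars (\<lambda>v. a v b)" if "b \<in> A" for b
  proof (rule linI)
    show "a (v \<oplus>\<^bsub>V\<^esub> w) b = a v b \<oplus>\<^bsub>scalars\<^esub> a w b" if "v \<in> carrier V" "w \<in> carrier V" for v w
    proof -
      have "a (v \<oplus>\<^bsub>V\<^esub> w) b = (\<lambda>b. a v b + a w b) b"
        by (rule aI) (simp_all add: vsum_combination_add[OF V sub] av vs_add[OF V] that \<open>b \<in> A\<close>)
      then show ?thesis by simp
    qed
    show "a (c \<odot>\<^bsub>V\<^esub> v) b = c \<odot>\<^bsub>scalars\<^esub> a v b" if "v \<in> carrier V" for c v
    proof -
      have "a (c \<odot>\<^bsub>V\<^esub> v) b = (\<lambda>b. c * a v b) b"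
        by (rule aI) (simp_all add: vsum_combination_smult[OF V sub] av vs_smult[OF V] that \<open>b \<in> A\<close>)
      then show ?thesis by simp
    qed
  qed simp
  then have "dual_basis V (map (\<lambda>b. (b, \<lambda>v. a v b)) xs)"
    unfolding dual_basis_def using sub xs av by (auto simp: comp_def)
  then show ?thesis ..
qed

lemma fd_spaceI:
  fixes V :: "('k::field, 'v) module"
  assumes V: "is_vs V" and D: "dual_basis V D"
  shows "fd_space V"
proof -
  interpret vectorspace class_ring V by (rule V)
  let ?S = "fst ` set D"
  have S: "?S \<subseteq> carrier V" using D by (auto simp: dual_basis_def)
  have sm: "submodule class_ring (span ?S) V" by (rule span_is_submodule[OF S])
  have sums: "vsum V xs \<in> span ?S" if "set xs \<subseteq> span ?S" for xs
    using that by (induction xs) (simp_all add: submodule.zero_closed[OF sm] submodule.m_closed[OF sm])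
  have "v \<in> span ?S" if v: "v \<in> carrier V" for v
  proof -
    have "vsum V (map (\<lambda>(b, \<phi>). \<phi> v \<odot>\<^bsub>V\<^esub> b) D) \<in> span ?S"
      using in_own_span[OF S] submodule.smult_closed[OF sm] by (intro sums) force
    then show ?thesis by (simp add: dual_basis_expand[OF D v])
  qed
  then have "span ?S = carrier V" using span_is_subset2[OF S] by blast
  then have "fin_dim" unfolding fin_dim_def using S by (intro exI[of _ ?S]) simp
  then show ?thesis using V by (simp add: fd_space_def)
qed

lemma fd_functional_separates:
  assumes "fd_space V" "v \<in> carrier V" "w \<in> carrier V" "\<And>\<phi>. lin V scalars \<phi> \<Longrightarrow> \<phi> v = \<phi> w"
  shows "v = w"
proof -
  obtain D where D: "dual_basis V D" using fd_space_dual_basis[OF assms(1)] ..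
  show ?thesis
    by (rule dual_basis_separates[OF D assms(2,3)]) (use dual_basis_closed[OF D] assms(4) in blast)
qed

lemma scalars_fd: "fd_space (scalars :: ('k::field, 'k) module)"
  by (rule fd_spaceI[OF scalars_vs, of "[(1, \<lambda>x. x)]"]) (simp add: dual_basis_def lin_id)

text \<open>The roles of vectors and functionals are exchanged: \<open>f = \<Sum> f(b) \<phi>\<close>, which is the expansion of a vector with
  \<open>f\<close> applied to it.\<close>

lemma functionals_dual_basis:
  fixes V :: "('k::field, 'v) module"
  assumes V: "is_vs V" and D: "dual_basis V D"
  shows "dual_basis (functionals V) (map (\<lambda>(b, \<phi>). (restrict \<phi> (carrier V), \<lambda>f. f b)) D)"
proof -
  note F = functionals_vs[OF V]
  have sums: "vsum (functionals V) fs v = sum_list (map (\<lambda>f. f v) fs)"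
    if "v \<in> carrier V" "set fs \<subseteq> lin_maps V scalars" for fs v
    using that by (induction fs) simp_all
  let ?r = "\<lambda>\<phi>. restrict \<phi> (carrier V)"
  let ?E = "map (\<lambda>(b, \<phi>). (?r \<phi>, \<lambda>f. f b :: 'k)) D"
  have "dual_basis (functionals V) ?E"
  proof (rule dual_basisI)
    fix p assume "p \<in> set ?E"
    then obtain c \<psi> where p: "p = (?r \<psi>, \<lambda>f. f c)" and c: "(c, \<psi>) \<in> set D" by auto
    show "lin (functionals V) scalars (snd p)"
      unfolding p by (rule linI) (use dual_basis_closed[OF D c] in auto)
    show "fst p \<in> carrier (functionals V)"
      using dual_basis_closed[OF D c] restrict_lin_maps[OF V] by (auto simp: p)
  next
    fix f assume f: "f \<in> carrier (functionals V)"
    let ?s = "map (\<lambda>p. snd p f \<odot>\<^bsub>functionals V\<^esub> fst p) ?E"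
    have s: "set ?s \<subseteq> carrier (functionals V)"
      by (auto simp del: functionals_simps(4) dest: dual_basis_closed[OF D]
          intro!: vs_smult[OF F, unfolded functionals_simps(1)] restrict_lin_maps[OF V])
    show "vsum (functionals V) ?s = f"
    proof (rule lin_maps_eqI[where V = V, symmetric])
      show "f \<in> lin_maps V scalars" using f by simp
      show "vsum (functionals V) ?s \<in> lin_maps V scalars"
        using vsum_closed[OF F s] by simp
      fix v assume v: "v \<in> carrier V"
      have "f v = sum_list (map (\<lambda>(b, \<phi>). \<phi> v * f b) D)"
        using dual_basis_lin[OF D V scalars_vs _ v, of f] f by (simp add: lin_maps_iff case_prod_unfold)
      also have "\<dots> = sum_list (map (\<lambda>f. f v) ?s)"
        using v by (simp add: comp_def case_prod_unfold mult.commute)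
      also have "\<dots> = vsum (functionals V) ?s v"
        by (rule sums[OF v, symmetric]) (use s in simp)
      finally show "f v = vsum (functionals V) ?s v" .
    qed
  qed
  then show ?thesis .
qed

lemma functionals_fd: "fd_space V \<Longrightarrow> fd_space (functionals V)"
  using fd_space_dual_basis fd_spaceI functionals_dual_basis functionals_vs fd_space_vs by metis


subsection \<open>Isomorphic copies\<close>

lemma lin_isoD:
  assumes "lin_iso V W f"
  shows "lin V W f" "inj_on f (carrier V)" "f ` carrier V = carrier W" "f \<in> lin_maps V W"
  using assms by (auto simp: lin_iso_def lin_maps_iff bij_betw_def)

lemma lin_iso_inv_into:
  assumes "lin_iso V W f" "x \<in> carrier W"
  shows "inv_into (carrier V) f x \<in> carrier V" "f (inv_into (carrier V) f x) = x"
  using assms lin_isoD[OF assms(1)] by (metis inv_into_into, metis f_inv_into_f)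

lemma lin_iso_inv_into_left:
  "lin_iso V W f \<Longrightarrow> x \<in> carrier V \<Longrightarrow> inv_into (carrier V) f (f x) = x"
  using lin_isoD(2) by (metis inv_into_f_f)

lemma lin_iso_inverse:
  assumes f: "lin_iso V W f" and V: "is_vs V"
  shows "lin W V (inv_into (carrier V) f)"
proof (rule linI)
  let ?g = "inv_into (carrier V) f"
  note g = lin_iso_inv_into[OF f]
  show "?g x \<in> carrier V" if "x \<in> carrier W" for x
    by (rule g(1)[OF that])
  show "?g (x \<oplus>\<^bsub>W\<^esub> y) = ?g x \<oplus>\<^bsub>V\<^esub> ?g y" if "x \<in> carrier W" "y \<in> carrier W" for x y
    using lin_add[OF lin_isoD(1)[OF f], of "?g x" "?g y"] g that
      lin_iso_inv_into_left[OF f, of "?g x \<oplus>\<^bsub>V\<^esub> ?g y"] vs_add[OF V] by simp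
  show "?g (c \<odot>\<^bsub>W\<^esub> x) = c \<odot>\<^bsub>V\<^esub> ?g x" if "x \<in> carrier W" for c x
    using lin_smult[OF lin_isoD(1)[OF f], of "?g x"] g that
      lin_iso_inv_into_left[OF f, of "c \<odot>\<^bsub>V\<^esub> ?g x"] vs_smult[OF V] by simp
qed

lemma lin_iso_dual_basis:
  assumes f: "lin_iso V W f" and VV: "is_vs V" and W: "is_vs W" and D: "dual_basis V D"
  shows "dual_basis W (map (\<lambda>(b, \<phi>). (f b, \<lambda>x. \<phi> (inv_into (carrier V) f x))) D)"
proof -
  let ?g = "inv_into (carrier V) f"
  have "dual_basis W (map (\<lambda>(b, \<phi>). (f b, \<lambda>x. \<phi> (?g x))) D)"
  proof (rule dual_basisI)
    fix p assume "p \<in> set (map (\<lambda>(b, \<phi>). (f b, \<lambda>x. \<phi> (?g x))) D)"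
    then obtain c \<psi> where p: "p = (f c, \<lambda>x. \<psi> (?g x))" and c: "(c, \<psi>) \<in> set D" by auto
    show "fst p \<in> carrier W" "lin W scalars (snd p)"
      using dual_basis_closed[OF D c] lin_closed[OF lin_isoD(1)[OF f]] lin_compose[OF lin_iso_inverse[OF f VV]]
      by (auto simp: p)
  next
    fix x assume x: "x \<in> carrier W"
    show "vsum W (map (\<lambda>p. snd p x \<odot>\<^bsub>W\<^esub> fst p) (map (\<lambda>(b, \<phi>). (f b, \<lambda>x. \<phi> (?g x))) D)) = x"
      using dual_basis_lin[OF D VV W lin_isoD(1)[OF f] lin_iso_inv_into(1)[OF f x]]
        lin_iso_inv_into(2)[OF f x] by (simp add: case_prod_unfold comp_def)
  qed
  then show ?thesis .
qed

lemma lin_iso_fd: "lin_iso V W f \<Longrightarrow> fd_space V \<Longrightarrow> is_vs W \<Longrightarrow> fd_space W"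
  using fd_space_dual_basis fd_spaceI lin_iso_dual_basis fd_space_vs by metis

lemma transport_structure:
  fixes V :: "('k::field, 'v) module" and f :: "'v \<Rightarrow> 'u"
  assumes V: "is_vs V" and inj: "inj_on f (carrier V)"
  shows "\<exists>(W :: ('k, 'u) module) f. is_vs W \<and> lin_iso V W f"
proof -
  let ?g = "inv_into (carrier V) f"
  define W :: "('k, 'u) module" where
    "W = \<lparr>carrier = f ` carrier V, mult = (\<lambda>x y. x), one = f \<zero>\<^bsub>V\<^esub>, zero = f \<zero>\<^bsub>V\<^esub>,
      add = (\<lambda>x y. f (?g x \<oplus>\<^bsub>V\<^esub> ?g y)), smult = (\<lambda>c x. f (c \<odot>\<^bsub>V\<^esub> ?g x))\<rparr>"
  have g: "?g (f x) = x" if "x \<in> carrier V" for x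
    using inj that by simp
  have "is_vs W"
    by (rule vsI)
      (auto simp: W_def g vs_closed[OF V] vs_assoc[OF V] vs_comm[OF V] vs_lcomm[OF V] vs_lzero[OF V]
        vs_rzero[OF V] vs_zero_smult[OF V]
        vs_one_smult[OF V] vs_smult_add[OF V] vs_add_smult[OF V] vs_smult_smult[OF V])
  moreover have "lin V W f"
    by (rule linI) (auto simp: W_def g)
  then have "lin_iso V W (restrict f (carrier V))"
    using restrict_lin_maps[OF V, of W f] inj by (auto simp: lin_iso_def bij_betw_def W_def)
  ultimately show ?thesis by blast
qed

text \<open>The coordinate map of a dual basis is injective and takes values in lists of scalars; the copy carries the structure
  transported along it.\<close>

lemma copy_exists:
  fixes V :: "('k::field, 'v) module"
  assumes "fd_space V"
  shows "\<exists>(W :: ('k, 'a + 'k list) module) f. is_vs W \<and> lin_iso V W f"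
proof -
  obtain D where D: "dual_basis V D" using fd_space_dual_basis[OF assms] ..
  let ?f = "\<lambda>v. Inr (map (\<lambda>(b, \<phi>). \<phi> v) D)"
  have "inj_on ?f (carrier V)"
    by (rule inj_onI, rule dual_basis_separates[OF D]) auto
  then show ?thesis by (rule transport_structure[OF fd_space_vs[OF assms]])
qed

lemma
  fixes V :: "('k::field, 'v) module"
  assumes "fd_space V"
  shows copy_fd: "fd_space (copy V :: ('k, 'a + 'k list) module)"
    and to_copy_iso: "lin_iso V (copy V :: ('k, 'a + 'k list) module) (to_copy V)"
proof -
  let ?W = "copy V :: ('k, 'a + 'k list) module"
  have *: "is_vs ?W \<and> (\<exists>f. lin_iso V ?W f)"
    unfolding copy_def by (rule someI_ex) (use copy_exists[OF assms] in blast)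
  then show iso: "lin_iso V ?W (to_copy V)"
    unfolding to_copy_def by (metis someI_ex)
  show "fd_space ?W" by (rule lin_iso_fd[OF iso assms]) (use * in blast)
qed


section \<open>Multilinear maps and tensor products of lists\<close>

lemma tuples_Nil [simp]: "vs \<in> tuples [] \<longleftrightarrow> vs = []"
  by (simp add: tuples_def)

lemma tuples_empty [simp]: "tuples [] = {[]}"
  by auto

lemma tuples_Cons: "vs \<in> tuples (V # Vs) \<longleftrightarrow> (\<exists>v ws. vs = v # ws \<and> v \<in> carrier V \<and> ws \<in> tuples Vs)"
  by (auto simp: tuples_def list_all2_Cons2)

lemma tuples_Cons_Cons [simp]: "v # vs \<in> tuples (V # Vs) \<longleftrightarrow> v \<in> carrier V \<and> vs \<in> tuples Vs"
  by (simp add: tuples_def)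

abbreviation vecs :: "nat \<Rightarrow> ('k::field, 'v) module \<Rightarrow> 'v list set" where
  "vecs n V \<equiv> tuples (replicate n V)"

lemma tuples_replicate: "vs \<in> vecs n V \<longleftrightarrow> length vs = n \<and> set vs \<subseteq> carrier V"
  by (auto simp: tuples_def list_all2_conv_all_nth all_set_conv_all_nth subset_code(1))

lemma tuples_length: "vs \<in> tuples Vs \<Longrightarrow> length vs = length Vs"
  by (auto simp: tuples_def list_all2_lengthD)

lemma tuples_update: "vs \<in> tuples Vs \<Longrightarrow> i < length Vs \<Longrightarrow> x \<in> carrier (Vs ! i) \<Longrightarrow> vs[i := x] \<in> tuples Vs"
  by (auto simp: tuples_def list_all2_conv_all_nth nth_list_update)

text \<open>Multilinearity without extensionality. Its recursion over the list of spaces, \<open>mlin_Cons\<close>, is what the inductions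
  below use.\<close>

definition mlin :: "('k::field, 'v) module list \<Rightarrow> ('k, 'w) module \<Rightarrow> ('v list \<Rightarrow> 'w) \<Rightarrow> bool" where
  "mlin Vs W f \<longleftrightarrow> (\<forall>vs\<in>tuples Vs. f vs \<in> carrier W \<and>
     (\<forall>i<length Vs. lin (Vs ! i) W (\<lambda>x. f (vs[i := x]))))"

lemma multilinear_maps_iff: "f \<in> multilinear_maps Vs W \<longleftrightarrow> mlin Vs W f \<and> f \<in> extensional (tuples Vs)"
  by (auto simp: multilinear_maps_def mlin_def lin_def PiE_def)

lemma mlin_Nil [simp]: "mlin [] W f \<longleftrightarrow> f [] \<in> carrier W"
  by (simp add: mlin_def)

lemma mlin_Cons:
  "mlin (V # Vs) W f \<longleftrightarrow>
    (\<forall>vs\<in>tuples Vs. lin V W (\<lambda>v. f (v # vs))) \<and> (\<forall>v\<in>carrier V. mlin Vs W (\<lambda>vs. f (v # vs)))"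
    (is "?l \<longleftrightarrow> ?r")
proof
  assume l: ?l
  show ?r
  proof (intro conjI ballI)
    fix vs assume vs: "vs \<in> tuples Vs"
    show "lin V W (\<lambda>v. f (v # vs))"
    proof (cases "carrier V = {}")
      case True
      then show ?thesis by (auto intro!: linI)
    next
      case False
      then obtain v where v: "v \<in> carrier V" by blast
      have "lin ((V # Vs) ! 0) W (\<lambda>x. f ((v # vs)[0 := x]))"
        using l v vs unfolding mlin_def by (metis length_Cons tuples_Cons_Cons zero_less_Suc)
      then show ?thesis by simp
    qed
  next
    fix v assume v: "v \<in> carrier V"
    show "mlin Vs W (\<lambda>vs. f (v # vs))"
      unfolding mlin_def
    proof (intro ballI conjI allI impI)
      fix vs assume vs: "vs \<in> tuples Vs"
      show "f (v # vs) \<in> carrier W" using l v vs by (auto simp: mlin_def)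
      fix i assume "i < length Vs"
      then have "lin ((V # Vs) ! Suc i) W (\<lambda>x. f ((v # vs)[Suc i := x]))"
        using l v vs unfolding mlin_def by (metis length_Cons tuples_Cons_Cons Suc_less_eq)
      then show "lin (Vs ! i) W (\<lambda>x. f (v # vs[i := x]))" by simp
    qed
  qed
next
  assume r: ?r
  show ?l
    unfolding mlin_def
  proof (intro ballI conjI allI impI)
    fix ws assume "ws \<in> tuples (V # Vs)"
    then obtain v vs where ws: "ws = v # vs" and v: "v \<in> carrier V" and vs: "vs \<in> tuples Vs"
      by (auto simp: tuples_Cons)
    show "f ws \<in> carrier W" using r v vs by (auto simp: ws mlin_def)
    fix i assume "i < length (V # Vs)"
    then show "lin ((V # Vs) ! i) W (\<lambda>x. f (ws[i := x]))"
      using r v vs by (cases i) (auto simp: ws mlin_def)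
  qed
qed

lemma mlin_cong:
  assumes "\<And>V. V \<in> set Vs \<Longrightarrow> is_vs V" "mlin Vs W f" "\<And>vs. vs \<in> tuples Vs \<Longrightarrow> f vs = g vs"
  shows "mlin Vs W g"
  using assms
proof (induction Vs arbitrary: f g)
  case (Cons V Vs)
  have "lin V W (\<lambda>v. g (v # vs))" if "vs \<in> tuples Vs" for vs
    by (rule lin_cong[of _ _ "\<lambda>v. f (v # vs)"]) (use Cons.prems that in \<open>auto simp: mlin_Cons\<close>)
  moreover have "mlin Vs W (\<lambda>vs. g (v # vs))" if "v \<in> carrier V" for v
    by (rule Cons.IH[of "\<lambda>vs. f (v # vs)"]) (use Cons.prems that in \<open>auto simp: mlin_Cons\<close>)
  ultimately show ?case by (simp add: mlin_Cons)
qed simp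

lemma mlin_closed: "mlin Vs W f \<Longrightarrow> vs \<in> tuples Vs \<Longrightarrow> f vs \<in> carrier W"
  by (simp add: mlin_def)

lemma restrict_multilinear_maps:
  assumes "\<And>V. V \<in> set Vs \<Longrightarrow> is_vs V" "mlin Vs W f"
  shows "restrict f (tuples Vs) \<in> multilinear_maps Vs W"
  using mlin_cong[OF assms, of "restrict f (tuples Vs)"] by (simp add: multilinear_maps_iff)

lemma mlin_compose: "mlin Vs W f \<Longrightarrow> lin W X h \<Longrightarrow> mlin Vs X (\<lambda>vs. h (f vs))"
  unfolding mlin_def by (intro ballI conjI allI impI) (simp add: lin_closed, rule lin_compose, simp_all)

definition bil :: "('k::field, 'v) module \<Rightarrow> ('k, 'w) module \<Rightarrow> ('k, 'x) module \<Rightarrow> ('v \<Rightarrow> 'w \<Rightarrow> 'x) \<Rightarrow> bool" where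
  "bil V W X f \<longleftrightarrow> (\<forall>w\<in>carrier W. lin V X (\<lambda>v. f v w)) \<and> (\<forall>v\<in>carrier V. lin W X (f v))"

lemma bilD1: "bil V W X f \<Longrightarrow> w \<in> carrier W \<Longrightarrow> lin V X (\<lambda>v. f v w)"
  by (simp add: bil_def)

lemma bilD2: "bil V W X f \<Longrightarrow> v \<in> carrier V \<Longrightarrow> lin W X (f v)"
  by (simp add: bil_def)

lemma bil_closed: "bil V W X f \<Longrightarrow> v \<in> carrier V \<Longrightarrow> w \<in> carrier W \<Longrightarrow> f v w \<in> carrier X"
  using bilD2 lin_closed by metis

lemma bilI:
  "(\<And>w. w \<in> carrier W \<Longrightarrow> lin V X (\<lambda>v. f v w)) \<Longrightarrow> (\<And>v. v \<in> carrier V \<Longrightarrow> lin W X (\<lambda>w. f v w)) \<Longrightarrow>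
    bil V W X f"
  by (simp add: bil_def)

lemma bil_flip: "bil V W X f \<Longrightarrow> bil W V X (\<lambda>w v. f v w)"
  by (simp add: bil_def)

lemma bil_compose: "bil V W X f \<Longrightarrow> lin X Y h \<Longrightarrow> bil V W Y (\<lambda>v w. h (f v w))"
  by (rule bilI) (rule lin_compose[where k = h], erule (1) bilD1, assumption,
    rule lin_compose[where k = h], erule (1) bilD2, assumption)

lemma bil_precompose:
  assumes "bil V W X f" "lin V' V h" "lin W' W k"
  shows "bil V' W' X (\<lambda>v w. f (h v) (k w))"
proof (rule bilI)
  show "lin V' X (\<lambda>v. f (h v) (k w))" if "w \<in> carrier W'" for w
    using lin_compose[OF assms(2) bilD1[OF assms(1) lin_closed[OF assms(3) that]]] .
  show "lin W' X (\<lambda>w. f (h v) (k w))" if "v \<in> carrier V'" for v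
    using lin_compose[OF assms(3) bilD2[OF assms(1) lin_closed[OF assms(2) that]]] .
qed

lemma mlin_pair: "mlin [V, W] X f \<longleftrightarrow> bil V W X (\<lambda>v w. f [v, w])"
proof -
  have "tuples [W] = (\<lambda>w. [w]) ` carrier W" by (auto simp: tuples_Cons)
  then show ?thesis by (auto simp: mlin_Cons bil_def dest: lin_closed)
qed


subsection \<open>The tensor product\<close>

lemma tensor_simps [simp]:
  "\<zero>\<^bsub>tensor Vs\<^esub> = (\<lambda>\<beta>\<in>multilinear_maps Vs scalars. 0)"
  "x \<oplus>\<^bsub>tensor Vs\<^esub> y = (\<lambda>\<beta>\<in>multilinear_maps Vs scalars. x \<beta> + y \<beta>)"
  "c \<odot>\<^bsub>tensor Vs\<^esub> x = (\<lambda>\<beta>\<in>multilinear_maps Vs scalars. c * x \<beta>)"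
  by (simp_all add: tensor_def Let_def)

lemma lspan_carrier_update: "lspan (V\<lparr>carrier := U\<rparr>) S = lspan V S"
proof (intro equalityI subsetI)
  show "x \<in> lspan V S" if "x \<in> lspan (V\<lparr>carrier := U\<rparr>) S" for x
    using that by induction (auto intro: lspan.intros)
  show "x \<in> lspan (V\<lparr>carrier := U\<rparr>) S" if "x \<in> lspan V S" for x
    using that
    by induction (auto intro: lspan.intros lspan.intros[where V = "V\<lparr>carrier := U\<rparr>", simplified])
qed

text \<open>The span in the definition of the tensor product consists of finite linear combinations. It is contained in the
  inductive span, since the latter is a submodule, and this makes induction over pure tensors available.\<close>

lemma
  fixes Vs :: "('k::field, 'v) module list"
  shows tensor_vs: "is_vs (tensor Vs)"
    and pure_generates: "generates (pure Vs ` tuples Vs) (tensor Vs)"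
    and tensor_carrier_sub: "carrier (tensor Vs) \<subseteq> multilinear_maps Vs scalars \<rightarrow>\<^sub>E UNIV"
proof -
  let ?S = "pure Vs ` tuples Vs"
  let ?F = "ring.func_space (class_ring :: 'k ring) (multilinear_maps Vs (scalars :: ('k, 'k) module))"
  have F: "is_vs ?F"
    by (rule vectorspace.intro[OF cring.func_space_is_module[OF class_cring.cring_axioms] class_field])
  interpret F: vectorspace class_ring ?F by (rule F)
  have S: "?S \<subseteq> carrier ?F" by (auto simp: pure_def)
  have car: "carrier (tensor Vs) = F.span ?S"
    by (simp add: tensor_def Let_def)
  have sm: "submodule class_ring (F.span ?S) ?F" by (rule F.span_is_submodule[OF S])
  have "is_vs (?F\<lparr>carrier := F.span ?S\<rparr>)"
    using F.submodule_is_module[OF sm] class_field by (intro vectorspace.intro)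
  then show "is_vs (tensor Vs)"
    by (simp add: tensor_def Let_def)
  have "submodule class_ring (lspan ?F ?S) ?F"
    using lspan_closed[OF F S] F.module_axioms
    by (intro submodule.intro) (auto intro: lspan.intros simp del: func_space_simps)
  then have "F.span ?S \<subseteq> lspan ?F ?S"
    by (intro F.span_is_subset) (auto intro: lspan.intros)
  moreover have "lspan (tensor Vs) ?S = lspan ?F ?S"
    by (simp add: tensor_def Let_def lspan_carrier_update)
  ultimately show "generates ?S (tensor Vs)"
    using F.in_own_span[OF S] by (auto simp: generates_def car)
  show "carrier (tensor Vs) \<subseteq> multilinear_maps Vs scalars \<rightarrow>\<^sub>E UNIV"
    using submodule.subset[OF sm] by (simp add: car)
qed

lemma pure_closed: "vs \<in> tuples Vs \<Longrightarrow> pure Vs vs \<in> carrier (tensor Vs)"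
  using generatesD[OF pure_generates] by blast

lemma tensor_eqI:
  assumes "x \<in> carrier (tensor Vs)" "y \<in> carrier (tensor Vs)"
    and "\<And>\<beta>. \<beta> \<in> multilinear_maps Vs scalars \<Longrightarrow> x \<beta> = y \<beta>"
  shows "x = y"
  using assms(3) PiE_ext[of x "multilinear_maps Vs scalars" "\<lambda>_. UNIV" y] tensor_carrier_sub[of Vs] assms(1,2)
  by blast

lemma eval_lin: "\<beta> \<in> multilinear_maps Vs scalars \<Longrightarrow> lin (tensor Vs) scalars (\<lambda>x. x \<beta>)"
  by (rule linI) simp_all

lemma pure_mlin: "mlin Vs (tensor Vs) (pure Vs)"
  unfolding mlin_def
proof (intro ballI conjI allI impI)
  fix vs i assume vs: "vs \<in> tuples Vs" and i: "i < length Vs"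
  have lin\<beta>: "lin (Vs ! i) scalars (\<lambda>x. \<beta> (vs[i := x]))" if "\<beta> \<in> multilinear_maps Vs scalars" for \<beta>
    using that vs i by (simp add: multilinear_maps_iff mlin_def)
  show "lin (Vs ! i) (tensor Vs) (\<lambda>x. pure Vs (vs[i := x]))"
  proof (rule linI)
    show "pure Vs (vs[i := x]) \<in> carrier (tensor Vs)" if "x \<in> carrier (Vs ! i)" for x
      by (intro pure_closed tuples_update vs i that)
  qed (auto simp: pure_def lin_add[OF lin\<beta>] lin_smult[OF lin\<beta>] intro!: restrict_ext)
qed (rule pure_closed)

text \<open>All products of members of the given dual bases: tuples of vectors with the matching tuples of functionals.\<close>

fun prod_dual :: "('v \<times> ('v \<Rightarrow> 'k)) list list \<Rightarrow> ('v list \<times> ('v \<Rightarrow> 'k) list) list" where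
  "prod_dual [] = [([], [])]"
| "prod_dual (D # Ds) = concat (map (\<lambda>(b, \<phi>). map (\<lambda>(bs, \<phi>s). (b # bs, \<phi> # \<phi>s)) (prod_dual Ds)) D)"

definition eval_prod :: "('v \<Rightarrow> 'k::field) list \<Rightarrow> 'v list \<Rightarrow> 'k" where
  "eval_prod \<phi>s vs = prod_list (map2 (\<lambda>\<phi> v. \<phi> v) \<phi>s vs)"

lemma eval_prod_simps [simp]:
  "eval_prod [] vs = 1" "eval_prod (\<phi> # \<phi>s) (v # vs) = \<phi> v * eval_prod \<phi>s vs"
  by (simp_all add: eval_prod_def)

lemma eval_prod_mlin:
  "list_all2 (\<lambda>\<phi> V. lin V scalars \<phi>) \<phi>s Vs \<Longrightarrow> mlin Vs scalars (eval_prod \<phi>s)"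
proof (induction rule: list_all2_induct)
  case (Cons \<phi> \<phi>s V Vs)
  have "lin V scalars (\<lambda>v. \<phi> v * eval_prod \<phi>s vs)" for vs
    using lin_scale[OF scalars_vs Cons.hyps(1), of "eval_prod \<phi>s vs"] by (simp add: mult.commute)
  moreover have "mlin Vs scalars (\<lambda>vs. \<phi> v * eval_prod \<phi>s vs)" for v
    using mlin_compose[OF Cons.IH lin_scale[OF scalars_vs lin_id, of "\<phi> v"]] by simp
  ultimately show ?case by (simp add: mlin_Cons)
qed simp

lemma prod_dual_mem:
  assumes "list_all2 dual_basis Vs Ds" "(bs, \<phi>s) \<in> set (prod_dual Ds)"
  shows "bs \<in> tuples Vs" "list_all2 (\<lambda>\<phi> V. lin V scalars \<phi>) \<phi>s Vs"
    "list_all2 (\<lambda>p D. p \<in> set D) (zip bs \<phi>s) Ds"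
proof -
  have "bs \<in> tuples Vs \<and> list_all2 (\<lambda>\<phi> V. lin V scalars \<phi>) \<phi>s Vs \<and> list_all2 (\<lambda>p D. p \<in> set D) (zip bs \<phi>s) Ds"
    using assms
  proof (induction Vs Ds arbitrary: bs \<phi>s rule: list_all2_induct)
    case (Cons V Vs D Ds)
    then obtain b \<phi> cs \<psi>s where "(b, \<phi>) \<in> set D" "(cs, \<psi>s) \<in> set (prod_dual Ds)"
      "bs = b # cs" "\<phi>s = \<phi> # \<psi>s" by auto
    then show ?case using Cons dual_basis_closed by fastforce
  qed simp
  then show "bs \<in> tuples Vs" "list_all2 (\<lambda>\<phi> V. lin V scalars \<phi>) \<phi>s Vs"
    "list_all2 (\<lambda>p D. p \<in> set D) (zip bs \<phi>s) Ds" by simp_all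
qed

lemma sum_list_concat_map: "sum_list (map f (concat xss)) = sum_list (map (\<lambda>xs. sum_list (map f xs)) xss)"
  by (induction xss) simp_all

text \<open>Expansion of one argument after the other. The list of pairs does not depend on \<open>\<beta>\<close>, which makes the formula an
  expansion of the pure tensor of \<open>vs\<close>.\<close>

lemma multilinear_expand:
  assumes "list_all2 dual_basis Vs Ds" "\<And>V. V \<in> set Vs \<Longrightarrow> is_vs V" "mlin Vs scalars \<beta>" "vs \<in> tuples Vs"
  shows "\<beta> vs = sum_list (map (\<lambda>(bs, \<phi>s). eval_prod \<phi>s vs * \<beta> bs) (prod_dual Ds))"
  using assms
proof (induction Vs Ds arbitrary: \<beta> vs rule: list_all2_induct)
  case (Cons V Vs D Ds)
  obtain v ws where vs: "vs = v # ws" and v: "v \<in> carrier V" and ws: "ws \<in> tuples Vs"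
    using Cons.prems(3) by (auto simp: tuples_Cons)
  have IH: "\<beta> (b # ws) = sum_list (map (\<lambda>(bs, \<phi>s). eval_prod \<phi>s ws * \<beta> (b # bs)) (prod_dual Ds))"
    if "b \<in> carrier V" for b
    by (rule Cons.IH) (use Cons.prems ws that in \<open>auto simp: mlin_Cons\<close>)
  have V: "is_vs V" by (rule Cons.prems) simp
  have "\<beta> vs = sum_list (map (\<lambda>(b, \<phi>). \<phi> v * \<beta> (b # ws)) D)"
    using dual_basis_lin[OF Cons.hyps(1) V scalars_vs _ v, of "\<lambda>v. \<beta> (v # ws)"] Cons.prems(2) ws
    by (simp add: mlin_Cons vs case_prod_unfold)
  also have "map (\<lambda>(b, \<phi>). \<phi> v * \<beta> (b # ws)) D =
      map (\<lambda>(b, \<phi>). sum_list (map (\<lambda>(bs, \<phi>s). \<phi> v * eval_prod \<phi>s ws * \<beta> (b # bs)) (prod_dual Ds))) D"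
    using dual_basis_closed[OF Cons.hyps(1)]
    by (auto simp: IH sum_list_const_mult[symmetric] case_prod_unfold mult.assoc)
  also have "sum_list \<dots> = sum_list (map (\<lambda>(bs, \<phi>s). eval_prod \<phi>s vs * \<beta> bs) (prod_dual (D # Ds)))"
    by (simp add: sum_list_concat_map comp_def case_prod_unfold vs)
  finally show ?case .
qed simp

definition prod_form :: "('k::field, 'v) module list \<Rightarrow> ('v \<Rightarrow> 'k) list \<Rightarrow> 'v list \<Rightarrow> 'k" where
  "prod_form Vs \<phi>s = restrict (eval_prod \<phi>s) (tuples Vs)"

lemma prod_form_multilinear:
  "(\<And>V. V \<in> set Vs \<Longrightarrow> is_vs V) \<Longrightarrow> list_all2 (\<lambda>\<phi> V. lin V scalars \<phi>) \<phi>s Vs \<Longrightarrow>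
    prod_form Vs \<phi>s \<in> multilinear_maps Vs scalars"
  unfolding prod_form_def by (intro restrict_multilinear_maps eval_prod_mlin)

lemma pure_prod_form:
  assumes "\<And>V. V \<in> set Vs \<Longrightarrow> is_vs V" "list_all2 (\<lambda>\<phi> V. lin V scalars \<phi>) \<phi>s Vs" "vs \<in> tuples Vs"
  shows "pure Vs vs (prod_form Vs \<phi>s) = eval_prod \<phi>s vs"
  using prod_form_multilinear[OF assms(1,2)] assms(3) by (simp add: pure_def prod_form_def)

text \<open>A product of functionals is a multilinear form, at which the elements of the tensor product can be evaluated.
  Evaluated at a form \<open>\<beta>\<close>, the expansion of a pure tensor is that of \<open>\<beta>\<close> in \<open>multilinear_expand\<close>.\<close>

lemma tensor_dual_basis:
  fixes Vs :: "('k::field, 'v) module list"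
  assumes D: "list_all2 dual_basis Vs Ds" and vs: "\<And>V. V \<in> set Vs \<Longrightarrow> is_vs V"
  shows "dual_basis (tensor Vs) (map (\<lambda>(bs, \<phi>s). (pure Vs bs, \<lambda>x. x (prod_form Vs \<phi>s))) (prod_dual Ds))"
    (is "dual_basis ?T ?E")
proof (rule dual_basisI)
  note T = tensor_vs[of Vs]
  have el: "fst p \<in> carrier ?T \<and> lin ?T scalars (snd p)" if p: "p \<in> set ?E" for p
  proof -
    obtain bs \<phi>s where "(bs, \<phi>s) \<in> set (prod_dual Ds)" and p: "p = (pure Vs bs, \<lambda>x. x (prod_form Vs \<phi>s))"
      using p by auto
    then show ?thesis
      using pure_closed[OF prod_dual_mem(1)[OF D]] eval_lin[OF prod_form_multilinear[OF vs prod_dual_mem(2)[OF D]]]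
      by simp
  qed
  then show "fst p \<in> carrier ?T" and "lin ?T scalars (snd p)" if "p \<in> set ?E" for p
    using that by (blast, blast)
  fix x assume x: "x \<in> carrier ?T"
  have closed: "p \<in> set ?E \<Longrightarrow> fst p \<in> carrier ?T" and lin: "p \<in> set ?E \<Longrightarrow> lin ?T scalars (snd p)" for p
    using el by (blast, blast)
  let ?L = "\<lambda>x. vsum ?T (map (\<lambda>p. snd p x \<odot>\<^bsub>?T\<^esub> fst p) ?E)"
  have L: "lin ?T ?T ?L"
  proof (rule lin_vsum_fun[OF T])
    fix p assume p: "p \<in> set ?E"
    note c = closed[OF p] and l = lin[OF p]
    show "lin ?T ?T (\<lambda>x. snd p x \<odot>\<^bsub>?T\<^esub> fst p)"
      by (rule linI)
        (simp_all only: vs_smult[OF T c] lin_add[OF l] lin_smult[OF l] scalars_simps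
          vs_add_smult[OF T c] vs_smult_smult[OF T c])
  qed
  show "?L x = x"
  proof (rule lin_eq_on_generators[OF T T pure_generates L lin_id _ x])
    fix y assume "y \<in> pure Vs ` tuples Vs"
    then obtain ws where y: "y = pure Vs ws" and ws: "ws \<in> tuples Vs" by blast
    have yT: "y \<in> carrier ?T" using ws by (simp add: y pure_closed)
    show "?L y = y"
    proof (rule tensor_eqI[OF lin_closed[OF L yT] yT])
      fix \<beta> :: "'v list \<Rightarrow> 'k" assume \<beta>: "\<beta> \<in> multilinear_maps Vs scalars"
      have "?L y \<beta> = sum_list (map (\<lambda>x. x \<beta>) (map (\<lambda>p. snd p y \<odot>\<^bsub>?T\<^esub> fst p) ?E))"
      proof -
        have "set (map (\<lambda>p. snd p y \<odot>\<^bsub>?T\<^esub> fst p) ?E) \<subseteq> carrier ?T"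
          by (subst set_map) (rule image_subsetI, rule vs_smult[OF T closed])
        from lin_vsum[OF eval_lin[OF \<beta>] T scalars_vs this] show ?thesis by (simp only: vsum_scalars)
      qed
      also have "\<dots> = sum_list (map (\<lambda>(bs, \<phi>s). eval_prod \<phi>s ws * \<beta> bs) (prod_dual Ds))"
        using \<beta> ws prod_dual_mem[OF D]
        by (auto simp: y comp_def case_prod_unfold pure_prod_form[OF vs] intro!: arg_cong[where f = sum_list])
          (auto simp: pure_def)
      also have "\<dots> = \<beta> ws"
        using multilinear_expand[OF D vs _ ws, of \<beta>] \<beta> by (simp add: multilinear_maps_iff)
      also have "\<dots> = y \<beta>" using \<beta> by (simp add: y pure_def)
      finally show "?L y \<beta> = y \<beta>" .
    qed
  qed
qed

lemma tensor_fd: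
  assumes "\<And>V. V \<in> set Vs \<Longrightarrow> fd_space V"
  shows "fd_space (tensor Vs)"
proof -
  have "\<exists>Ds. list_all2 dual_basis Vs Ds"
    using assms
  proof (induction Vs)
    case (Cons V Vs)
    then obtain Ds where "list_all2 dual_basis Vs Ds" by auto
    moreover obtain D where "dual_basis V D" using fd_space_dual_basis[of V] Cons.prems by auto
    ultimately have "list_all2 dual_basis (V # Vs) (D # Ds)" by simp
    then show ?case ..
  qed auto
  then show ?thesis
    using fd_spaceI[OF tensor_vs tensor_dual_basis] fd_space_vs[OF assms] by blast
qed

text \<open>A functional on \<open>X\<close> composed with \<open>f\<close> is a multilinear form, and evaluation at this form is the companion functional
  on the tensor product that \<open>lin_extend\<close> asks for.\<close>

lemma tensor_lift:
  assumes vs: "\<And>V. V \<in> set Vs \<Longrightarrow> is_vs V" and X: "fd_space X" and f: "mlin Vs X f"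
  shows "\<exists>h\<in>lin_maps (tensor Vs) X. \<forall>vs\<in>tuples Vs. h (pure Vs vs) = f vs"
proof (rule lin_extend[where F = "{\<phi>. lin X scalars \<phi>}"])
  show "is_vs X" using X by (rule fd_space_vs)
  show "b = b'" if "b \<in> carrier X" "b' \<in> carrier X" "\<And>\<phi>. \<phi> \<in> {\<phi>. lin X scalars \<phi>} \<Longrightarrow> \<phi> b = \<phi> b'" for b b'
    using fd_functional_separates[OF X that(1,2)] that(3) by simp
  fix \<phi> assume "\<phi> \<in> {\<phi>. lin X scalars \<phi>}"
  then have \<phi>: "lin X scalars \<phi>" by simp
  define \<beta> where "\<beta> = restrict (\<lambda>vs. \<phi> (f vs)) (tuples Vs)"
  have "\<beta> \<in> multilinear_maps Vs scalars"
    unfolding \<beta>_def by (intro restrict_multilinear_maps vs mlin_compose[OF f \<phi>])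
  then show "lin X scalars \<phi> \<and> (\<exists>g. lin (tensor Vs) scalars g \<and> (\<forall>ws\<in>tuples Vs. g (pure Vs ws) = \<phi> (f ws)))"
    using \<phi> eval_lin[of \<beta> Vs] by (intro conjI exI[of _ "\<lambda>x. x \<beta>"]) (auto simp: pure_def \<beta>_def)
qed (use tensor_vs pure_generates mlin_closed[OF f] in auto)

lemma map2_update:
  "i < length fs \<Longrightarrow> map2 (\<lambda>f v. f v) fs (vs[i := x]) = (map2 (\<lambda>f v. f v) fs vs)[i := (fs ! i) x]"
proof (induction fs arbitrary: vs i)
  case (Cons f fs)
  then show ?case by (cases vs; cases i) simp_all
qed simp

lemma
  assumes Vs: "\<And>V. V \<in> set Vs \<Longrightarrow> fd_space V" and Ws: "\<And>W. W \<in> set Ws \<Longrightarrow> fd_space W"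
    and len: "length Vs = n" "length Ws = n" "length fs = n"
    and fs: "\<And>i. i < n \<Longrightarrow> lin (Vs ! i) (Ws ! i) (fs ! i)"
  shows tensor_map_lin: "tensor_map Vs Ws fs \<in> lin_maps (tensor Vs) (tensor Ws)"
    and tensor_map_pure: "\<And>vs. vs \<in> tuples Vs \<Longrightarrow>
      tensor_map Vs Ws fs (pure Vs vs) = pure Ws (map2 (\<lambda>f v. f v) fs vs)"
proof -
  let ?f = "\<lambda>vs. pure Ws (map2 (\<lambda>f v. f v) fs vs)"
  have vs: "V \<in> set Vs \<Longrightarrow> is_vs V" for V by (rule fd_space_vs[OF Vs])
  have tup: "map2 (\<lambda>f v. f v) fs vs \<in> tuples Ws" if "vs \<in> tuples Vs" for vs
    using that lin_closed[OF fs] len by (auto simp: tuples_def list_all2_conv_all_nth)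
  have "mlin Vs (tensor Ws) ?f"
    unfolding mlin_def
  proof (intro ballI conjI allI impI)
    fix vs assume vs: "vs \<in> tuples Vs"
    show "?f vs \<in> carrier (tensor Ws)" by (intro pure_closed tup vs)
    fix i assume i: "i < length Vs"
    have "lin (Ws ! i) (tensor Ws) (\<lambda>x. pure Ws ((map2 (\<lambda>f v. f v) fs vs)[i := x]))"
      using pure_mlin[of Ws] tup[OF vs] i len by (auto simp: mlin_def)
    from lin_compose[OF fs this] show "lin (Vs ! i) (tensor Ws) (\<lambda>x. ?f (vs[i := x]))"
      using i len by (simp add: map2_update)
  qed
  from tensor_lift[OF vs tensor_fd[OF Ws] this]
  obtain h where h: "h \<in> lin_maps (tensor Vs) (tensor Ws)" "\<forall>vs\<in>tuples Vs. h (pure Vs vs) = ?f vs"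
    by blast
  have "\<exists>!h. h \<in> lin_maps (tensor Vs) (tensor Ws) \<and> (\<forall>vs\<in>tuples Vs. h (pure Vs vs) = ?f vs)"
    using h by (intro ex1I[of _ h])
      (auto intro!: lin_maps_eq_on_generators[OF tensor_vs tensor_vs pure_generates])
  from theI'[OF this]
  show "tensor_map Vs Ws fs \<in> lin_maps (tensor Vs) (tensor Ws)"
    "\<And>vs. vs \<in> tuples Vs \<Longrightarrow> tensor_map Vs Ws fs (pure Vs vs) = ?f vs"
    by (simp_all add: tensor_map_def)
qed


section \<open>Tensor products of two spaces\<close>

text \<open>\<open>T\<close> with the bilinear map \<open>m\<close> is a tensor product of \<open>V\<close> and \<open>W\<close>. The universal property is required for
  bilinear forms only; for bilinear maps to finite-dimensional spaces it follows (\<open>tprod_lift\<close>). The notion covers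
  \<open>tensor [V, W]\<close>, its copy \<open>tens V W\<close>, and \<open>(V \<otimes> W)\<^sup>\<otimes>\<^sup>n\<close> as a tensor product of
  \<open>V\<^sup>\<otimes>\<^sup>n\<close> and \<open>W\<^sup>\<otimes>\<^sup>n\<close>.\<close>

definition tprod ::
  "('k::field, 'v) module \<Rightarrow> ('k, 'w) module \<Rightarrow> ('k, 't) module \<Rightarrow> ('v \<Rightarrow> 'w \<Rightarrow> 't) \<Rightarrow> bool" where
  "tprod V W T m \<longleftrightarrow> is_vs T \<and> bil V W T m \<and> generates ((\<lambda>(v, w). m v w) ` (carrier V \<times> carrier W)) T \<and>
     (\<forall>B. bil V W scalars B \<longrightarrow>
       (\<exists>f. lin T scalars f \<and> (\<forall>v\<in>carrier V. \<forall>w\<in>carrier W. f (m v w) = B v w)))"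

lemma
  assumes "tprod V W T m"
  shows tprod_vs: "is_vs T" and tprod_bil: "bil V W T m"
    and tprod_gen: "generates ((\<lambda>(v, w). m v w) ` (carrier V \<times> carrier W)) T"
    and tprod_form: "\<And>B. bil V W scalars B \<Longrightarrow>
       \<exists>f. lin T scalars f \<and> (\<forall>v\<in>carrier V. \<forall>w\<in>carrier W. f (m v w) = B v w)"
  using assms by (auto simp: tprod_def)

lemma tprod_closed: "tprod V W T m \<Longrightarrow> v \<in> carrier V \<Longrightarrow> w \<in> carrier W \<Longrightarrow> m v w \<in> carrier T"
  using bil_closed[OF tprod_bil] .

lemma tprod_lift:
  assumes T: "tprod V W T m" and X: "fd_space X" and B: "bil V W X B"
  shows "\<exists>h\<in>lin_maps T X. \<forall>v\<in>carrier V. \<forall>w\<in>carrier W. h (m v w) = B v w"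
proof -
  have "\<exists>h\<in>lin_maps T X. \<forall>i\<in>carrier V \<times> carrier W. h ((\<lambda>(v, w). m v w) i) = (\<lambda>(v, w). B v w) i"
  proof (rule lin_extend[where F = "{\<phi>. lin X scalars \<phi>}"])
    show "is_vs X" using X by (rule fd_space_vs)
    show "b = b'" if "b \<in> carrier X" "b' \<in> carrier X" "\<And>\<phi>. \<phi> \<in> {\<phi>. lin X scalars \<phi>} \<Longrightarrow> \<phi> b = \<phi> b'" for b b'
      using fd_functional_separates[OF X that(1,2)] that(3) by simp
    fix \<phi> assume "\<phi> \<in> {\<phi>. lin X scalars \<phi>}"
    then have \<phi>: "lin X scalars \<phi>" by simp
    show "lin X scalars \<phi> \<and> (\<exists>g. lin T scalars g \<and>
        (\<forall>i\<in>carrier V \<times> carrier W. g ((\<lambda>(v, w). m v w) i) = \<phi> ((\<lambda>(v, w). B v w) i)))"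
      using \<phi> tprod_form[OF T bil_compose[OF B \<phi>]] by auto
  qed (use tprod_vs[OF T] tprod_gen[OF T] bil_closed[OF B] in auto)
  then show ?thesis by auto
qed

lemma tprod_generates:
  assumes T: "tprod V W T m" and V: "is_vs V" and W: "is_vs W" and S: "generates S V" and S': "generates S' W"
  shows "generates ((\<lambda>(v, w). m v w) ` (S \<times> S')) T"
proof (rule generates_trans[OF tprod_vs[OF T] tprod_gen[OF T]])
  let ?M = "(\<lambda>(v, w). m v w) ` (S \<times> S')"
  have sub: "S \<subseteq> carrier V" "S' \<subseteq> carrier W" "carrier V \<subseteq> lspan V S" "carrier W \<subseteq> lspan W S'"
    using S S' by (auto simp: generates_def)
  then show "?M \<subseteq> carrier T" by (auto intro!: tprod_closed[OF T])
  show "(\<lambda>(v, w). m v w) ` (carrier V \<times> carrier W) \<subseteq> lspan T ?M"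
  proof clarify
    fix v w assume v: "v \<in> carrier V" and w: "w \<in> carrier W"
    have "m s w \<in> lspan T ?M" if s: "s \<in> S" for s
      by (rule lin_image_lspan[OF bilD2[OF tprod_bil[OF T], of s] W tprod_vs[OF T] sub(2)])
        (use s sub w in \<open>auto intro: lspan.lspan_base\<close>)
    then show "m v w \<in> lspan T ?M"
      by (intro lin_image_lspan[OF bilD1[OF tprod_bil[OF T], of w] V tprod_vs[OF T] sub(1)])
        (use v w sub in auto)
  qed
qed

lemma tprod_eqI:
  assumes T: "tprod V W T m" and X: "is_vs X" and "lin T X h" "lin T X k"
    and "\<And>v w. v \<in> carrier V \<Longrightarrow> w \<in> carrier W \<Longrightarrow> h (m v w) = k (m v w)" and "t \<in> carrier T"
  shows "h t = k t"
  by (rule lin_eq_on_generators[OF tprod_vs[OF T] X tprod_gen[OF T]]) (use assms in auto)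

lemma tprod_induct [consumes 2, case_names zero base add smult]:
  assumes T: "tprod V W T m" and t: "t \<in> carrier T"
    and zero: "P \<zero>\<^bsub>T\<^esub>"
    and base: "\<And>v w. v \<in> carrier V \<Longrightarrow> w \<in> carrier W \<Longrightarrow> P (m v w)"
    and add: "\<And>x y. x \<in> carrier T \<Longrightarrow> y \<in> carrier T \<Longrightarrow> P x \<Longrightarrow> P y \<Longrightarrow> P (x \<oplus>\<^bsub>T\<^esub> y)"
    and smult: "\<And>c x. x \<in> carrier T \<Longrightarrow> P x \<Longrightarrow> P (c \<odot>\<^bsub>T\<^esub> x)"
  shows "P t"
  using tprod_vs[OF T] tprod_gen[OF T] t
  by (induction rule: generates_induct) (auto intro: zero base add smult)

lemma tprod_iso:
  assumes T: "tprod V W T m" and U: "is_vs U" and f: "lin_iso T U f"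
  shows "tprod V W U (\<lambda>v w. f (m v w))"
  unfolding tprod_def
proof (intro conjI allI impI)
  note l = lin_isoD(1)[OF f]
  show "bil V W U (\<lambda>v w. f (m v w))" by (rule bil_compose[OF tprod_bil[OF T] l])
  show "generates ((\<lambda>(v, w). f (m v w)) ` (carrier V \<times> carrier W)) U"
    unfolding generates_def
  proof (intro conjI subsetI)
    fix u assume u: "u \<in> carrier U"
    then obtain t where t: "t \<in> carrier T" "u = f t" using lin_isoD(3)[OF f] by blast
    have "f t \<in> lspan U ((\<lambda>(v, w). f (m v w)) ` (carrier V \<times> carrier W))"
      by (rule lin_image_lspan[OF l tprod_vs[OF T] U, of "(\<lambda>(v, w). m v w) ` (carrier V \<times> carrier W)"])
        (use tprod_gen[OF T] t in \<open>auto simp: generates_def intro: lspan.lspan_base\<close>)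
    then show "u \<in> lspan U ((\<lambda>(v, w). f (m v w)) ` (carrier V \<times> carrier W))" by (simp add: t)
  qed (use tprod_closed[OF T] lin_closed[OF l] in auto)
  fix B assume "bil V W scalars B"
  then obtain g where g: "lin T scalars g" "\<forall>v\<in>carrier V. \<forall>w\<in>carrier W. g (m v w) = B v w"
    using tprod_form[OF T] by blast
  show "\<exists>g. lin U scalars g \<and> (\<forall>v\<in>carrier V. \<forall>w\<in>carrier W. g (f (m v w)) = B v w)"
    using lin_compose[OF lin_iso_inverse[OF f tprod_vs[OF T]] g(1)] g(2)
      lin_iso_inv_into_left[OF f tprod_closed[OF T]]
    by (intro exI[of _ "\<lambda>u. g (inv_into (carrier T) f u)"]) auto
qed (rule U)

lemma tprod_tensor:
  assumes V: "is_vs V" and W: "is_vs W"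
  shows "tprod V W (tensor [V, W]) (\<lambda>v w. pure [V, W] [v, w])"
  unfolding tprod_def
proof (intro conjI allI impI)
  show "is_vs (tensor [V, W])" by (rule tensor_vs)
  show "bil V W (tensor [V, W]) (\<lambda>v w. pure [V, W] [v, w])"
    using pure_mlin[of "[V, W]"] by (simp add: mlin_pair)
  have "tuples [V, W] = (\<lambda>(v, w). [v, w]) ` (carrier V \<times> carrier W)"
    by (auto simp: tuples_Cons)
  then show "generates ((\<lambda>(v, w). pure [V, W] [v, w]) ` (carrier V \<times> carrier W)) (tensor [V, W])"
    using pure_generates[of "[V, W]"] by (simp add: image_image case_prod_unfold)
  fix B assume "bil V W scalars B"
  then have "mlin [V, W] scalars (\<lambda>vs. B (vs ! 0) (vs ! 1))" by (simp add: mlin_pair)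
  then have ml: "restrict (\<lambda>vs. B (vs ! 0) (vs ! 1)) (tuples [V, W]) \<in> multilinear_maps [V, W] scalars"
    by (rule restrict_multilinear_maps[rotated]) (use V W in auto)
  show "\<exists>f. lin (tensor [V, W]) scalars f \<and> (\<forall>v\<in>carrier V. \<forall>w\<in>carrier W. f (pure [V, W] [v, w]) = B v w)"
    using eval_lin[OF ml] ml by (intro exI conjI) (auto simp: pure_def)
qed

lemma lin_times: "lin V scalars \<phi> \<Longrightarrow> lin V scalars (\<lambda>v. \<phi> v * c)"
  using lin_scale[OF scalars_vs, of V \<phi> c] by (simp add: mult.commute)

text \<open>The vectors \<open>m b c\<close> and the functionals \<open>\<phi> \<otimes> \<psi>\<close> form a dual basis. The functionals are described by their
  values on \<open>m v w\<close>, so that the lemma can be applied again to a factor that is itself a tensor product.\<close>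

lemma tprod_dual_basis:
  assumes T: "tprod V W T m" and V: "is_vs V" and W: "is_vs W"
    and DV: "dual_basis V DV" and DW: "dual_basis W DW"
  shows "\<exists>D. dual_basis T D \<and> (\<forall>(t, f)\<in>set D. \<exists>b \<phi> c \<psi>. (b, \<phi>) \<in> set DV \<and> (c, \<psi>) \<in> set DW \<and> t = m b c \<and>
      (\<forall>v\<in>carrier V. \<forall>w\<in>carrier W. f (m v w) = \<phi> v * \<psi> w))"
proof -
  note TT = tprod_vs[OF T]
  define P where "P \<phi> \<psi> = (SOME f. lin T scalars f \<and> (\<forall>v\<in>carrier V. \<forall>w\<in>carrier W. f (m v w) = \<phi> v * \<psi> w))"
    for \<phi> \<psi>
  have P: "lin T scalars (P \<phi> \<psi>) \<and> (\<forall>v\<in>carrier V. \<forall>w\<in>carrier W. P \<phi> \<psi> (m v w) = \<phi> v * \<psi> w)"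
    if "lin V scalars \<phi>" "lin W scalars \<psi>" for \<phi> \<psi>
  proof -
    have "bil V W scalars (\<lambda>v w. \<phi> v * \<psi> w)"
      using lin_scale[OF scalars_vs that(2)] lin_times[OF that(1)] by (intro bilI) simp_all
    from tprod_form[OF T this] show ?thesis unfolding P_def by (rule someI_ex)
  qed
  let ?D = "concat (map (\<lambda>(b, \<phi>). map (\<lambda>(c, \<psi>). (m b c, P \<phi> \<psi>)) DW) DV)"
  have mem: "\<exists>b \<phi> c \<psi>. p = (m b c, P \<phi> \<psi>) \<and> (b, \<phi>) \<in> set DV \<and> (c, \<psi>) \<in> set DW" if "p \<in> set ?D" for p
    using that by auto
  have el: "fst p \<in> carrier T \<and> lin T scalars (snd p)" if p: "p \<in> set ?D" for p
  proof -
    obtain b \<phi> c \<psi> where "p = (m b c, P \<phi> \<psi>)" "(b, \<phi>) \<in> set DV" "(c, \<psi>) \<in> set DW"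
      using mem[OF p] by blast
    then show ?thesis
      using dual_basis_closed[OF DV] dual_basis_closed[OF DW] tprod_closed[OF T] P by simp
  qed
  have "dual_basis T ?D"
  proof (rule dual_basisI)
    show "fst p \<in> carrier T" "lin T scalars (snd p)" if "p \<in> set ?D" for p using el[OF that] by blast+
    fix t assume t: "t \<in> carrier T"
    let ?L = "\<lambda>t. vsum T (map (\<lambda>p. snd p t \<odot>\<^bsub>T\<^esub> fst p) ?D)"
    have L: "lin T T ?L"
    proof (rule lin_vsum_fun[OF TT])
      fix p assume p: "p \<in> set ?D"
      have c: "fst p \<in> carrier T" and l: "lin T scalars (snd p)" using el[OF p] by blast+
      show "lin T T (\<lambda>x. snd p x \<odot>\<^bsub>T\<^esub> fst p)"
        by (rule linI)
          (simp_all only: vs_smult[OF TT c] lin_add[OF l] lin_smult[OF l] scalars_simps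
            vs_add_smult[OF TT c] vs_smult_smult[OF TT c])
    qed
    show "?L t = t"
    proof (rule tprod_eqI[OF T TT L lin_id _ t])
      fix v w assume v: "v \<in> carrier V" and w: "w \<in> carrier W"
      have mb: "vsum T (map (\<lambda>(c, \<psi>). (\<phi> v * \<psi> w) \<odot>\<^bsub>T\<^esub> m b c) DW) = \<phi> v \<odot>\<^bsub>T\<^esub> m b w"
        if "(b, \<phi>) \<in> set DV" for b \<phi>
      proof -
        have b: "b \<in> carrier V" using dual_basis_closed[OF DV that] by simp
        have "\<phi> v \<odot>\<^bsub>T\<^esub> m b w = vsum T (map (\<lambda>(c, \<psi>). \<psi> w \<odot>\<^bsub>T\<^esub> (\<phi> v \<odot>\<^bsub>T\<^esub> m b c)) DW)"
          by (rule dual_basis_lin[OF DW W TT lin_scale[OF TT bilD2[OF tprod_bil[OF T] b]] w])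
        also have "map (\<lambda>(c, \<psi>). \<psi> w \<odot>\<^bsub>T\<^esub> (\<phi> v \<odot>\<^bsub>T\<^esub> m b c)) DW =
            map (\<lambda>(c, \<psi>). (\<phi> v * \<psi> w) \<odot>\<^bsub>T\<^esub> m b c) DW"
          using dual_basis_closed[OF DW] tprod_closed[OF T b] vs_smult_smult[OF TT]
          by (auto simp: mult.commute)
        finally show ?thesis by simp
      qed
      have "?L (m v w) = vsum T (concat (map (\<lambda>(b, \<phi>). map (\<lambda>(c, \<psi>). P \<phi> \<psi> (m v w) \<odot>\<^bsub>T\<^esub> m b c) DW) DV))"
        by (simp add: map_concat comp_def case_prod_unfold)
      also have "map (\<lambda>(b, \<phi>). map (\<lambda>(c, \<psi>). P \<phi> \<psi> (m v w) \<odot>\<^bsub>T\<^esub> m b c) DW) DV =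
          map (\<lambda>(b, \<phi>). map (\<lambda>(c, \<psi>). (\<phi> v * \<psi> w) \<odot>\<^bsub>T\<^esub> m b c) DW) DV"
        using dual_basis_closed[OF DV] dual_basis_closed[OF DW] P v w by auto
      also have "vsum T (concat \<dots>) =
          vsum T (map (vsum T) (map (\<lambda>(b, \<phi>). map (\<lambda>(c, \<psi>). (\<phi> v * \<psi> w) \<odot>\<^bsub>T\<^esub> m b c) DW) DV))"
        by (rule vsum_concat[OF TT])
          (use dual_basis_closed[OF DV] dual_basis_closed[OF DW] vs_smult[OF TT] tprod_closed[OF T] in auto)
      also have "\<dots> = vsum T (map (\<lambda>(b, \<phi>). \<phi> v \<odot>\<^bsub>T\<^esub> m b w) DV)"
        using mb by (auto intro!: arg_cong[where f = "vsum T"])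
      also have "\<dots> = m v w"
        by (rule dual_basis_lin[OF DV V TT bilD1[OF tprod_bil[OF T] w] v, symmetric])
      finally show "?L (m v w) = m v w" .
    qed
  qed
  moreover have "\<forall>(t, f)\<in>set ?D. \<exists>b \<phi> c \<psi>. (b, \<phi>) \<in> set DV \<and> (c, \<psi>) \<in> set DW \<and> t = m b c \<and>
      (\<forall>v\<in>carrier V. \<forall>w\<in>carrier W. f (m v w) = \<phi> v * \<psi> w)"
  proof clarify
    fix t f assume "(t, f) \<in> set ?D"
    then obtain b \<phi> c \<psi> where *: "(t, f) = (m b c, P \<phi> \<psi>)" "(b, \<phi>) \<in> set DV" "(c, \<psi>) \<in> set DW"
      using mem by blast
    moreover have "\<forall>v\<in>carrier V. \<forall>w\<in>carrier W. P \<phi> \<psi> (m v w) = \<phi> v * \<psi> w"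
      using dual_basis_closed[OF DV *(2)] dual_basis_closed[OF DW *(3)] P by blast
    ultimately show "\<exists>b \<phi> c \<psi>. (b, \<phi>) \<in> set DV \<and> (c, \<psi>) \<in> set DW \<and> t = m b c \<and>
      (\<forall>v\<in>carrier V. \<forall>w\<in>carrier W. f (m v w) = \<phi> v * \<psi> w)" by blast
  qed
  ultimately show ?thesis by blast
qed

text \<open>For each \<open>w\<close> the bilinear map \<open>f _ _ w\<close> lifts to a linear map on \<open>T\<close>. Its value at a fixed element of \<open>T\<close> depends
  linearly on \<open>w\<close>, because this holds at \<open>m u v\<close> and is preserved by sums and multiples.\<close>

lemma trilinear_lift:
  assumes T: "tprod U V T m" and W: "is_vs W" and X: "fd_space X"
    and f: "\<And>w. w \<in> carrier W \<Longrightarrow> bil U V X (\<lambda>u v. f u v w)"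
    and f': "\<And>u v. u \<in> carrier U \<Longrightarrow> v \<in> carrier V \<Longrightarrow> lin W X (f u v)"
  shows "\<exists>B. bil T W X B \<and> (\<forall>u\<in>carrier U. \<forall>v\<in>carrier V. \<forall>w\<in>carrier W. B (m u v) w = f u v w)"
proof -
  have XX: "is_vs X" using X by (rule fd_space_vs)
  have "\<forall>w\<in>carrier W. \<exists>h. lin T X h \<and> (\<forall>u\<in>carrier U. \<forall>v\<in>carrier V. h (m u v) = f u v w)"
    using tprod_lift[OF T X f] lin_mapsD by blast
  then obtain h where hl: "\<And>w. w \<in> carrier W \<Longrightarrow> lin T X (h w)"
    and h: "\<And>u v w. u \<in> carrier U \<Longrightarrow> v \<in> carrier V \<Longrightarrow> w \<in> carrier W \<Longrightarrow> h w (m u v) = f u v w"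
    unfolding bchoice_iff by blast
  have linW: "lin W X (\<lambda>w. h w t)" if "t \<in> carrier T" for t
    using T that
  proof (induction rule: tprod_induct)
    case zero
    show ?case
      by (rule lin_cong[OF W lin_const_zero[OF XX]]) (simp add: lin_zero[OF hl tprod_vs[OF T] XX])
  next
    case (base u v)
    show ?case by (rule lin_cong[OF W f'[OF base]]) (simp add: h base)
  next
    case (add x y)
    show ?case
      by (rule lin_cong[OF W lin_plus[OF XX add(3,4)]]) (simp add: lin_add[OF hl] add)
  next
    case (smult c x)
    show ?case
      by (rule lin_cong[OF W lin_scale[OF XX smult(2), of c]]) (simp add: lin_smult[OF hl] smult)
  qed
  have "bil T W X (\<lambda>t w. h w t)" by (rule bilI) (auto intro: hl linW)
  then show ?thesis using h by blast
qed

text \<open>The maps between tensor products are defined by description. The description denotes when some linear map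
  satisfies it and the condition fixes the values on generators.\<close>

lemma the_lin_map:
  assumes T: "is_vs T" and X: "is_vs X" and S: "generates S T"
    and h: "h \<in> lin_maps T X" "P h"
    and unique: "\<And>k s. k \<in> lin_maps T X \<Longrightarrow> P k \<Longrightarrow> s \<in> S \<Longrightarrow> k s = h s"
  shows "(THE k. k \<in> lin_maps T X \<and> P k) \<in> lin_maps T X" "P (THE k. k \<in> lin_maps T X \<and> P k)"
proof -
  have "\<exists>!k. k \<in> lin_maps T X \<and> P k"
    using h by (intro ex1I[of _ h]) (auto intro!: lin_maps_eq_on_generators[OF T X S] unique)
  from theI'[OF this] show "(THE k. k \<in> lin_maps T X \<and> P k) \<in> lin_maps T X" "P (THE k. k \<in> lin_maps T X \<and> P k)"
    by auto
qed

lemma the_tprod_map: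
  assumes T: "tprod V W T m" and X: "fd_space X" and B: "bil V W X B"
  defines "h \<equiv> THE h. h \<in> lin_maps T X \<and> (\<forall>v\<in>carrier V. \<forall>w\<in>carrier W. h (m v w) = B v w)"
  shows "h \<in> lin_maps T X" "\<And>v w. v \<in> carrier V \<Longrightarrow> w \<in> carrier W \<Longrightarrow> h (m v w) = B v w"
proof -
  obtain k where k: "k \<in> lin_maps T X" "\<forall>v\<in>carrier V. \<forall>w\<in>carrier W. k (m v w) = B v w"
    using tprod_lift[OF T X B] by blast
  note * = the_lin_map[OF tprod_vs[OF T] fd_space_vs[OF X] tprod_gen[OF T], of k
      "\<lambda>h. \<forall>v\<in>carrier V. \<forall>w\<in>carrier W. h (m v w) = B v w", folded h_def, OF k]
  show "h \<in> lin_maps T X" by (rule *) (use k in auto)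
  show "h (m v w) = B v w" if "v \<in> carrier V" "w \<in> carrier W" for v w
  proof -
    have "\<forall>v\<in>carrier V. \<forall>w\<in>carrier W. h (m v w) = B v w" by (rule *) (use k in auto)
    then show ?thesis using that by blast
  qed
qed

lemma lin_isoI:
  assumes V: "is_vs V" and W: "is_vs W" and S: "generates S V" and S': "generates S' W"
    and h: "h \<in> lin_maps V W" and k: "lin W V k"
    and kh: "\<And>x. x \<in> S \<Longrightarrow> k (h x) = x" and hk: "\<And>y. y \<in> S' \<Longrightarrow> h (k y) = y"
  shows "lin_iso V W h"
proof -
  have "k (h x) = x" if "x \<in> carrier V" for x
    by (rule lin_eq_on_generators[OF V V S lin_compose[OF lin_mapsD[OF h] k] lin_id kh that])
  moreover have "h (k y) = y" if "y \<in> carrier W" for y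
    by (rule lin_eq_on_generators[OF W W S' lin_compose[OF k lin_mapsD[OF h]] lin_id hk that])
  ultimately have "bij_betw h (carrier V) (carrier W)"
    using lin_closed[OF lin_mapsD[OF h]] lin_closed[OF k] by (intro bij_betw_byWitness[where f' = k]) auto
  then show ?thesis using h by (simp add: lin_iso_def)
qed


subsection \<open>Perfect pairings\<close>

text \<open>A non-degenerate pairing, in the form in which it is used: both spaces have dual bases whose functionals are given by
  pairing with vectors of the other space.\<close>

definition perfect :: "('k::field, 'v) module \<Rightarrow> ('k, 'w) module \<Rightarrow> ('v \<Rightarrow> 'w \<Rightarrow> 'k) \<Rightarrow> bool" where
  "perfect A X p \<longleftrightarrow> is_vs A \<and> is_vs X \<and> bil A X scalars p \<and>
     (\<exists>D. dual_basis X D \<and> (\<forall>(x, f)\<in>set D. \<exists>a\<in>carrier A. \<forall>y\<in>carrier X. f y = p a y)) \<and>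
     (\<exists>D. dual_basis A D \<and> (\<forall>(a, f)\<in>set D. \<exists>x\<in>carrier X. \<forall>b\<in>carrier A. f b = p b x))"

lemma
  assumes "perfect A X p"
  shows perfect_vs1: "is_vs A" and perfect_vs2: "is_vs X" and perfect_bil: "bil A X scalars p"
    and perfect_dual_basis1: "\<exists>D. dual_basis A D \<and> (\<forall>(a, f)\<in>set D. \<exists>x\<in>carrier X. \<forall>b\<in>carrier A. f b = p b x)"
    and perfect_dual_basis2: "\<exists>D. dual_basis X D \<and> (\<forall>(x, f)\<in>set D. \<exists>a\<in>carrier A. \<forall>y\<in>carrier X. f y = p a y)"
  using assms by (simp_all add: perfect_def)

lemma perfect_separates1:
  assumes p: "perfect A X p" and ab: "a \<in> carrier A" "b \<in> carrier A"
    and eq: "\<And>x. x \<in> carrier X \<Longrightarrow> p a x = p b x"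
  shows "a = b"
proof -
  obtain D where D: "dual_basis A D" "\<forall>(a, f)\<in>set D. \<exists>x\<in>carrier X. \<forall>b\<in>carrier A. f b = p b x"
    using perfect_dual_basis1[OF p] by blast
  show ?thesis
    by (rule dual_basis_separates[OF D(1) ab]) (use D(2) eq ab in fastforce)
qed

lemma perfect_represents:
  assumes p: "perfect A X p" and f: "lin X scalars f"
  shows "\<exists>a\<in>carrier A. \<forall>x\<in>carrier X. p a x = f x"
proof -
  obtain D where D: "dual_basis X D" "\<forall>(x, f)\<in>set D. \<exists>a\<in>carrier A. \<forall>y\<in>carrier X. f y = p a y"
    using perfect_dual_basis2[OF p] by blast
  have "\<forall>q\<in>set D. \<exists>a. a \<in> carrier A \<and> (\<forall>y\<in>carrier X. snd q y = p a y)"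
    using D(2) by fastforce
  then obtain r where r: "\<And>q. q \<in> set D \<Longrightarrow> r q \<in> carrier A"
    and rp: "\<And>q y. q \<in> set D \<Longrightarrow> y \<in> carrier X \<Longrightarrow> p (r q) y = snd q y"
    unfolding bchoice_iff by metis
  note A = perfect_vs1[OF p] and X = perfect_vs2[OF p] and b = perfect_bil[OF p]
  let ?xs = "map (\<lambda>q. f (fst q) \<odot>\<^bsub>A\<^esub> r q) D"
  have xs: "set ?xs \<subseteq> carrier A" using r vs_smult[OF A] by auto
  show ?thesis
  proof (intro bexI ballI)
    show "vsum A ?xs \<in> carrier A" by (rule vsum_closed[OF A xs])
    fix x assume x: "x \<in> carrier X"
    have "p (vsum A ?xs) x = vsum scalars (map (\<lambda>a. p a x) ?xs)"
      by (rule lin_vsum[OF bilD1[OF b x] A scalars_vs xs])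
    also have "map (\<lambda>a. p a x) ?xs = map (\<lambda>(b, \<phi>). \<phi> x \<odot>\<^bsub>scalars\<^esub> f b) D"
      using r rp[OF _ x] lin_smult[OF bilD1[OF b x]] by (auto simp: case_prod_unfold)
    also have "vsum scalars \<dots> = f x"
      by (rule dual_basis_lin[OF D(1) X scalars_vs f x, symmetric])
    finally show "p (vsum A ?xs) x = f x" .
  qed
qed

text \<open>\<open>q b \<circ> l\<close> is represented by a vector of \<open>A\<close>, which is unique and hence depends linearly on \<open>b\<close>. This gives both the
  transpose of an arrow and the transpose of an endomorphism of a tensor power.\<close>

lemma perfect_transpose:
  assumes p: "perfect A X p" and q: "perfect B Y q" and l: "lin X Y l"
  defines "P \<equiv> \<lambda>h. \<forall>b\<in>carrier B. \<forall>x\<in>carrier X. p (h b) x = q b (l x)"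
  shows "(THE h. h \<in> lin_maps B A \<and> P h) \<in> lin_maps B A"
    "\<And>b x. b \<in> carrier B \<Longrightarrow> x \<in> carrier X \<Longrightarrow> p ((THE h. h \<in> lin_maps B A \<and> P h) b) x = q b (l x)"
proof -
  note A = perfect_vs1[OF p] and X = perfect_vs2[OF p] and bp = perfect_bil[OF p]
  note B = perfect_vs1[OF q] and Y = perfect_vs2[OF q] and bq = perfect_bil[OF q]
  have "\<forall>b\<in>carrier B. \<exists>a. a \<in> carrier A \<and> (\<forall>x\<in>carrier X. p a x = q b (l x))"
    using perfect_represents[OF p lin_compose[OF l bilD2[OF bq]]] by blast
  then obtain h where h: "\<And>b. b \<in> carrier B \<Longrightarrow> h b \<in> carrier A"
    and hp: "\<And>b x. b \<in> carrier B \<Longrightarrow> x \<in> carrier X \<Longrightarrow> p (h b) x = q b (l x)"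
    unfolding bchoice_iff by metis
  have "lin B A h"
  proof (rule linI)
    show "h (b \<oplus>\<^bsub>B\<^esub> b') = h b \<oplus>\<^bsub>A\<^esub> h b'" if b: "b \<in> carrier B" "b' \<in> carrier B" for b b'
      by (rule perfect_separates1[OF p])
        (simp_all add: h b vs_add[OF A] vs_add[OF B] hp lin_add[OF bilD1[OF bp]] lin_add[OF bilD1[OF bq]]
          lin_closed[OF l])
    show "h (c \<odot>\<^bsub>B\<^esub> b) = c \<odot>\<^bsub>A\<^esub> h b" if b: "b \<in> carrier B" for c b
      by (rule perfect_separates1[OF p])
        (simp_all add: h b vs_smult[OF A] vs_smult[OF B] hp lin_smult[OF bilD1[OF bp]] lin_smult[OF bilD1[OF bq]]
          lin_closed[OF l])
  qed (rule h)
  then have k: "restrict h (carrier B) \<in> lin_maps B A" by (rule restrict_lin_maps[OF B])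
  have Pk: "P (restrict h (carrier B))" by (simp add: P_def hp)
  have gen: "generates (carrier B) B" by (auto simp: generates_def intro: lspan.lspan_base)
  have uniq: "g b = restrict h (carrier B) b" if "g \<in> lin_maps B A" "P g" "b \<in> carrier B" for g b
    by (rule perfect_separates1[OF p])
      (use that in \<open>simp_all add: h hp P_def lin_closed[OF lin_mapsD]\<close>)
  show "(THE h. h \<in> lin_maps B A \<and> P h) \<in> lin_maps B A"
    by (rule the_lin_map(1)[where P = P, OF B A gen k Pk]) (rule uniq)
  have "P (THE h. h \<in> lin_maps B A \<and> P h)"
    by (rule the_lin_map(2)[where P = P, OF B A gen k Pk]) (rule uniq)
  then show "p ((THE h. h \<in> lin_maps B A \<and> P h) b) x = q b (l x)" if "b \<in> carrier B" "x \<in> carrier X" for b x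
    using that unfolding P_def by blast
qed


section \<open>Tensor products and duals inside one type of vectors\<close>

type_synonym ('k, 'a) cmod = "('k, 'a + 'k list) module"

lemma generates_carrier: "generates (carrier V) V"
  by (auto simp: generates_def intro: lspan.lspan_base)

lemma
  fixes V W :: "('k::field, 'a) cmod"
  assumes V: "fd_space V" and W: "fd_space W"
  shows tens_fd: "fd_space (tens V W)"
    and tens_tprod: "tprod V W (tens V W) (tens_vec V W)"
proof -
  have T: "fd_space (tensor [V, W])" using tensor_fd[of "[V, W]"] V W by auto
  show fd: "fd_space (tens V W)" unfolding tens_def by (rule copy_fd[OF T])
  show "tprod V W (tens V W) (tens_vec V W)"
    using tprod_iso[OF tprod_tensor[OF fd_space_vs[OF V] fd_space_vs[OF W]] fd_space_vs[OF copy_fd[OF T]]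
        to_copy_iso[OF T]]
    by (simp add: tens_def tens_vec_def[abs_def])
qed

lemmas tens_vs = fd_space_vs[OF tens_fd]
lemmas tens_vec_closed = tprod_closed[OF tens_tprod]
lemmas tens_vec_bil = tprod_bil[OF tens_tprod]

lemma unit_space_fd: "fd_space (unit_space :: ('k::field, 'a) cmod)"
  unfolding unit_space_def by (rule copy_fd[OF scalars_fd])

lemmas unit_space_vs = fd_space_vs[OF unit_space_fd]

lemma unit_vec_iso: "lin_iso scalars (unit_space :: ('k::field, 'a) cmod) unit_vec"
  unfolding unit_space_def unit_vec_def by (rule to_copy_iso[OF scalars_fd])

definition unit_val :: "'a + 'k list \<Rightarrow> 'k::field" where
  "unit_val = inv_into UNIV unit_vec"

lemma unit_vec_closed [simp]: "unit_vec (c :: 'k) \<in> carrier (unit_space :: ('k::field, 'a) cmod)"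
  using lin_closed[OF lin_isoD(1)[OF unit_vec_iso]] by simp

lemma unit_val_vec [simp]: "unit_val (unit_vec c :: 'a + 'k list) = (c :: 'k::field)"
  using lin_iso_inv_into_left[OF unit_vec_iso, of c] by (simp add: unit_val_def)

lemma unit_vec_val: "u \<in> carrier (unit_space :: ('k::field, 'a) cmod) \<Longrightarrow> unit_vec (unit_val u) = u"
  using lin_iso_inv_into(2)[OF unit_vec_iso, of u] by (simp add: unit_val_def)

lemma unit_val_lin: "lin (unit_space :: ('k::field, 'a) cmod) scalars unit_val"
  using lin_iso_inverse[OF unit_vec_iso scalars_vs] by (simp add: unit_val_def)

lemma unit_vec_lin: "lin scalars (unit_space :: ('k::field, 'a) cmod) unit_vec"
  by (rule lin_isoD(1)[OF unit_vec_iso])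

lemma unit_vec_eq: "unit_vec (c :: 'k) = c \<odot>\<^bsub>unit_space :: ('k::field, 'a) cmod\<^esub> unit_vec (1 :: 'k)"
  using lin_smult[OF unit_vec_lin, of 1 c] by simp

lemma unit_space_gen: "generates {unit_vec (1 :: 'k)} (unit_space :: ('k::field, 'a) cmod)"
proof -
  let ?U = "unit_space :: ('k, 'a) cmod" and ?e = "unit_vec (1 :: 'k)"
  have "u \<in> lspan ?U {?e}" if "u \<in> carrier ?U" for u
  proof -
    have "u = unit_val u \<odot>\<^bsub>?U\<^esub> ?e" using unit_vec_val[OF that] unit_vec_eq[of "unit_val u"] by (rule subst)
    also have "\<dots> \<in> lspan ?U {?e}" by (rule lspan.lspan_smult[OF lspan.lspan_base]) simp
    finally show ?thesis .
  qed
  then show ?thesis by (auto simp: generates_def)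
qed


subsection \<open>The structural maps\<close>

lemma
  fixes V W V' W' :: "('k::field, 'a) cmod"
  assumes fd: "fd_space V" "fd_space W" "fd_space V'" "fd_space W'"
    and k: "lin V V' k" and l: "lin W W' l"
  shows tens_map_lin: "tens_map V V' W W' k l \<in> lin_maps (tens V W) (tens V' W')"
    and tens_map_vec: "\<And>v w. v \<in> carrier V \<Longrightarrow> w \<in> carrier W \<Longrightarrow>
      tens_map V V' W W' k l (tens_vec V W v w) = tens_vec V' W' (k v) (l w)"
  using the_tprod_map[OF tens_tprod[OF fd(1,2)] tens_fd[OF fd(3,4)]
      bil_precompose[OF tens_vec_bil[OF fd(3,4)] k l]]
  unfolding tens_map_def by blast+

lemma
  fixes V W :: "('k::field, 'a) cmod"
  assumes fd: "fd_space V" "fd_space W"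
  shows swap_lin: "swap_map V W \<in> lin_maps (tens V W) (tens W V)"
    and swap_vec: "\<And>v w. v \<in> carrier V \<Longrightarrow> w \<in> carrier W \<Longrightarrow> swap_map V W (tens_vec V W v w) = tens_vec W V w v"
  using the_tprod_map[OF tens_tprod[OF fd] tens_fd[OF fd(2,1)] bil_flip[OF tens_vec_bil[OF fd(2,1)]]]
  unfolding swap_map_def by blast+

lemma bil_unit_left:
  fixes V :: "('k::field, 'a) cmod"
  assumes V: "is_vs V"
  shows "bil unit_space V V (\<lambda>u v. unit_val u \<odot>\<^bsub>V\<^esub> v)"
proof (rule bilI)
  show "lin unit_space V (\<lambda>u. unit_val u \<odot>\<^bsub>V\<^esub> v)" if "v \<in> carrier V" for v
    by (rule linI)
      (simp_all add: that vs_smult[OF V] lin_add[OF unit_val_lin] lin_smult[OF unit_val_lin]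
        vs_add_smult[OF V] vs_smult_smult[OF V])
qed (rule lin_scale[OF V lin_id])

lemma
  fixes V :: "('k::field, 'a) cmod"
  assumes fd: "fd_space V"
  shows lunit_lin: "lunit_map V \<in> lin_maps (tens unit_space V) V"
    and lunit_vec: "\<And>c v. v \<in> carrier V \<Longrightarrow> lunit_map V (tens_vec unit_space V (unit_vec c) v) = c \<odot>\<^bsub>V\<^esub> v"
    and lunit_iso: "lin_iso (tens unit_space V) V (lunit_map V)"
proof -
  note V = fd_space_vs[OF fd]
  note T = tens_tprod[OF unit_space_fd fd]
  obtain h where h: "h \<in> lin_maps (tens unit_space V) V"
    "\<forall>u\<in>carrier (unit_space :: ('k, 'a) cmod). \<forall>v\<in>carrier V. h (tens_vec unit_space V u v) = unit_val u \<odot>\<^bsub>V\<^esub> v"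
    using tprod_lift[OF T fd bil_unit_left[OF V]] by blast
  let ?P = "\<lambda>h. \<forall>c. \<forall>v\<in>carrier V. h (tens_vec unit_space V (unit_vec c) v) = c \<odot>\<^bsub>V\<^esub> v"
  have P: "?P h" using h(2) by simp
  have uniq: "k s = h s" if Pk: "?P k" and sS: "s \<in> (\<lambda>(u, v). tens_vec unit_space V u v) ` (carrier (unit_space :: ('k, 'a) cmod) \<times> carrier V)" for k s
  proof -
    obtain u v where s: "u \<in> carrier (unit_space :: ('k, 'a) cmod)" "v \<in> carrier V" "s = tens_vec unit_space V u v" using sS by auto
    then show ?thesis using Pk P unit_vec_val[OF s(1)] by metis
  qed
  show 1: "lunit_map V \<in> lin_maps (tens unit_space V) V"
    unfolding lunit_map_def by (rule the_lin_map(1)[where P = ?P, OF tprod_vs[OF T] V tprod_gen[OF T] h(1) P]) (rule uniq)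
  have "?P (lunit_map V)"
    unfolding lunit_map_def by (rule the_lin_map(2)[where P = ?P, OF tprod_vs[OF T] V tprod_gen[OF T] h(1) P]) (rule uniq)
  then show 2: "\<And>c v. v \<in> carrier V \<Longrightarrow> lunit_map V (tens_vec unit_space V (unit_vec c) v) = c \<odot>\<^bsub>V\<^esub> v" by blast
  show "lin_iso (tens unit_space V) V (lunit_map V)"
  proof (rule lin_isoI[OF tprod_vs[OF T] V tprod_generates[OF T unit_space_vs V unit_space_gen generates_carrier]
        generates_carrier 1])
    show "lin V (tens unit_space V) (tens_vec unit_space V (unit_vec (1 :: 'k)))"
      by (rule bilD2[OF tprod_bil[OF T]]) simp
  qed (auto simp: 2 vs_one_smult[OF V])
qed

lemma
  fixes V :: "('k::field, 'a) cmod"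
  assumes fd: "fd_space V"
  shows runit_lin: "runit_map V \<in> lin_maps (tens V unit_space) V"
    and runit_vec: "\<And>c v. v \<in> carrier V \<Longrightarrow> runit_map V (tens_vec V unit_space v (unit_vec c)) = c \<odot>\<^bsub>V\<^esub> v"
    and runit_iso: "lin_iso (tens V unit_space) V (runit_map V)"
proof -
  note V = fd_space_vs[OF fd]
  note T = tens_tprod[OF fd unit_space_fd]
  obtain h where h: "h \<in> lin_maps (tens V unit_space) V"
    "\<forall>v\<in>carrier V. \<forall>u\<in>carrier (unit_space :: ('k, 'a) cmod). h (tens_vec V unit_space v u) = unit_val u \<odot>\<^bsub>V\<^esub> v"
    using tprod_lift[OF T fd bil_flip[OF bil_unit_left[OF V]]] by blast
  let ?P = "\<lambda>h. \<forall>c. \<forall>v\<in>carrier V. h (tens_vec V unit_space v (unit_vec c)) = c \<odot>\<^bsub>V\<^esub> v"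
  have P: "?P h" using h(2) by simp
  have uniq: "k s = h s" if Pk: "?P k" and sS: "s \<in> (\<lambda>(v, u). tens_vec V unit_space v u) ` (carrier V \<times> carrier (unit_space :: ('k, 'a) cmod))" for k s
  proof -
    obtain u v where s: "u \<in> carrier (unit_space :: ('k, 'a) cmod)" "v \<in> carrier V" "s = tens_vec V unit_space v u" using sS by auto
    then show ?thesis using Pk P unit_vec_val[OF s(1)] by metis
  qed
  show 1: "runit_map V \<in> lin_maps (tens V unit_space) V"
    unfolding runit_map_def by (rule the_lin_map(1)[where P = ?P, OF tprod_vs[OF T] V tprod_gen[OF T] h(1) P]) (rule uniq)
  have "?P (runit_map V)"
    unfolding runit_map_def by (rule the_lin_map(2)[where P = ?P, OF tprod_vs[OF T] V tprod_gen[OF T] h(1) P]) (rule uniq)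
  then show 2: "\<And>c v. v \<in> carrier V \<Longrightarrow> runit_map V (tens_vec V unit_space v (unit_vec c)) = c \<odot>\<^bsub>V\<^esub> v" by blast
  show "lin_iso (tens V unit_space) V (runit_map V)"
  proof (rule lin_isoI[OF tprod_vs[OF T] V tprod_generates[OF T V unit_space_vs generates_carrier unit_space_gen]
        generates_carrier 1])
    show "lin V (tens V unit_space) (\<lambda>v. tens_vec V unit_space v (unit_vec (1 :: 'k)))"
      by (rule bilD1[OF tprod_bil[OF T]]) simp
  qed (auto simp: 2 vs_one_smult[OF V])
qed

lemma
  fixes U V W :: "('k::field, 'a) cmod"
  assumes U: "fd_space U" and V: "fd_space V" and W: "fd_space W"
  shows tens_assoc_gen: "generates ((\<lambda>(t, w). tens_vec (tens U V) W t w) `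
      (((\<lambda>(u, v). tens_vec U V u v) ` (carrier U \<times> carrier V)) \<times> carrier W)) (tens (tens U V) W)"
    and tens_assoc_gen': "generates ((\<lambda>(u, s). tens_vec U (tens V W) u s) `
      (carrier U \<times> ((\<lambda>(v, w). tens_vec V W v w) ` (carrier V \<times> carrier W)))) (tens U (tens V W))"
  by (rule tprod_generates[OF tens_tprod] tprod_gen[OF tens_tprod] generates_carrier fd_space_vs tens_fd U V W)+

lemma
  fixes U V W :: "('k::field, 'a) cmod"
  assumes U: "fd_space U" and V: "fd_space V" and W: "fd_space W"
  shows assoc_lin: "assoc_map U V W \<in> lin_maps (tens (tens U V) W) (tens U (tens V W))"
    and assoc_vec: "\<And>u v w. u \<in> carrier U \<Longrightarrow> v \<in> carrier V \<Longrightarrow> w \<in> carrier W \<Longrightarrow>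
      assoc_map U V W (tens_vec (tens U V) W (tens_vec U V u v) w) = tens_vec U (tens V W) u (tens_vec V W v w)"
    and assoc_iso: "lin_iso (tens (tens U V) W) (tens U (tens V W)) (assoc_map U V W)"
proof -
  note UV = tens_fd[OF U V] and VW = tens_fd[OF V W]
  note X = tens_fd[OF U VW] and X' = tens_fd[OF UV W]
  note mU = tens_vec_bil[OF U VW] and mV = tens_vec_bil[OF V W] and mU' = tens_vec_bil[OF U V]
    and mW' = tens_vec_bil[OF UV W]
  let ?f = "\<lambda>u v w. tens_vec U (tens V W) u (tens_vec V W v w)"
  let ?g = "\<lambda>v w u. tens_vec (tens U V) W (tens_vec U V u v) w"
  have "\<exists>B. bil (tens U V) W (tens U (tens V W)) B \<and>
      (\<forall>u\<in>carrier U. \<forall>v\<in>carrier V. \<forall>w\<in>carrier W. B (tens_vec U V u v) w = ?f u v w)"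
    by (rule trilinear_lift[OF tens_tprod[OF U V] fd_space_vs[OF W] X])
      (auto intro!: bil_precompose[OF mU lin_id bilD1[OF mV]] lin_compose[OF bilD2[OF mV] bilD2[OF mU]])
  then obtain B where B: "bil (tens U V) W (tens U (tens V W)) B"
    "\<forall>u\<in>carrier U. \<forall>v\<in>carrier V. \<forall>w\<in>carrier W. B (tens_vec U V u v) w = ?f u v w" by blast
  obtain h where h: "h \<in> lin_maps (tens (tens U V) W) (tens U (tens V W))"
    "\<forall>t\<in>carrier (tens U V). \<forall>w\<in>carrier W. h (tens_vec (tens U V) W t w) = B t w"
    using tprod_lift[OF tens_tprod[OF UV W] X B(1)] by blast
  let ?P = "\<lambda>h. \<forall>u\<in>carrier U. \<forall>v\<in>carrier V. \<forall>w\<in>carrier W. h (tens_vec (tens U V) W (tens_vec U V u v) w) = ?f u v w"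
  have P: "?P h" using h(2) B(2) tens_vec_closed[OF U V] by simp
  have uniq: "k s = h s" if "?P k" "s \<in> (\<lambda>(t, w). tens_vec (tens U V) W t w) `
      (((\<lambda>(u, v). tens_vec U V u v) ` (carrier U \<times> carrier V)) \<times> carrier W)" for k s
    using that P by auto
  show 1: "assoc_map U V W \<in> lin_maps (tens (tens U V) W) (tens U (tens V W))"
    unfolding assoc_map_def
    by (rule the_lin_map(1)[where P = ?P, OF fd_space_vs[OF X'] fd_space_vs[OF X] tens_assoc_gen[OF U V W] h(1) P]) (rule uniq)
  have "?P (assoc_map U V W)"
    unfolding assoc_map_def
    by (rule the_lin_map(2)[where P = ?P, OF fd_space_vs[OF X'] fd_space_vs[OF X] tens_assoc_gen[OF U V W] h(1) P]) (rule uniq)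
  then show 2: "\<And>u v w. u \<in> carrier U \<Longrightarrow> v \<in> carrier V \<Longrightarrow> w \<in> carrier W \<Longrightarrow>
      assoc_map U V W (tens_vec (tens U V) W (tens_vec U V u v) w) = ?f u v w" by blast
  have "\<exists>B. bil (tens V W) U (tens (tens U V) W) B \<and>
      (\<forall>v\<in>carrier V. \<forall>w\<in>carrier W. \<forall>u\<in>carrier U. B (tens_vec V W v w) u = ?g v w u)"
    by (rule trilinear_lift[OF tens_tprod[OF V W] fd_space_vs[OF U] X'])
      (auto intro!: bil_precompose[OF mW' bilD2[OF mU'] lin_id] lin_compose[OF bilD1[OF mU'] bilD1[OF mW']])
  then obtain C where C: "bil (tens V W) U (tens (tens U V) W) C"
    "\<forall>v\<in>carrier V. \<forall>w\<in>carrier W. \<forall>u\<in>carrier U. C (tens_vec V W v w) u = ?g v w u" by blast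
  obtain k where k: "k \<in> lin_maps (tens U (tens V W)) (tens (tens U V) W)"
    "\<forall>u\<in>carrier U. \<forall>s\<in>carrier (tens V W). k (tens_vec U (tens V W) u s) = C s u"
    using tprod_lift[OF tens_tprod[OF U VW] X' bil_flip[OF C(1)]] by blast
  have kf: "k (?f u v w) = ?g v w u" if "u \<in> carrier U" "v \<in> carrier V" "w \<in> carrier W" for u v w
    using k(2) C(2) that tens_vec_closed[OF V W] by simp
  show "lin_iso (tens (tens U V) W) (tens U (tens V W)) (assoc_map U V W)"
    by (rule lin_isoI[OF fd_space_vs[OF X'] fd_space_vs[OF X] tens_assoc_gen[OF U V W] tens_assoc_gen'[OF U V W]
          1 lin_mapsD[OF k(1)]]) (auto simp: 2 kf)
qed


subsection \<open>Duals, evaluation and coevaluation\<close>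

lemma
  fixes V :: "('k::field, 'a) cmod"
  assumes fd: "fd_space V"
  shows dual_fd: "fd_space (dual V)"
    and functionals_dual_iso: "lin_iso (functionals V) (dual V) (to_copy (functionals V))"
  unfolding dual_def by (rule copy_fd to_copy_iso functionals_fd fd)+

text \<open>A dual basis of \<open>V\<close> whose functionals are named by vectors of the copy \<open>dual V\<close>.\<close>

definition dual_pairs :: "('k::field, 'a) cmod \<Rightarrow> (('a + 'k list) \<times> ('a + 'k list)) list \<Rightarrow> bool" where
  "dual_pairs V D \<longleftrightarrow> dual_basis V (map (\<lambda>(b, \<beta>). (b, pairing V \<beta>)) D) \<and>
     dual_basis (dual V) (map (\<lambda>(b, \<beta>). (\<beta>, \<lambda>a. pairing V a b)) D) \<and>
     (\<forall>(b, \<beta>)\<in>set D. b \<in> carrier V \<and> \<beta> \<in> carrier (dual V))"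

lemma
  fixes V :: "('k::field, 'a) cmod"
  assumes fd: "fd_space V"
  shows pairing_bil: "bil (dual V) V scalars (pairing V)"
    and dual_pairs_exist: "\<exists>D. dual_pairs V D"
proof -
  note V = fd_space_vs[OF fd] and I = functionals_dual_iso[OF fd]
  note F = functionals_vs[OF V] and DV = fd_space_vs[OF dual_fd[OF fd]]
  show b: "bil (dual V) V scalars (pairing V)"
  proof (rule bilI)
    fix v assume v: "v \<in> carrier V"
    have "lin (functionals V) scalars (\<lambda>f. f v)" by (rule linI) (simp_all add: v)
    from lin_compose[OF lin_iso_inverse[OF I F] this]
    show "lin (dual V) scalars (\<lambda>a. pairing V a v)" by (simp add: pairing_def)
  next
    fix a assume a: "a \<in> carrier (dual V)"
    show "lin V scalars (\<lambda>v. pairing V a v)"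
      using lin_iso_inv_into(1)[OF I a] by (simp add: pairing_def lin_mapsD)
  qed
  obtain D where D: "dual_basis V D" using fd_space_dual_basis[OF fd] ..
  let ?c = "\<lambda>\<phi>. to_copy (functionals V) (restrict \<phi> (carrier V))"
  let ?D = "map (\<lambda>(b, \<phi>). (b, ?c \<phi>)) D"
  have c: "?c \<phi> \<in> carrier (dual V)" and pc: "\<And>v. v \<in> carrier V \<Longrightarrow> pairing V (?c \<phi>) v = \<phi> v"
    if "lin V scalars \<phi>" for \<phi>
    using lin_closed[OF lin_isoD(1)[OF I]] lin_iso_inv_into_left[OF I] restrict_lin_maps[OF V that]
    by (simp_all add: pairing_def)
  have el: "\<forall>(b, \<beta>)\<in>set ?D. b \<in> carrier V \<and> \<beta> \<in> carrier (dual V)"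
    using dual_basis_closed[OF D] c by auto
  have "dual_basis V (map (\<lambda>(b, \<beta>). (b, pairing V \<beta>)) ?D)"
  proof (rule dual_basisI)
    fix v assume v: "v \<in> carrier V"
    have eq: "map (\<lambda>p. snd p v \<odot>\<^bsub>V\<^esub> fst p) (map (\<lambda>(b, \<beta>). (b, pairing V \<beta>)) ?D) = map (\<lambda>(b, \<phi>). \<phi> v \<odot>\<^bsub>V\<^esub> b) D"
      using dual_basis_closed[OF D] pc v by auto
    show "vsum V (map (\<lambda>p. snd p v \<odot>\<^bsub>V\<^esub> fst p) (map (\<lambda>(b, \<beta>). (b, pairing V \<beta>)) ?D)) = v"
      unfolding eq by (rule dual_basis_expand[OF D v])
  next
    fix p assume "p \<in> set (map (\<lambda>(b, \<beta>). (b, pairing V \<beta>)) ?D)"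
    then obtain b' \<psi> where "(b', \<psi>) \<in> set D" and p: "p = (b', pairing V (?c \<psi>))" by auto
    then show "fst p \<in> carrier V" "lin V scalars (snd p)"
      using dual_basis_closed[OF D] bilD2[OF b c] by auto
  qed
  moreover have "dual_basis (dual V) (map (\<lambda>(b, \<beta>). (\<beta>, \<lambda>a. pairing V a b)) ?D)"
    using lin_iso_dual_basis[OF I F DV functionals_dual_basis[OF V D]]
    by (simp add: comp_def case_prod_unfold pairing_def)
  ultimately have "dual_pairs V ?D" using el by (simp add: dual_pairs_def)
  then show "\<exists>D. dual_pairs V D" ..
qed

lemma pairing_perfect:
  fixes V :: "('k::field, 'a) cmod"
  assumes fd: "fd_space V"
  shows "perfect (dual V) V (pairing V)"
proof -
  obtain D where D: "dual_pairs V D" using dual_pairs_exist[OF fd] ..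
  show ?thesis
    unfolding perfect_def
  proof (intro conjI exI)
    show "dual_basis V (map (\<lambda>(b, \<beta>). (b, pairing V \<beta>)) D)"
      "dual_basis (dual V) (map (\<lambda>(b, \<beta>). (\<beta>, \<lambda>a. pairing V a b)) D)"
      using D by (simp_all add: dual_pairs_def)
    show "\<forall>(x, f)\<in>set (map (\<lambda>(b, \<beta>). (b, pairing V \<beta>)) D). \<exists>a\<in>carrier (dual V). \<forall>y\<in>carrier V. f y = pairing V a y"
      "\<forall>(a, f)\<in>set (map (\<lambda>(b, \<beta>). (\<beta>, \<lambda>a. pairing V a b)) D). \<exists>x\<in>carrier V. \<forall>b\<in>carrier (dual V). f b = pairing V b x"
      using D by (fastforce simp: dual_pairs_def)+
  qed (rule fd_space_vs dual_fd pairing_bil fd)+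
qed

lemma
  fixes V W :: "('k::field, 'a) cmod"
  assumes V: "fd_space V" and W: "fd_space W" and l: "lin V W l"
  shows dual_map_lin: "dual_map V W l \<in> lin_maps (dual W) (dual V)"
    and dual_map_pairing: "\<And>b v. b \<in> carrier (dual W) \<Longrightarrow> v \<in> carrier V \<Longrightarrow>
      pairing V (dual_map V W l b) v = pairing W b (l v)"
  using perfect_transpose[OF pairing_perfect[OF V] pairing_perfect[OF W] l]
  unfolding dual_map_def by blast+

text \<open>The canonical element \<open>\<Sum> b \<otimes> \<beta>\<close> of \<open>V \<otimes> V\<^sup>*\<close>. Its contractions \<open>coev_vec_left\<close>
  and \<open>coev_vec_right\<close> are all that is used of it, and they characterise it.\<close>

definition coev_vec :: "('k::field, 'a) cmod \<Rightarrow> 'a + 'k list" where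
  "coev_vec V = vsum (tens V (dual V)) (map (\<lambda>(b, \<beta>). tens_vec V (dual V) b \<beta>) (SOME D. dual_pairs V D))"

text \<open>The two contractions of the canonical element against one of its factors. A linear map on \<open>V \<otimes> V\<^sup>*\<close> that contracts
  the factor \<open>V\<^sup>*\<close> with \<open>w\<close> and applies \<open>g\<close> to the other sends it to \<open>\<Sum> \<beta>(w) g(b) = g(w)\<close>, and likewise on the other side.
  The zig-zag identities are instances of this.\<close>

lemma
  fixes V :: "('k::field, 'a) cmod"
  assumes V: "fd_space V"
  shows coev_vec_closed: "coev_vec V \<in> carrier (tens V (dual V))"
    and coev_vec_left: "\<And>X h g w. is_vs X \<Longrightarrow> lin (tens V (dual V)) X h \<Longrightarrow> lin V X g \<Longrightarrow> w \<in> carrier V \<Longrightarrow>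
      (\<And>v a. v \<in> carrier V \<Longrightarrow> a \<in> carrier (dual V) \<Longrightarrow> h (tens_vec V (dual V) v a) = pairing V a w \<odot>\<^bsub>X\<^esub> g v) \<Longrightarrow>
      h (coev_vec V) = g w"
    and coev_vec_right: "\<And>X h g c. is_vs X \<Longrightarrow> lin (tens V (dual V)) X h \<Longrightarrow> lin (dual V) X g \<Longrightarrow> c \<in> carrier (dual V) \<Longrightarrow>
      (\<And>v a. v \<in> carrier V \<Longrightarrow> a \<in> carrier (dual V) \<Longrightarrow> h (tens_vec V (dual V) v a) = pairing V c v \<odot>\<^bsub>X\<^esub> g a) \<Longrightarrow>
      h (coev_vec V) = g c"
proof -
  define D where "D = (SOME D. dual_pairs V D)"
  have D: "dual_pairs V D" unfolding D_def by (rule someI_ex[OF dual_pairs_exist[OF V]])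
  note DV = dual_fd[OF V]
  note T = tens_vs[OF V DV]
  let ?ts = "map (\<lambda>(b, \<beta>). tens_vec V (dual V) b \<beta>) D"
  have el: "b \<in> carrier V" "\<beta> \<in> carrier (dual V)" if "(b, \<beta>) \<in> set D" for b \<beta>
    using D that by (auto simp: dual_pairs_def)
  have ts: "set ?ts \<subseteq> carrier (tens V (dual V))"
    using el tens_vec_closed[OF V DV] by auto
  have \<kappa>: "coev_vec V = vsum (tens V (dual V)) ?ts" by (simp add: coev_vec_def D_def)
  show "coev_vec V \<in> carrier (tens V (dual V))" unfolding \<kappa> by (rule vsum_closed[OF T ts])
  show "h (coev_vec V) = g w"
    if X: "is_vs X" and h: "lin (tens V (dual V)) X h" and g: "lin V X g" and w: "w \<in> carrier V"
      and hv: "\<And>v a. v \<in> carrier V \<Longrightarrow> a \<in> carrier (dual V) \<Longrightarrow> h (tens_vec V (dual V) v a) = pairing V a w \<odot>\<^bsub>X\<^esub> g v"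
    for X :: "('k, 'x) module" and h g w
  proof -
    have B: "dual_basis V (map (\<lambda>(b, \<beta>). (b, pairing V \<beta>)) D)" using D by (simp add: dual_pairs_def)
    have "h (coev_vec V) = vsum X (map h ?ts)" unfolding \<kappa> by (rule lin_vsum[OF h T X ts])
    also have "map h ?ts = map (\<lambda>(b, \<beta>). pairing V \<beta> w \<odot>\<^bsub>X\<^esub> g b) D" using hv el by auto
    also have "vsum X \<dots> = g w"
      using dual_basis_lin[OF B fd_space_vs[OF V] X g w] by (simp add: comp_def case_prod_unfold)
    finally show ?thesis .
  qed
  show "h (coev_vec V) = g c"
    if X: "is_vs X" and h: "lin (tens V (dual V)) X h" and g: "lin (dual V) X g" and c: "c \<in> carrier (dual V)"
      and hv: "\<And>v a. v \<in> carrier V \<Longrightarrow> a \<in> carrier (dual V) \<Longrightarrow> h (tens_vec V (dual V) v a) = pairing V c v \<odot>\<^bsub>X\<^esub> g a"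
    for X :: "('k, 'x) module" and h g c
  proof -
    have B: "dual_basis (dual V) (map (\<lambda>(b, \<beta>). (\<beta>, \<lambda>a. pairing V a b)) D)" using D by (simp add: dual_pairs_def)
    have "h (coev_vec V) = vsum X (map h ?ts)" unfolding \<kappa> by (rule lin_vsum[OF h T X ts])
    also have "map h ?ts = map (\<lambda>(b, \<beta>). pairing V c b \<odot>\<^bsub>X\<^esub> g \<beta>) D" using hv el by auto
    also have "vsum X \<dots> = g c"
      using dual_basis_lin[OF B fd_space_vs[OF DV] X g c] by (simp add: comp_def case_prod_unfold)
    finally show ?thesis .
  qed
qed

definition ev_map :: "('k::field, 'a) cmod \<Rightarrow> 'a + 'k list \<Rightarrow> 'a + 'k list" where
  "ev_map V = (THE h. h \<in> lin_maps (tens (dual V) V) unit_space \<and>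
     (\<forall>a\<in>carrier (dual V). \<forall>v\<in>carrier V. h (tens_vec (dual V) V a v) = unit_vec (pairing V a v)))"

lemma
  fixes V :: "('k::field, 'a) cmod"
  assumes V: "fd_space V"
  shows ev_lin: "ev_map V \<in> lin_maps (tens (dual V) V) unit_space"
    and ev_vec: "\<And>a v. a \<in> carrier (dual V) \<Longrightarrow> v \<in> carrier V \<Longrightarrow>
      ev_map V (tens_vec (dual V) V a v) = unit_vec (pairing V a v)"
  using the_tprod_map[OF tens_tprod[OF dual_fd[OF V] V] unit_space_fd bil_compose[OF pairing_bil[OF V] unit_vec_lin]]
  unfolding ev_map_def by blast+

definition coev_map :: "('k::field, 'a) cmod \<Rightarrow> 'a + 'k list \<Rightarrow> 'a + 'k list" where
  "coev_map V = (\<lambda>u\<in>carrier (unit_space :: ('k, 'a) cmod). unit_val u \<odot>\<^bsub>tens V (dual V)\<^esub> coev_vec V)"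

lemma
  fixes V :: "('k::field, 'a) cmod"
  assumes V: "fd_space V"
  shows coev_lin: "coev_map V \<in> lin_maps unit_space (tens V (dual V))"
    and coev_one: "coev_map V (unit_vec (1 :: 'k)) = coev_vec V"
proof -
  note T = tens_vs[OF V dual_fd[OF V]]
  show "coev_map V \<in> lin_maps unit_space (tens V (dual V))"
    unfolding coev_map_def
    by (rule restrict_lin_maps[OF unit_space_vs bilD1[OF bil_unit_left[OF T] coev_vec_closed[OF V]]])
  show "coev_map V (unit_vec (1 :: 'k)) = coev_vec V"
    by (simp add: coev_map_def vs_one_smult[OF T] coev_vec_closed[OF V])
qed


section \<open>Tensor powers\<close>

lemma tpow_vs: "is_vs (tpow n V)"
  unfolding tpow_def by (rule tensor_vs)

lemma tpow_fd: "fd_space V \<Longrightarrow> fd_space (tpow n V)"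
  unfolding tpow_def by (rule tensor_fd) simp

lemma tpow_pure_eq: "vs \<in> vecs n V \<Longrightarrow> tpow_pure V vs = pure (replicate n V) vs"
  by (simp add: tpow_pure_def tuples_replicate)

lemma tpow_pure_closed: "vs \<in> vecs n V \<Longrightarrow> tpow_pure V vs \<in> carrier (tpow n V)"
  by (simp add: tpow_pure_eq tpow_def pure_closed)

lemma tpow_gen: "generates (tpow_pure V ` vecs n V) (tpow n V)"
  using pure_generates[of "replicate n V"] by (simp add: tpow_def tpow_pure_eq cong: image_cong_simp)

lemma lspan_mono: "S \<subseteq> T \<Longrightarrow> x \<in> lspan V S \<Longrightarrow> x \<in> lspan V T"
  by (rotate_tac, induction rule: lspan.induct) (auto intro: lspan.intros)

text \<open>The arguments are replaced one at a time by elements of the generating set.\<close>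

lemma mlin_in_lspan:
  assumes V: "is_vs V" and T: "is_vs T" and S: "generates S V"
  shows "mlin (replicate n V) T f \<Longrightarrow> vs \<in> vecs n V \<Longrightarrow>
    f vs \<in> lspan T (f ` {ss. length ss = n \<and> set ss \<subseteq> S})"
proof (induction n arbitrary: f vs)
  case (Suc n)
  obtain v ws where vs: "vs = v # ws" and v: "v \<in> carrier V" and ws: "ws \<in> vecs n V"
    using Suc.prems(2) by (auto simp: tuples_Cons)
  have S': "S \<subseteq> carrier V" "carrier V \<subseteq> lspan V S" using S by (auto simp: generates_def)
  show ?case
    unfolding vs
  proof (rule lin_image_lspan[of V T "\<lambda>v. f (v # ws)", OF _ V T S'(1)])
    show "lin V T (\<lambda>v. f (v # ws))" using Suc.prems(1) ws by (simp add: mlin_Cons)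
    show "v \<in> lspan V S" using S' v by blast
    show "(\<lambda>v. f (v # ws)) ` S \<subseteq> lspan T (f ` {ss. length ss = Suc n \<and> set ss \<subseteq> S})"
    proof clarify
      fix s assume s: "s \<in> S"
      have "f (s # ws) \<in> lspan T ((\<lambda>ss. f (s # ss)) ` {ss. length ss = n \<and> set ss \<subseteq> S})"
        by (rule Suc.IH[of "\<lambda>ss. f (s # ss)"]) (use Suc.prems(1) ws s S' in \<open>auto simp: mlin_Cons\<close>)
      then show "f (s # ws) \<in> lspan T (f ` {ss. length ss = Suc n \<and> set ss \<subseteq> S})"
        by (rule lspan_mono[rotated]) (use s in auto)
    qed
  qed
qed (auto intro: lspan.lspan_base)

lemma tpow_generates:
  assumes V: "is_vs V" and S: "generates S V"
  shows "generates (tpow_pure V ` {ss. length ss = n \<and> set ss \<subseteq> S}) (tpow n V)"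
proof (rule generates_trans[OF tpow_vs tpow_gen])
  let ?A = "{ss. length ss = n \<and> set ss \<subseteq> S}"
  have A: "?A \<subseteq> vecs n V"
    using S by (auto simp: tuples_replicate generates_def)
  then have eq: "tpow_pure V ` ?A = pure (replicate n V) ` ?A"
    by (intro image_cong) (auto simp: tpow_pure_eq)
  show "tpow_pure V ` ?A \<subseteq> carrier (tpow n V)" using A tpow_pure_closed by blast
  show "tpow_pure V ` vecs n V \<subseteq> lspan (tpow n V) (tpow_pure V ` ?A)"
    unfolding eq using mlin_in_lspan[OF V tensor_vs S pure_mlin] by (auto simp: tpow_def tpow_pure_eq)
qed

lemma tpow_eqI:
  assumes "is_vs X" "lin (tpow n V) X h" "lin (tpow n V) X k"
    and "\<And>vs. vs \<in> vecs n V \<Longrightarrow> h (tpow_pure V vs) = k (tpow_pure V vs)" "x \<in> carrier (tpow n V)"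
  shows "h x = k x"
  by (rule lin_eq_on_generators[OF tpow_vs assms(1) tpow_gen assms(2,3) _ assms(5)]) (use assms(4) in blast)

lemma mlin_scale:
  assumes "is_vs W"
  shows "mlin (replicate n V) W f \<Longrightarrow> vs \<in> vecs n V \<Longrightarrow> length cs = n \<Longrightarrow> is_vs V \<Longrightarrow>
    f (map2 (\<lambda>c v. c \<odot>\<^bsub>V\<^esub> v) cs vs) = prod_list cs \<odot>\<^bsub>W\<^esub> f vs"
proof (induction n arbitrary: f vs cs)
  case 0
  then show ?case using vs_one_smult[OF assms] by simp
next
  case (Suc n)
  obtain v ws where vs: "vs = v # ws" and v: "v \<in> carrier V" and ws: "ws \<in> vecs n V"
    using Suc.prems(2) by (auto simp: tuples_Cons)
  obtain c ds where cs: "cs = c # ds" and ds: "length ds = n" using Suc.prems(3) by (cases cs) auto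
  have cv: "c \<odot>\<^bsub>V\<^esub> v \<in> carrier V" by (rule vs_smult[OF Suc.prems(4) v])
  have l: "lin V W (\<lambda>v. f (v # ws))" using Suc.prems(1) ws by (simp add: mlin_Cons)
  have "f (map2 (\<lambda>c v. c \<odot>\<^bsub>V\<^esub> v) cs vs) = prod_list ds \<odot>\<^bsub>W\<^esub> f (c \<odot>\<^bsub>V\<^esub> v # ws)"
    using Suc.IH[of "\<lambda>ws. f (c \<odot>\<^bsub>V\<^esub> v # ws)", OF _ ws ds Suc.prems(4)] Suc.prems(1) cv
    by (simp add: vs cs mlin_Cons)
  also have "\<dots> = prod_list ds \<odot>\<^bsub>W\<^esub> (c \<odot>\<^bsub>W\<^esub> f vs)"
    using lin_smult[OF l v] by (simp add: vs)
  also have "\<dots> = prod_list cs \<odot>\<^bsub>W\<^esub> f vs"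
    using vs_smult_smult[OF assms, of "f vs"] lin_closed[OF l v] by (simp add: cs vs mult.commute)
  finally show ?case .
qed

lemma
  fixes V :: "('k::field, 'v) module" and W :: "('k, 'w) module"
  assumes V: "fd_space V" and W: "fd_space W" and l: "lin V W l"
  shows tpow_map_lin: "tpow_map n V W l \<in> lin_maps (tpow n V) (tpow n W)"
    and tpow_map_pure: "\<And>vs. vs \<in> vecs n V \<Longrightarrow> tpow_map n V W l (tpow_pure V vs) = tpow_pure W (map l vs)"
proof -
  have 1: "\<And>X. X \<in> set (replicate n V) \<Longrightarrow> fd_space X" "\<And>X. X \<in> set (replicate n W) \<Longrightarrow> fd_space X"
    "\<And>i. i < n \<Longrightarrow> lin (replicate n V ! i) (replicate n W ! i) (replicate n l ! i)"
    using V W l by auto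
  show "tpow_map n V W l \<in> lin_maps (tpow n V) (tpow n W)"
    unfolding tpow_map_def tpow_def by (rule tensor_map_lin[where n = n]) (use 1 in auto)
  fix vs assume vs: "vs \<in> vecs n V"
  then have len: "length vs = n" by (simp add: tuples_replicate)
  have "tensor_map (replicate n V) (replicate n W) (replicate n l) (pure (replicate n V) vs)
      = pure (replicate n W) (map2 (\<lambda>f v. f v) (replicate n l) vs)"
    by (rule tensor_map_pure[where n = n]) (use 1 vs in auto)
  moreover have "map2 (\<lambda>f v. f v) (replicate n l) vs = map l vs"
    by (rule nth_equalityI) (simp_all add: len)
  ultimately show "tpow_map n V W l (tpow_pure V vs) = tpow_pure W (map l vs)"
    by (simp add: tpow_map_def tpow_pure_def len)
qed

lemma map_tuples: "lin V W l \<Longrightarrow> vs \<in> vecs n V \<Longrightarrow> map l vs \<in> vecs n W"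
  using lin_closed by (fastforce simp: tuples_replicate)

lemma tpow_map_comp:
  assumes fd: "fd_space V" "fd_space W" "fd_space X" and l: "lin V W l" and k: "lin W X k" and m: "lin V X m"
    and eq: "\<And>v. v \<in> carrier V \<Longrightarrow> m v = k (l v)" and x: "x \<in> carrier (tpow n V)"
  shows "tpow_map n V X m x = tpow_map n W X k (tpow_map n V W l x)"
proof (rule tpow_eqI[OF tpow_vs lin_mapsD[OF tpow_map_lin[OF fd(1,3) m]]
      lin_compose[OF lin_mapsD[OF tpow_map_lin[OF fd(1,2) l]] lin_mapsD[OF tpow_map_lin[OF fd(2,3) k]]] _ x])
  fix vs assume vs: "vs \<in> vecs n V"
  have "map m vs = map k (map l vs)" using vs eq by (auto simp: tuples_replicate)
  then show "tpow_map n V X m (tpow_pure V vs) = tpow_map n W X k (tpow_map n V W l (tpow_pure V vs))"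
    by (simp add: tpow_map_pure fd l k m vs map_tuples[OF l] del: map_map)
qed

lemma tpow_map_ident:
  assumes fd: "fd_space V" and l: "lin V V l" and eq: "\<And>v. v \<in> carrier V \<Longrightarrow> l v = v" and x: "x \<in> carrier (tpow n V)"
  shows "tpow_map n V V l x = x"
proof (rule tpow_eqI[OF tpow_vs lin_mapsD[OF tpow_map_lin[OF fd fd l]] lin_id _ x])
  fix vs assume vs: "vs \<in> vecs n V"
  have "map l vs = vs" using vs eq by (auto simp: tuples_replicate intro: map_idI)
  then show "tpow_map n V V l (tpow_pure V vs) = tpow_pure V vs"
    by (simp add: tpow_map_pure fd l vs)
qed


subsection \<open>Products of functionals\<close>

lemma eval_prod_nth:
  "length \<phi>s = n \<Longrightarrow> length vs = n \<Longrightarrow> eval_prod \<phi>s vs = (\<Prod>i<n. (\<phi>s ! i) (vs ! i))"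
  by (simp add: eval_prod_def prod.list_conv_set_nth atLeast0LessThan)

lemma tpow_functional:
  assumes V: "is_vs V" and len: "length \<phi>s = n" and \<phi>s: "\<And>i. i < n \<Longrightarrow> lin V scalars (\<phi>s ! i)"
  shows "\<exists>f. lin (tpow n V) scalars f \<and>
    (\<forall>vs\<in>vecs n V. f (tpow_pure V vs) = (\<Prod>i<n. (\<phi>s ! i) (vs ! i)))"
proof -
  have l: "list_all2 (\<lambda>\<phi> V. lin V scalars \<phi>) \<phi>s (replicate n V)"
    using len \<phi>s by (simp add: list_all2_conv_all_nth)
  have V': "\<And>X. X \<in> set (replicate n V) \<Longrightarrow> is_vs X" using V by simp
  show ?thesis
    using eval_lin[OF prod_form_multilinear[OF V' l]] pure_prod_form[OF V' l]
    by (intro exI[of _ "\<lambda>x. x (prod_form (replicate n V) \<phi>s)"])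
      (auto simp: tpow_def tpow_pure_eq eval_prod_nth[OF len] tuples_length)
qed

text \<open>Only the members of the given dual basis \<open>D\<close> enter the product functionals. With \<open>D\<close> consisting of simple tensors
  \<open>\<phi> \<otimes> \<psi>\<close> this gives functionals on \<open>(V \<otimes> W)\<^sup>\<otimes>\<^sup>n\<close> that correspond under regrouping to
  functionals on \<open>V\<^sup>\<otimes>\<^sup>n \<otimes> W\<^sup>\<otimes>\<^sup>n\<close>.\<close>

lemma tpow_dual_basis:
  assumes V: "is_vs V" and D: "dual_basis V D"
  shows "\<exists>E. dual_basis (tpow n V) E \<and> (\<forall>(t, f)\<in>set E. \<exists>bs \<phi>s. length bs = n \<and> length \<phi>s = n \<and>
      (\<forall>i<n. (bs ! i, \<phi>s ! i) \<in> set D) \<and> t = tpow_pure V bs \<and>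
      (\<forall>vs\<in>vecs n V. f (tpow_pure V vs) = (\<Prod>i<n. (\<phi>s ! i) (vs ! i))))"
proof -
  have V': "\<And>X. X \<in> set (replicate n V) \<Longrightarrow> is_vs X" using V by simp
  have D': "list_all2 dual_basis (replicate n V) (replicate n D)"
    using D by (simp add: list_all2_conv_all_nth)
  let ?E = "map (\<lambda>(bs, \<phi>s). (pure (replicate n V) bs, \<lambda>x. x (prod_form (replicate n V) \<phi>s))) (prod_dual (replicate n D))"
  have "dual_basis (tpow n V) ?E"
    unfolding tpow_def by (rule tensor_dual_basis[OF D' V'])
  moreover have "\<exists>bs \<phi>s. length bs = n \<and> length \<phi>s = n \<and>
      (\<forall>i<n. (bs ! i, \<phi>s ! i) \<in> set D) \<and> t = tpow_pure V bs \<and>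
      (\<forall>vs\<in>vecs n V. f (tpow_pure V vs) = (\<Prod>i<n. (\<phi>s ! i) (vs ! i)))"
    if tf: "(t, f) \<in> set ?E" for t f
  proof -
    obtain bs \<phi>s where m: "(bs, \<phi>s) \<in> set (prod_dual (replicate n D))"
      and t: "t = pure (replicate n V) bs" and f: "f = (\<lambda>x. x (prod_form (replicate n V) \<phi>s))"
      using tf by auto
    note P = prod_dual_mem[OF D' m]
    have len: "length bs = n" "length \<phi>s = n"
      using P(1,2) by (auto simp: tuples_replicate dest: list_all2_lengthD)
    have "\<forall>i<n. (bs ! i, \<phi>s ! i) \<in> set D"
      using P(3) len by (simp add: list_all2_conv_all_nth)
    moreover have "\<forall>vs\<in>vecs n V. f (tpow_pure V vs) = (\<Prod>i<n. (\<phi>s ! i) (vs ! i))"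
      using pure_prod_form[OF V' P(2)] eval_prod_nth[OF len(2)]
      by (auto simp: f tpow_pure_eq tuples_replicate)
    ultimately show ?thesis using len P(1) by (metis t tpow_pure_eq)
  qed
  ultimately show ?thesis by blast
qed


lemma dual_basis_separates_image:
  assumes "dual_basis V D" "v \<in> carrier V" "w \<in> carrier V" "\<And>f. f \<in> snd ` set D \<Longrightarrow> f v = f w"
  shows "v = w"
  by (rule dual_basis_separates[OF assms(1-3)]) (metis assms(4) imageI snd_conv)


subsection \<open>Regrouping\<close>

lemma tuples_replicate_nth: "vs \<in> vecs n V \<longleftrightarrow> length vs = n \<and> (\<forall>i<n. vs ! i \<in> carrier V)"
  by (auto simp: tuples_def list_all2_conv_all_nth)

lemma set_map2_sub: "set (map2 m vs ws) \<subseteq> (\<lambda>(v, w). m v w) ` (set vs \<times> set ws)"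
  by (induction vs ws rule: list_induct2') auto

lemma map2_tens_tuples:
  fixes V W :: "('k::field, 'a) cmod"
  assumes "fd_space V" "fd_space W" "vs \<in> vecs n V" "ws \<in> vecs n W"
  shows "map2 (tens_vec V W) vs ws \<in> vecs n (tens V W)"
  using assms(3,4) tens_vec_closed[OF assms(1,2)] by (simp add: tuples_replicate_nth)

lemma split_simple_tensors:
  "set ts \<subseteq> (\<lambda>(v, w). m v w) ` (A \<times> B) \<Longrightarrow>
    \<exists>vs ws. length vs = length ws \<and> set vs \<subseteq> A \<and> set ws \<subseteq> B \<and> ts = map2 m vs ws"
proof (induction ts)
  case (Cons t ts)
  have "set ts \<subseteq> (\<lambda>(v, w). m v w) ` (A \<times> B)" using Cons.prems by simp
  from Cons.IH[OF this]
  obtain vs ws where *: "length vs = length ws" "set vs \<subseteq> A" "set ws \<subseteq> B" "ts = map2 m vs ws"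
    by blast
  obtain v w where "v \<in> A" "w \<in> B" "t = m v w" using Cons.prems by auto
  with * show ?case
    by (intro exI[of _ "v # vs"] exI[of _ "w # ws"]) simp
qed (intro exI[of _ "[]"], simp)

text \<open>The index set of the two families of generators that regrouping identifies.\<close>

definition simple_pairs :: "nat \<Rightarrow> ('k::field, 'v) module \<Rightarrow> ('k, 'w) module \<Rightarrow> ('v list \<times> 'w list) set" where
  "simple_pairs n V W = vecs n V \<times> vecs n W"

lemma
  fixes V W :: "('k::field, 'a) cmod"
  assumes V: "fd_space V" and W: "fd_space W"
  shows regroup_gen1: "generates ((\<lambda>(vs, ws). tpow_pure (tens V W) (map2 (tens_vec V W) vs ws)) ` simple_pairs n V W)
      (tpow n (tens V W))"
    and regroup_gen2: "generates ((\<lambda>(vs, ws). pure [tpow n V, tpow n W] [tpow_pure V vs, tpow_pure W ws]) ` simple_pairs n V W)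
      (tensor [tpow n V, tpow n W])"
proof -
  note TV = tens_vs[OF V W]
  let ?S = "(\<lambda>(v, w). tens_vec V W v w) ` (carrier V \<times> carrier W)"
  have "{ss. length ss = n \<and> set ss \<subseteq> ?S} = (\<lambda>(vs, ws). map2 (tens_vec V W) vs ws) ` simple_pairs n V W" (is "?l = ?r")
  proof (intro equalityI subsetI)
    fix ts assume ts: "ts \<in> ?l"
    then have "set ts \<subseteq> ?S" by simp
    from split_simple_tensors[OF this]
    obtain vs ws where *: "length vs = length ws" "set vs \<subseteq> carrier V" "set ws \<subseteq> carrier W"
      and eq: "ts = map2 (tens_vec V W) vs ws" by blast
    have "(vs, ws) \<in> simple_pairs n V W" using * ts unfolding eq by (simp add: simple_pairs_def tuples_replicate)
    then show "ts \<in> ?r" by (rule image_eqI[rotated]) (simp add: eq)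
  next
    fix ts assume "ts \<in> ?r"
    then obtain vs ws where ts: "ts = map2 (tens_vec V W) vs ws"
      and "length vs = n" "length ws = n" "set vs \<subseteq> carrier V" "set ws \<subseteq> carrier W"
      by (auto simp: simple_pairs_def tuples_replicate)
    moreover from this have "(\<lambda>(v, w). tens_vec V W v w) ` (set vs \<times> set ws) \<subseteq> ?S" by blast
    ultimately show "ts \<in> ?l" using set_map2_sub[of "tens_vec V W" vs ws] by simp
  qed
  then show "generates ((\<lambda>(vs, ws). tpow_pure (tens V W) (map2 (tens_vec V W) vs ws)) ` simple_pairs n V W) (tpow n (tens V W))"
    using tpow_generates[OF TV tprod_gen[OF tens_tprod[OF V W]], of n]
    by (simp add: image_image case_prod_unfold)
  have "(\<lambda>(x, y). pure [tpow n V, tpow n W] [x, y]) ` (tpow_pure V ` vecs n V \<times> tpow_pure W ` vecs n W)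
      = (\<lambda>(vs, ws). pure [tpow n V, tpow n W] [tpow_pure V vs, tpow_pure W ws]) ` simple_pairs n V W"
    unfolding simple_pairs_def by force
  then show "generates ((\<lambda>(vs, ws). pure [tpow n V, tpow n W] [tpow_pure V vs, tpow_pure W ws]) ` simple_pairs n V W)
      (tensor [tpow n V, tpow n W])"
    using tprod_generates[OF tprod_tensor[OF tpow_vs tpow_vs] tpow_vs tpow_vs tpow_gen tpow_gen, of n V n W] by simp
qed

text \<open>Both spaces have dual bases with functionals \<open>\<Prod> \<phi>\<^sub>i(v\<^sub>i) \<psi>\<^sub>i(w\<^sub>i)\<close> on the generators indexed by
  \<open>(vs, ws)\<close>, on one side as \<open>\<Prod> (\<phi>\<^sub>i \<otimes> \<psi>\<^sub>i)(v\<^sub>i \<otimes> w\<^sub>i)\<close> and on the other as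
  \<open>(\<Prod> \<phi>\<^sub>i(v\<^sub>i)) (\<Prod> \<psi>\<^sub>i(w\<^sub>i))\<close>. So \<open>lin_extend\<close> applies in both directions.\<close>

lemma regroup_maps:
  fixes V W :: "('k::field, 'a) cmod"
  assumes V: "fd_space V" and W: "fd_space W"
  shows "\<exists>h\<in>lin_maps (tpow n (tens V W)) (tensor [tpow n V, tpow n W]). \<forall>i\<in>simple_pairs n V W.
      h ((\<lambda>(vs, ws). tpow_pure (tens V W) (map2 (tens_vec V W) vs ws)) i) =
      (\<lambda>(vs, ws). pure [tpow n V, tpow n W] [tpow_pure V vs, tpow_pure W ws]) i"
      (is "\<exists>h\<in>lin_maps ?X ?Y. \<forall>i\<in>?I. h (?x i) = ?y i")
    and "\<exists>h\<in>lin_maps (tensor [tpow n V, tpow n W]) (tpow n (tens V W)). \<forall>i\<in>simple_pairs n V W.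
      h ((\<lambda>(vs, ws). pure [tpow n V, tpow n W] [tpow_pure V vs, tpow_pure W ws]) i) =
      (\<lambda>(vs, ws). tpow_pure (tens V W) (map2 (tens_vec V W) vs ws)) i"
proof -
  note VV = fd_space_vs[OF V] and WW = fd_space_vs[OF W] and TT = tens_vs[OF V W]
  note TY = tprod_tensor[OF tpow_vs tpow_vs, of n V n W]
  obtain DV where DV: "dual_basis V DV" using fd_space_dual_basis[OF V] ..
  obtain DW where DW: "dual_basis W DW" using fd_space_dual_basis[OF W] ..
  have vsD: "length vs = n \<and> (\<forall>i<n. vs ! i \<in> carrier V)" if "vs \<in> vecs n V" for vs and V :: "('k, 'a) cmod"
    using that by (simp add: tuples_replicate_nth)
  show "\<exists>h\<in>lin_maps ?X ?Y. \<forall>i\<in>?I. h (?x i) = ?y i"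
  proof -
    obtain EV where EV: "dual_basis (tpow n V) EV" and EV': "\<forall>(t, f)\<in>set EV. \<exists>bs \<phi>s. length bs = n \<and> length \<phi>s = n \<and>
      (\<forall>i<n. (bs ! i, \<phi>s ! i) \<in> set DV) \<and> t = tpow_pure V bs \<and>
      (\<forall>vs\<in>vecs n V. f (tpow_pure V vs) = (\<Prod>i<n. (\<phi>s ! i) (vs ! i)))"
      using tpow_dual_basis[OF VV DV] by blast
    obtain EW where EW: "dual_basis (tpow n W) EW" and EW': "\<forall>(t, f)\<in>set EW. \<exists>bs \<phi>s. length bs = n \<and> length \<phi>s = n \<and>
      (\<forall>i<n. (bs ! i, \<phi>s ! i) \<in> set DW) \<and> t = tpow_pure W bs \<and>
      (\<forall>vs\<in>vecs n W. f (tpow_pure W vs) = (\<Prod>i<n. (\<phi>s ! i) (vs ! i)))"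
      using tpow_dual_basis[OF WW DW] by blast
    obtain D where D: "dual_basis ?Y D" and D': "\<forall>(t, f)\<in>set D. \<exists>b \<phi> c \<psi>. (b, \<phi>) \<in> set EV \<and> (c, \<psi>) \<in> set EW \<and>
      t = pure [tpow n V, tpow n W] [b, c] \<and>
      (\<forall>x\<in>carrier (tpow n V). \<forall>y\<in>carrier (tpow n W). f (pure [tpow n V, tpow n W] [x, y]) = \<phi> x * \<psi> y)"
      using tprod_dual_basis[OF TY tpow_vs tpow_vs EV EW] by blast
    show ?thesis
    proof (rule lin_extend[where F = "snd ` set D", OF tpow_vs tensor_vs regroup_gen1[OF V W]])
      show "?y i \<in> carrier ?Y" if "i \<in> ?I" for i
        using that by (auto simp: simple_pairs_def intro!: pure_closed tpow_pure_closed)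
      show "b = b'" if "b \<in> carrier ?Y" "b' \<in> carrier ?Y" "\<And>f. f \<in> snd ` set D \<Longrightarrow> f b = f b'" for b b'
        by (rule dual_basis_separates_image[OF D that])
      fix f assume "f \<in> snd ` set D"
      then obtain t where tf: "(t, f) \<in> set D" by auto
      then obtain b \<phi> c \<psi> where bc: "(b, \<phi>) \<in> set EV" "(c, \<psi>) \<in> set EW"
        and f: "\<forall>x\<in>carrier (tpow n V). \<forall>y\<in>carrier (tpow n W). f (pure [tpow n V, tpow n W] [x, y]) = \<phi> x * \<psi> y"
        using D' by blast
      obtain bs \<phi>s where \<phi>s: "length bs = n" "length \<phi>s = n" "\<forall>i<n. (bs ! i, \<phi>s ! i) \<in> set DV"
        "\<forall>vs\<in>vecs n V. \<phi> (tpow_pure V vs) = (\<Prod>i<n. (\<phi>s ! i) (vs ! i))"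
        using EV' bc(1) by blast
      obtain cs \<psi>s where \<psi>s: "length cs = n" "length \<psi>s = n" "\<forall>i<n. (cs ! i, \<psi>s ! i) \<in> set DW"
        "\<forall>vs\<in>vecs n W. \<psi> (tpow_pure W vs) = (\<Prod>i<n. (\<psi>s ! i) (vs ! i))"
        using EW' bc(2) by blast
      have "\<forall>i<n. \<exists>\<tau>. lin (tens V W) scalars \<tau> \<and>
          (\<forall>v\<in>carrier V. \<forall>w\<in>carrier W. \<tau> (tens_vec V W v w) = (\<phi>s ! i) v * (\<psi>s ! i) w)"
      proof (intro allI impI)
        fix i assume i: "i < n"
        have "lin V scalars (\<phi>s ! i)" "lin W scalars (\<psi>s ! i)"
          using i \<phi>s(3) \<psi>s(3) dual_basis_closed[OF DV] dual_basis_closed[OF DW] by blast+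
        then have "bil V W scalars (\<lambda>v w. (\<phi>s ! i) v * (\<psi>s ! i) w)"
          using lin_times[of V "\<phi>s ! i"] lin_scale[OF scalars_vs, of W "\<psi>s ! i"] by (intro bilI) simp_all
        from tprod_form[OF tens_tprod[OF V W] this]
        show "\<exists>\<tau>. lin (tens V W) scalars \<tau> \<and>
          (\<forall>v\<in>carrier V. \<forall>w\<in>carrier W. \<tau> (tens_vec V W v w) = (\<phi>s ! i) v * (\<psi>s ! i) w)" .
      qed
      then obtain \<tau> where \<tau>: "\<And>i. i < n \<Longrightarrow> lin (tens V W) scalars (\<tau> i)"
        "\<And>i v w. i < n \<Longrightarrow> v \<in> carrier V \<Longrightarrow> w \<in> carrier W \<Longrightarrow> \<tau> i (tens_vec V W v w) = (\<phi>s ! i) v * (\<psi>s ! i) w"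
        unfolding choice_iff' by blast
      obtain g where g: "lin ?X scalars g"
        "\<forall>ts\<in>vecs n (tens V W). g (tpow_pure (tens V W) ts) = (\<Prod>i<n. (map \<tau> [0..<n] ! i) (ts ! i))"
        using tpow_functional[OF TT, of "map \<tau> [0..<n]" n] \<tau>(1) by auto
      have "g (?x i) = f (?y i)" if iI: "i \<in> ?I" for i
      proof -
        obtain vs ws where i: "i = (vs, ws)" "vs \<in> vecs n V" "ws \<in> vecs n W"
          using iI by (auto simp: simple_pairs_def)
        have "g (?x i) = (\<Prod>i<n. (\<phi>s ! i) (vs ! i) * (\<psi>s ! i) (ws ! i))"
          using vsD[OF i(2)] vsD[OF i(3)] g(2) map2_tens_tuples[OF V W i(2,3)] \<tau>(2) by (simp add: i)
        also have "\<dots> = f (?y i)"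
          using f tpow_pure_closed[OF i(2)] tpow_pure_closed[OF i(3)] \<phi>s(4) \<psi>s(4) i by (simp add: prod.distrib)
        finally show ?thesis .
      qed
      then show "lin ?Y scalars f \<and> (\<exists>g. lin ?X scalars g \<and> (\<forall>i\<in>?I. g (?x i) = f (?y i)))"
        using dual_basis_closed[OF D tf] g(1) by blast
    qed
  qed
  show "\<exists>h\<in>lin_maps ?Y ?X. \<forall>i\<in>?I. h (?y i) = ?x i"
  proof -
    obtain D where D: "dual_basis (tens V W) D" and D': "\<forall>(t, f)\<in>set D. \<exists>b \<phi> c \<psi>. (b, \<phi>) \<in> set DV \<and> (c, \<psi>) \<in> set DW \<and>
      t = tens_vec V W b c \<and> (\<forall>x\<in>carrier V. \<forall>y\<in>carrier W. f (tens_vec V W x y) = \<phi> x * \<psi> y)"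
      using tprod_dual_basis[OF tens_tprod[OF V W] VV WW DV DW] by blast
    obtain E where E: "dual_basis ?X E" and E': "\<forall>(t, f)\<in>set E. \<exists>bs \<tau>s. length bs = n \<and> length \<tau>s = n \<and>
      (\<forall>i<n. (bs ! i, \<tau>s ! i) \<in> set D) \<and> t = tpow_pure (tens V W) bs \<and>
      (\<forall>ts\<in>vecs n (tens V W). f (tpow_pure (tens V W) ts) = (\<Prod>i<n. (\<tau>s ! i) (ts ! i)))"
      using tpow_dual_basis[OF TT D] by blast
    show ?thesis
    proof (rule lin_extend[where F = "snd ` set E", OF tensor_vs tpow_vs regroup_gen2[OF V W]])
      show "?x i \<in> carrier ?X" if "i \<in> ?I" for i
        using that by (auto simp: simple_pairs_def intro!: tpow_pure_closed map2_tens_tuples V W)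
      show "b = b'" if "b \<in> carrier ?X" "b' \<in> carrier ?X" "\<And>f. f \<in> snd ` set E \<Longrightarrow> f b = f b'" for b b'
        by (rule dual_basis_separates_image[OF E that])
      fix f assume "f \<in> snd ` set E"
      then obtain t where tf: "(t, f) \<in> set E" by auto
      then obtain bs \<tau>s where \<tau>s: "length \<tau>s = n" "\<forall>i<n. (bs ! i, \<tau>s ! i) \<in> set D"
        "\<forall>ts\<in>vecs n (tens V W). f (tpow_pure (tens V W) ts) = (\<Prod>i<n. (\<tau>s ! i) (ts ! i))"
        using E' by blast
      have "\<forall>i<n. \<exists>\<phi> \<psi>. lin V scalars \<phi> \<and> lin W scalars \<psi> \<and>
          (\<forall>v\<in>carrier V. \<forall>w\<in>carrier W. (\<tau>s ! i) (tens_vec V W v w) = \<phi> v * \<psi> w)"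
        using \<tau>s(2) D' dual_basis_closed[OF DV] dual_basis_closed[OF DW] by blast
      then obtain \<phi> \<psi> where \<phi>: "\<And>i. i < n \<Longrightarrow> lin V scalars (\<phi> i)" and \<psi>: "\<And>i. i < n \<Longrightarrow> lin W scalars (\<psi> i)"
        and \<tau>: "\<And>i v w. i < n \<Longrightarrow> v \<in> carrier V \<Longrightarrow> w \<in> carrier W \<Longrightarrow> (\<tau>s ! i) (tens_vec V W v w) = \<phi> i v * \<psi> i w"
        unfolding choice_iff' by blast
      obtain p where p: "lin (tpow n V) scalars p"
        "\<forall>vs\<in>vecs n V. p (tpow_pure V vs) = (\<Prod>i<n. (map \<phi> [0..<n] ! i) (vs ! i))"
        using tpow_functional[OF VV, of "map \<phi> [0..<n]" n] \<phi> by auto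
      obtain q where q: "lin (tpow n W) scalars q"
        "\<forall>vs\<in>vecs n W. q (tpow_pure W vs) = (\<Prod>i<n. (map \<psi> [0..<n] ! i) (vs ! i))"
        using tpow_functional[OF WW, of "map \<psi> [0..<n]" n] \<psi> by auto
      have "bil (tpow n V) (tpow n W) scalars (\<lambda>x y. p x * q y)"
        using lin_times[OF p(1)] lin_scale[OF scalars_vs q(1)] by (intro bilI) simp_all
      from tprod_form[OF TY this] obtain g where g: "lin ?Y scalars g"
        "\<forall>x\<in>carrier (tpow n V). \<forall>y\<in>carrier (tpow n W). g (pure [tpow n V, tpow n W] [x, y]) = p x * q y"
        by blast
      have "g (?y i) = f (?x i)" if iI: "i \<in> ?I" for i
      proof -
        obtain vs ws where i: "i = (vs, ws)" "vs \<in> vecs n V" "ws \<in> vecs n W"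
          using iI by (auto simp: simple_pairs_def)
        have "f (?x i) = (\<Prod>i<n. \<phi> i (vs ! i) * \<psi> i (ws ! i))"
          using vsD[OF i(2)] vsD[OF i(3)] \<tau>s(3) map2_tens_tuples[OF V W i(2,3)] \<tau> by (simp add: i)
        also have "\<dots> = g (?y i)"
          using g(2) tpow_pure_closed[OF i(2)] tpow_pure_closed[OF i(3)] p(2) q(2) i by (simp add: prod.distrib)
        finally show ?thesis by simp
      qed
      then show "lin ?X scalars f \<and> (\<exists>g. lin ?Y scalars g \<and> (\<forall>i\<in>?I. g (?y i) = f (?x i)))"
        using dual_basis_closed[OF E tf] g(1) by blast
    qed
  qed
qed

lemma
  fixes V W :: "('k::field, 'a) cmod"
  assumes V: "fd_space V" and W: "fd_space W"
  shows regroup_iso: "lin_iso (tpow n (tens V W)) (tensor [tpow n V, tpow n W]) (regroup n V W)"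
    and regroup_pure: "\<And>vs ws. vs \<in> vecs n V \<Longrightarrow> ws \<in> vecs n W \<Longrightarrow>
      regroup n V W (tpow_pure (tens V W) (map2 (tens_vec V W) vs ws)) = pure [tpow n V, tpow n W] [tpow_pure V vs, tpow_pure W ws]"
proof -
  let ?X = "tpow n (tens V W)" and ?Y = "tensor [tpow n V, tpow n W]"
  obtain h where h: "h \<in> lin_maps ?X ?Y" and hp: "\<forall>i\<in>simple_pairs n V W.
      h ((\<lambda>(vs, ws). tpow_pure (tens V W) (map2 (tens_vec V W) vs ws)) i) =
      (\<lambda>(vs, ws). pure [tpow n V, tpow n W] [tpow_pure V vs, tpow_pure W ws]) i"
    using regroup_maps(1)[OF V W] by blast
  obtain k where k: "k \<in> lin_maps ?Y ?X" and kp: "\<forall>i\<in>simple_pairs n V W.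
      k ((\<lambda>(vs, ws). pure [tpow n V, tpow n W] [tpow_pure V vs, tpow_pure W ws]) i) =
      (\<lambda>(vs, ws). tpow_pure (tens V W) (map2 (tens_vec V W) vs ws)) i"
    using regroup_maps(2)[OF V W] by blast
  let ?P = "\<lambda>h. \<forall>vs\<in>vecs n V. \<forall>ws\<in>vecs n W.
        h (tpow_pure (tens V W) (map2 (tens_vec V W) vs ws)) = pure [tpow n V, tpow n W] [tpow_pure V vs, tpow_pure W ws]"
  have P: "?P h" using hp by (auto simp: simple_pairs_def)
  have uniq: "g s = h s" if "?P g" "s \<in> (\<lambda>(vs, ws). tpow_pure (tens V W) (map2 (tens_vec V W) vs ws)) ` simple_pairs n V W" for g s
    using that P by (auto simp: simple_pairs_def)
  have 1: "regroup n V W \<in> lin_maps ?X ?Y"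
    unfolding regroup_def
    by (rule the_lin_map(1)[where P = ?P, OF tpow_vs tensor_vs regroup_gen1[OF V W] h P]) (rule uniq)
  have 2: "?P (regroup n V W)"
    unfolding regroup_def
    by (rule the_lin_map(2)[where P = ?P, OF tpow_vs tensor_vs regroup_gen1[OF V W] h P]) (rule uniq)
  then show "\<And>vs ws. vs \<in> vecs n V \<Longrightarrow> ws \<in> vecs n W \<Longrightarrow>
      regroup n V W (tpow_pure (tens V W) (map2 (tens_vec V W) vs ws)) = pure [tpow n V, tpow n W] [tpow_pure V vs, tpow_pure W ws]"
    by blast
  show "lin_iso ?X ?Y (regroup n V W)"
    by (rule lin_isoI[OF tpow_vs tensor_vs regroup_gen1[OF V W] regroup_gen2[OF V W] 1 lin_mapsD[OF k]])
      (use kp 2 in \<open>auto simp: simple_pairs_def\<close>)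
qed

lemma lin_iso_flip:
  assumes f: "lin_iso V W f" and V: "is_vs V" and W: "is_vs W"
  shows "lin_iso W V (restrict (inv_into (carrier V) f) (carrier W))"
  unfolding lin_iso_def
proof
  show "restrict (inv_into (carrier V) f) (carrier W) \<in> lin_maps W V"
    by (rule restrict_lin_maps[OF W lin_iso_inverse[OF f V]])
  show "bij_betw (restrict (inv_into (carrier V) f) (carrier W)) (carrier W) (carrier V)"
    using bij_betw_inv_into[of f "carrier V" "carrier W"] f
    by (simp add: lin_iso_def)
qed

text \<open>The inverse of regrouping as a bilinear map. The restriction of the inverse function makes it literally the composite
  with a linear isomorphism, to which \<open>tprod_iso\<close> applies.\<close>

definition merge :: "nat \<Rightarrow> ('k::field, 'a) cmod \<Rightarrow> ('k, 'a) cmod \<Rightarrow> ((('a + 'k list) list \<Rightarrow> 'k) \<Rightarrow> 'k) \<Rightarrow>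
    ((('a + 'k list) list \<Rightarrow> 'k) \<Rightarrow> 'k) \<Rightarrow> ((('a + 'k list) list \<Rightarrow> 'k) \<Rightarrow> 'k)" where
  "merge n V W x y = restrict (inv_into (carrier (tpow n (tens V W))) (regroup n V W))
     (carrier (tensor [tpow n V, tpow n W])) (pure [tpow n V, tpow n W] [x, y])"

lemma
  fixes V W :: "('k::field, 'a) cmod"
  assumes V: "fd_space V" and W: "fd_space W"
  shows merge_tprod: "tprod (tpow n V) (tpow n W) (tpow n (tens V W)) (merge n V W)"
    and regroup_merge: "\<And>x y. x \<in> carrier (tpow n V) \<Longrightarrow> y \<in> carrier (tpow n W) \<Longrightarrow>
      regroup n V W (merge n V W x y) = pure [tpow n V, tpow n W] [x, y]"
    and unregroup_pure: "\<And>x y. x \<in> carrier (tpow n V) \<Longrightarrow> y \<in> carrier (tpow n W) \<Longrightarrow>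
      inv_into (carrier (tpow n (tens V W))) (regroup n V W) (pure [tpow n V, tpow n W] [x, y]) = merge n V W x y"
    and merge_pure: "\<And>vs ws. vs \<in> vecs n V \<Longrightarrow> ws \<in> vecs n W \<Longrightarrow>
      merge n V W (tpow_pure V vs) (tpow_pure W ws) = tpow_pure (tens V W) (map2 (tens_vec V W) vs ws)"
proof -
  note I = regroup_iso[OF V W, of n]
  show "tprod (tpow n V) (tpow n W) (tpow n (tens V W)) (merge n V W)"
    using tprod_iso[OF tprod_tensor[OF tpow_vs tpow_vs] tpow_vs lin_iso_flip[OF I tpow_vs tensor_vs]]
    by (simp add: merge_def[abs_def])
  have c: "pure [tpow n V, tpow n W] [x, y] \<in> carrier (tensor [tpow n V, tpow n W])"
    if "x \<in> carrier (tpow n V)" "y \<in> carrier (tpow n W)" for x y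
    by (rule pure_closed) (simp add: that)
  show "regroup n V W (merge n V W x y) = pure [tpow n V, tpow n W] [x, y]"
    if "x \<in> carrier (tpow n V)" "y \<in> carrier (tpow n W)" for x y
    using lin_iso_inv_into(2)[OF I c[OF that]] c[OF that] by (simp add: merge_def)
  show "inv_into (carrier (tpow n (tens V W))) (regroup n V W) (pure [tpow n V, tpow n W] [x, y]) = merge n V W x y"
    if "x \<in> carrier (tpow n V)" "y \<in> carrier (tpow n W)" for x y
    using c[OF that] by (simp add: merge_def)
  show "merge n V W (tpow_pure V vs) (tpow_pure W ws) = tpow_pure (tens V W) (map2 (tens_vec V W) vs ws)"
    if vs: "vs \<in> vecs n V" and ws: "ws \<in> vecs n W" for vs ws
    using lin_iso_inv_into_left[OF I tpow_pure_closed[OF map2_tens_tuples[OF V W vs ws]]]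
      regroup_pure[OF V W vs ws] c[OF tpow_pure_closed[OF vs] tpow_pure_closed[OF ws]]
    by (simp add: merge_def)
qed

lemmas merge_bil = tprod_bil[OF merge_tprod]
lemmas merge_closed = tprod_closed[OF merge_tprod]

lemma merge_eqI:
  fixes V W :: "('k::field, 'a) cmod"
  assumes fd: "fd_space V" "fd_space W" and X: "is_vs X"
    and h: "bil (tpow n V) (tpow n W) X h" and k: "bil (tpow n V) (tpow n W) X k"
    and eq: "\<And>vs ws. vs \<in> vecs n V \<Longrightarrow> ws \<in> vecs n W \<Longrightarrow>
      h (tpow_pure V vs) (tpow_pure W ws) = k (tpow_pure V vs) (tpow_pure W ws)"
    and x: "x \<in> carrier (tpow n V)" and y: "y \<in> carrier (tpow n W)"
  shows "h x y = k x y"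
proof (rule tpow_eqI[OF X bilD1[OF h y] bilD1[OF k y] _ x])
  fix vs assume vs: "vs \<in> vecs n V"
  note p = tpow_pure_closed[OF vs]
  show "h (tpow_pure V vs) y = k (tpow_pure V vs) y"
    by (rule tpow_eqI[OF X bilD2[OF h p] bilD2[OF k p] eq[OF vs] y])
qed

lemma tpow_map_tens:
  fixes V W V' W' :: "('k::field, 'a) cmod"
  assumes fd: "fd_space V" "fd_space W" "fd_space V'" "fd_space W'"
    and k: "lin V V' k" and l: "lin W W' l"
    and x: "x \<in> carrier (tpow n V)" and y: "y \<in> carrier (tpow n W)"
  shows "tpow_map n (tens V W) (tens V' W') (tens_map V V' W W' k l) (merge n V W x y) =
    merge n V' W' (tpow_map n V V' k x) (tpow_map n W W' l y)"
proof (rule merge_eqI[OF fd(1,2) tpow_vs _ _ _ x y])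
  note T = tens_fd[OF fd(1,2)] and T' = tens_fd[OF fd(3,4)] and kl = lin_mapsD[OF tens_map_lin[OF fd k l]]
  show "bil (tpow n V) (tpow n W) (tpow n (tens V' W'))
      (\<lambda>x y. tpow_map n (tens V W) (tens V' W') (tens_map V V' W W' k l) (merge n V W x y))"
    by (rule bil_compose[OF merge_bil[OF fd(1,2)] lin_mapsD[OF tpow_map_lin[OF T T' kl]]])
  show "bil (tpow n V) (tpow n W) (tpow n (tens V' W'))
      (\<lambda>x y. merge n V' W' (tpow_map n V V' k x) (tpow_map n W W' l y))"
    by (rule bil_precompose[OF merge_bil[OF fd(3,4)] lin_mapsD[OF tpow_map_lin[OF fd(1,3) k]]
          lin_mapsD[OF tpow_map_lin[OF fd(2,4) l]]])
  fix vs ws assume vs: "vs \<in> vecs n V" and ws: "ws \<in> vecs n W"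
  have "map (tens_map V V' W W' k l) (map2 (tens_vec V W) vs ws) = map2 (tens_vec V' W') (map k vs) (map l ws)"
    using vs ws by (intro nth_equalityI) (simp_all add: tuples_replicate_nth tens_map_vec[OF fd k l])
  then show "tpow_map n (tens V W) (tens V' W') (tens_map V V' W W' k l) (merge n V W (tpow_pure V vs) (tpow_pure W ws)) =
      merge n V' W' (tpow_map n V V' k (tpow_pure V vs)) (tpow_map n W W' l (tpow_pure W ws))"
    by (simp add: merge_pure fd vs ws tpow_map_pure T T' kl k l map2_tens_tuples map_tuples[OF k] map_tuples[OF l]
        del: map_map)
qed

lemma tpow_map_swap:
  fixes V W :: "('k::field, 'a) cmod"
  assumes fd: "fd_space V" "fd_space W"
    and x: "x \<in> carrier (tpow n V)" and y: "y \<in> carrier (tpow n W)"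
  shows "tpow_map n (tens V W) (tens W V) (swap_map V W) (merge n V W x y) = merge n W V y x"
proof (rule merge_eqI[OF fd(1,2) tpow_vs _ _ _ x y])
  note T = tens_fd[OF fd] and T' = tens_fd[OF fd(2,1)] and s = lin_mapsD[OF swap_lin[OF fd]]
  show "bil (tpow n V) (tpow n W) (tpow n (tens W V)) (\<lambda>x y. tpow_map n (tens V W) (tens W V) (swap_map V W) (merge n V W x y))"
    by (rule bil_compose[OF merge_bil[OF fd] lin_mapsD[OF tpow_map_lin[OF T T' s]]])
  show "bil (tpow n V) (tpow n W) (tpow n (tens W V)) (\<lambda>x y. merge n W V y x)"
    by (rule bil_flip[OF merge_bil[OF fd(2,1)]])
  fix vs ws assume vs: "vs \<in> vecs n V" and ws: "ws \<in> vecs n W"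
  have "map (swap_map V W) (map2 (tens_vec V W) vs ws) = map2 (tens_vec W V) ws vs"
    using vs ws by (intro nth_equalityI) (simp_all add: tuples_replicate_nth swap_vec[OF fd])
  then show "tpow_map n (tens V W) (tens W V) (swap_map V W) (merge n V W (tpow_pure V vs) (tpow_pure W ws)) =
      merge n W V (tpow_pure W ws) (tpow_pure V vs)"
    by (simp add: merge_pure fd vs ws tpow_map_pure T T' s map2_tens_tuples del: map_map)
qed

text \<open>Both sides are linear in each of the three arguments, and on pure tensors they agree factor by factor.\<close>

lemma tpow_map_assoc:
  fixes U V W :: "('k::field, 'a) cmod"
  assumes U: "fd_space U" and V: "fd_space V" and W: "fd_space W"
    and x: "x \<in> carrier (tpow n U)" and y: "y \<in> carrier (tpow n V)" and z: "z \<in> carrier (tpow n W)"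
  shows "tpow_map n (tens (tens U V) W) (tens U (tens V W)) (assoc_map U V W) (merge n (tens U V) W (merge n U V x y) z) =
    merge n U (tens V W) x (merge n V W y z)"
proof -
  note UV = tens_fd[OF U V] and VW = tens_fd[OF V W]
  note X = tens_fd[OF UV W] and X' = tens_fd[OF U VW] and a = lin_mapsD[OF assoc_lin[OF U V W]]
  note A = lin_mapsD[OF tpow_map_lin[OF X X' a]]
  let ?l = "\<lambda>x y z. tpow_map n (tens (tens U V) W) (tens U (tens V W)) (assoc_map U V W) (merge n (tens U V) W (merge n U V x y) z)"
  let ?r = "\<lambda>x y z. merge n U (tens V W) x (merge n V W y z)"
  have "?l x y z = ?r x y z"
  proof (rule tpow_eqI[where n = n and V = U, OF tpow_vs _ _ _ x])
    show "lin (tpow n U) (tpow n (tens U (tens V W))) (\<lambda>x. ?l x y z)"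
      by (rule lin_compose[OF lin_compose[OF bilD1[OF merge_bil[OF U V] y] bilD1[OF merge_bil[OF UV W] z]] A])
    show "lin (tpow n U) (tpow n (tens U (tens V W))) (\<lambda>x. ?r x y z)"
      by (rule bilD1[OF merge_bil[OF U VW] merge_closed[OF V W y z]])
    fix us assume us: "us \<in> vecs n U"
    note x = tpow_pure_closed[OF us]
    show "?l (tpow_pure U us) y z = ?r (tpow_pure U us) y z"
    proof (rule merge_eqI[OF V W tpow_vs _ _ _ y z])
      show "bil (tpow n V) (tpow n W) (tpow n (tens U (tens V W))) (\<lambda>y z. ?l (tpow_pure U us) y z)"
        by (rule bil_compose[OF bil_precompose[OF merge_bil[OF UV W] bilD2[OF merge_bil[OF U V] x] lin_id] A])
      show "bil (tpow n V) (tpow n W) (tpow n (tens U (tens V W))) (\<lambda>y z. ?r (tpow_pure U us) y z)"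
        by (rule bil_compose[OF merge_bil[OF V W] bilD2[OF merge_bil[OF U VW] x]])
      fix vs ws assume vs: "vs \<in> vecs n V" and ws: "ws \<in> vecs n W"
      have "map (assoc_map U V W) (map2 (tens_vec (tens U V) W) (map2 (tens_vec U V) us vs) ws) =
          map2 (tens_vec U (tens V W)) us (map2 (tens_vec V W) vs ws)"
        using us vs ws by (intro nth_equalityI) (simp_all add: tuples_replicate_nth assoc_vec[OF U V W])
      then show "?l (tpow_pure U us) (tpow_pure V vs) (tpow_pure W ws) = ?r (tpow_pure U us) (tpow_pure V vs) (tpow_pure W ws)"
        by (simp add: merge_pure U V W UV VW us vs ws tpow_map_pure X X' a map2_tens_tuples del: map_map)
    qed
  qed
  then show ?thesis .
qed

text \<open>The generator \<open>1 \<otimes> \<dots> \<otimes> 1\<close> of the line \<open>k\<^sup>\<otimes>\<^sup>n\<close>, the tensor power of the unit space.\<close>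

definition tpow_one :: "nat \<Rightarrow> ((('a + 'k list) list \<Rightarrow> 'k) \<Rightarrow> 'k::field)" where
  "tpow_one n = tpow_pure (unit_space :: ('k, 'a) cmod) (replicate n (unit_vec (1 :: 'k)))"

lemma unit_ones_tuple: "replicate n (unit_vec (1 :: 'k)) \<in> tuples (replicate n (unit_space :: ('k::field, 'a) cmod))"
  by (simp add: tuples_replicate_nth)

lemma tpow_one_closed: "tpow_one n \<in> carrier (tpow n (unit_space :: ('k::field, 'a) cmod))"
  unfolding tpow_one_def by (rule tpow_pure_closed[OF unit_ones_tuple])

lemma tpow_one_gen: "generates {tpow_one n} (tpow n (unit_space :: ('k::field, 'a) cmod))"
proof -
  let ?e = "unit_vec (1 :: 'k) :: 'a + 'k list"
  have "{ss. length ss = n \<and> set ss \<subseteq> {?e}} = {replicate n ?e}"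
    by (auto intro!: replicate_eqI)
  moreover have "generates (tpow_pure (unit_space :: ('k, 'a) cmod) ` {ss. length ss = n \<and> set ss \<subseteq> {?e}}) (tpow n unit_space)"
    by (rule tpow_generates[OF unit_space_vs unit_space_gen])
  ultimately show ?thesis by (simp add: tpow_one_def)
qed

lemma tpow_pure_unit:
  fixes cs :: "'k::field list"
  shows "tpow_pure (unit_space :: ('k, 'a) cmod) (map unit_vec cs) =
    prod_list cs \<odot>\<^bsub>tpow (length cs) (unit_space :: ('k, 'a) cmod)\<^esub> tpow_one (length cs)"
proof -
  let ?U = "unit_space :: ('k, 'a) cmod" and ?n = "length cs"
  have "map unit_vec cs = map2 (\<lambda>c v. c \<odot>\<^bsub>?U\<^esub> v) cs (replicate ?n (unit_vec (1 :: 'k)))"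
    by (rule nth_equalityI) (simp_all add: unit_vec_eq[symmetric])
  moreover have "map unit_vec cs \<in> vecs ?n ?U" by (simp add: tuples_replicate_nth)
  ultimately show ?thesis
    using mlin_scale[OF tensor_vs pure_mlin unit_ones_tuple refl unit_space_vs, of cs]
    by (simp add: tpow_pure_eq tpow_one_def tpow_pure_eq[OF unit_ones_tuple] tpow_def)
qed

lemma tpow_map_lunit:
  fixes V :: "('k::field, 'a) cmod"
  assumes V: "fd_space V" and y: "y \<in> carrier (tpow n V)"
  shows "tpow_map n (tens unit_space V) V (lunit_map V) (merge n unit_space V (tpow_one n) y) = y"
proof (rule tpow_eqI[OF tpow_vs _ lin_id _ y])
  have U: "fd_space (unit_space :: ('k, 'a) cmod)" by (rule unit_space_fd)
  note T = tens_fd[OF U V] and a = lin_mapsD[OF lunit_lin[OF V]]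
  show "lin (tpow n V) (tpow n V) (\<lambda>y. tpow_map n (tens unit_space V) V (lunit_map V) (merge n unit_space V (tpow_one n) y))"
    by (rule lin_compose[OF bilD2[OF merge_bil[OF U V] tpow_one_closed] lin_mapsD[OF tpow_map_lin[OF T V a]]])
  fix vs assume vs: "vs \<in> vecs n V"
  have "map (lunit_map V) (map2 (tens_vec unit_space V) (replicate n (unit_vec (1 :: 'k))) vs) = vs"
    using vs by (intro nth_equalityI)
      (simp_all add: tuples_replicate_nth lunit_vec[OF V] vs_one_smult[OF fd_space_vs[OF V]])
  then show "tpow_map n (tens unit_space V) V (lunit_map V) (merge n unit_space V (tpow_one n) (tpow_pure V vs)) = tpow_pure V vs"
    by (simp add: tpow_one_def merge_pure U V vs unit_ones_tuple tpow_map_pure T a map2_tens_tuples del: map_map)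
qed

lemma tpow_map_runit:
  fixes V :: "('k::field, 'a) cmod"
  assumes V: "fd_space V" and y: "y \<in> carrier (tpow n V)"
  shows "tpow_map n (tens V unit_space) V (runit_map V) (merge n V unit_space y (tpow_one n)) = y"
proof (rule tpow_eqI[OF tpow_vs _ lin_id _ y])
  have U: "fd_space (unit_space :: ('k, 'a) cmod)" by (rule unit_space_fd)
  note T = tens_fd[OF V U] and a = lin_mapsD[OF runit_lin[OF V]]
  show "lin (tpow n V) (tpow n V) (\<lambda>y. tpow_map n (tens V unit_space) V (runit_map V) (merge n V unit_space y (tpow_one n)))"
    by (rule lin_compose[OF bilD1[OF merge_bil[OF V U] tpow_one_closed] lin_mapsD[OF tpow_map_lin[OF T V a]]])
  fix vs assume vs: "vs \<in> vecs n V"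
  have "map (runit_map V) (map2 (tens_vec V unit_space) vs (replicate n (unit_vec (1 :: 'k)))) = vs"
    using vs by (intro nth_equalityI)
      (simp_all add: tuples_replicate_nth runit_vec[OF V] vs_one_smult[OF fd_space_vs[OF V]])
  then show "tpow_map n (tens V unit_space) V (runit_map V) (merge n V unit_space (tpow_pure V vs) (tpow_one n)) = tpow_pure V vs"
    by (simp add: tpow_one_def merge_pure U V vs unit_ones_tuple tpow_map_pure T a map2_tens_tuples del: map_map)
qed


subsection \<open>The endomorphism of a tensor product\<close>

text \<open>The Leibniz rule. It determines the endomorphism, because the elements \<open>merge n V W x y\<close> generate.\<close>

lemma
  fixes V W :: "('k::field, 'a) cmod"
  assumes V: "fd_space V" and W: "fd_space W"
    and R: "R n \<in> lin_maps (tpow n V) (tpow n V)" and S: "S n \<in> lin_maps (tpow n W) (tpow n W)"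
  shows box_lin: "box_endo (V, R) (W, S) n \<in> lin_maps (tpow n (tens V W)) (tpow n (tens V W))"
    and box_merge: "\<And>x y. x \<in> carrier (tpow n V) \<Longrightarrow> y \<in> carrier (tpow n W) \<Longrightarrow>
      box_endo (V, R) (W, S) n (merge n V W x y) =
        merge n V W (R n x) y \<oplus>\<^bsub>tpow n (tens V W)\<^esub> merge n V W x (S n y)"
proof -
  let ?X = "tpow n (tens V W)" and ?T = "[tpow n V, tpow n W]"
  let ?g = "regroup n V W" and ?i = "inv_into (carrier (tpow n (tens V W))) (regroup n V W)"
  note I = regroup_iso[OF V W, of n]
  note g = lin_isoD(1)[OF I] and i = lin_iso_inverse[OF I tpow_vs]
  have TM: "lin (tensor ?T) (tensor ?T) (tensor_map ?T ?T [h, k]) \<and>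
      (\<forall>x\<in>carrier (tpow n V). \<forall>y\<in>carrier (tpow n W). tensor_map ?T ?T [h, k] (pure ?T [x, y]) = pure ?T [h x, k y])"
    if "lin (tpow n V) (tpow n V) h" "lin (tpow n W) (tpow n W) k" for h k
  proof -
    have fd: "\<And>X. X \<in> set ?T \<Longrightarrow> fd_space X" using tpow_fd[OF V] tpow_fd[OF W] by auto
    have l: "lin (?T ! i) (?T ! i) ([h, k] ! i)" if "i < 2" for i
      using that \<open>lin (tpow n V) (tpow n V) h\<close> \<open>lin (tpow n W) (tpow n W) k\<close> by (auto simp: less_2_cases_iff)
    have len: "length ?T = 2" "length [h, k] = 2" by simp_all
    show ?thesis
      using lin_mapsD[OF tensor_map_lin[OF fd fd len(1) len(1) len(2) l]]
        tensor_map_pure[OF fd fd len(1) len(1) len(2) l] by simp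
  qed
  have idl: "lin (tpow n V) (tpow n V) (id_map (tpow n V))" "lin (tpow n W) (tpow n W) (id_map (tpow n W))"
    by (rule lin_mapsD[OF id_map_lin_maps[OF tpow_vs]])+
  let ?p = "tensor_map ?T ?T [R n, id_map (tpow n W)]" and ?q = "tensor_map ?T ?T [id_map (tpow n V), S n]"
  note p = TM[OF lin_mapsD[OF R] idl(2)] and q = TM[OF idl(1) lin_mapsD[OF S]]
  have box: "box_endo (V, R) (W, S) n = (\<lambda>x\<in>carrier ?X. ?i (?p (?g x) \<oplus>\<^bsub>tensor ?T\<^esub> ?q (?g x)))"
    by (simp add: box_endo_def Let_def)
  show "box_endo (V, R) (W, S) n \<in> lin_maps ?X ?X"
    unfolding box
    by (rule restrict_lin_maps[OF tpow_vs lin_compose[OF lin_plus[OF tensor_vs] i]])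
      (use lin_compose[OF g] p q in blast)+
  fix x y assume x: "x \<in> carrier (tpow n V)" and y: "y \<in> carrier (tpow n W)"
  have Rx: "R n x \<in> carrier (tpow n V)" and Sy: "S n y \<in> carrier (tpow n W)"
    using lin_closed[OF lin_mapsD[OF R] x] lin_closed[OF lin_mapsD[OF S] y] .
  have c: "pure ?T [u, v] \<in> carrier (tensor ?T)" if "u \<in> carrier (tpow n V)" "v \<in> carrier (tpow n W)" for u v
    by (rule pure_closed) (simp add: that)
  have "box_endo (V, R) (W, S) n (merge n V W x y) = ?i (pure ?T [R n x, y] \<oplus>\<^bsub>tensor ?T\<^esub> pure ?T [x, S n y])"
    using p q x y merge_closed[OF V W x y] regroup_merge[OF V W x y]
    by (simp add: box id_map_def del: tensor_simps)
  also have "\<dots> = merge n V W (R n x) y \<oplus>\<^bsub>?X\<^esub> merge n V W x (S n y)"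
    using lin_add[OF i c[OF Rx y] c[OF x Sy]] unregroup_pure[OF V W Rx y] unregroup_pure[OF V W x Sy] by simp
  finally show "box_endo (V, R) (W, S) n (merge n V W x y) = merge n V W (R n x) y \<oplus>\<^bsub>?X\<^esub> merge n V W x (S n y)" .
qed


subsection \<open>The pairing of tensor powers\<close>

lemma mlin_add:
  assumes W: "is_vs W" and "mlin Vs W f" "mlin Vs W g"
  shows "mlin Vs W (\<lambda>vs. f vs \<oplus>\<^bsub>W\<^esub> g vs)"
  using assms(2,3) unfolding mlin_def by (auto intro!: lin_plus[OF W] vs_add[OF W])

lemma mlin_smult:
  assumes W: "is_vs W" and "mlin Vs W f"
  shows "mlin Vs W (\<lambda>vs. c \<odot>\<^bsub>W\<^esub> f vs)"
  using assms(2) unfolding mlin_def by (auto intro!: lin_scale[OF W] vs_smult[OF W])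

text \<open>The pairing is an iterated evaluation. An element \<open>x\<close> of \<open>V\<^sup>\<otimes>\<^sup>n\<close> is evaluated at the form
  \<open>vs \<mapsto> \<Prod> \<langle>as\<^sub>i, vs\<^sub>i\<rangle>\<close>; as a function of \<open>as\<close> the result is again a multilinear form, at which the element
  of \<open>V\<^sup>*\<^sup>\<otimes>\<^sup>n\<close> is evaluated.\<close>

lemma
  fixes V :: "('k::field, 'a) cmod"
  assumes V: "fd_space V"
  shows tpow_pairing_bil: "bil (tpow n (dual V)) (tpow n V) scalars (\<lambda>a x. tpow_pairing n V [a, x])"
    and tpow_pairing_pure: "\<And>as vs. as \<in> vecs n (dual V) \<Longrightarrow> vs \<in> vecs n V \<Longrightarrow>
      tpow_pairing n V [tpow_pure (dual V) as, tpow_pure V vs] = (\<Prod>i<n. pairing V (as ! i) (vs ! i))"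
proof -
  let ?A = "tpow n (dual V)" and ?X = "tpow n V"
  note VV = fd_space_vs[OF V] and DV = fd_space_vs[OF dual_fd[OF V]] and b = pairing_bil[OF V]
  (* F as is the form vs |-> Prod <as_i, vs_i>, and G x the form as |-> x (F as) *)
  define F where "F as = prod_form (replicate n V) (map (pairing V) as)" for as
  have l: "list_all2 (\<lambda>\<phi> V. lin V scalars \<phi>) (map (pairing V) as) (replicate n V)"
    if "as \<in> vecs n (dual V)" for as
    using that bilD2[OF b] by (simp add: list_all2_conv_all_nth tuples_replicate_nth)
  have VV': "\<And>X. X \<in> set (replicate n V) \<Longrightarrow> is_vs X" using VV by simp
  have DV': "\<And>X. X \<in> set (replicate n (dual V)) \<Longrightarrow> is_vs X" using DV by simp
  have F: "F as \<in> multilinear_maps (replicate n V) scalars" if "as \<in> vecs n (dual V)" for as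
    unfolding F_def by (rule prod_form_multilinear[OF VV' l[OF that]])
  have Fv: "tpow_pure V vs (F as) = (\<Prod>i<n. pairing V (as ! i) (vs ! i))"
    if "as \<in> vecs n (dual V)" "vs \<in> vecs n V" for as vs
    using pure_prod_form[OF VV' l[OF that(1)] that(2)] that
    by (simp add: F_def tpow_pure_eq[OF that(2)] eval_prod_nth[of _ n] tuples_replicate_nth)
  have mF: "mlin (replicate n (dual V)) scalars (\<lambda>as. x (F as))" if x: "x \<in> carrier ?X" for x
    using tpow_vs tpow_gen x
  proof (induction rule: generates_induct)
    case zero
    have "mlin (replicate n (dual V)) scalars (\<lambda>as. 0)"
      unfolding mlin_def using lin_const_zero[OF scalars_vs, of "dual V"] by simp
    from mlin_cong[OF DV' this] show ?case by (simp add: tpow_def F)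
  next
    case (base x)
    then obtain vs where x: "x = tpow_pure V vs" and vs: "vs \<in> vecs n V" by blast
    have "mlin (replicate n (dual V)) scalars (eval_prod (map (\<lambda>v a. pairing V a v) vs))"
      by (rule eval_prod_mlin) (use vs bilD1[OF b] in \<open>simp add: list_all2_conv_all_nth tuples_replicate_nth\<close>)
    from mlin_cong[OF DV' this] show ?case
      using vs by (simp add: x Fv eval_prod_nth[of _ n] tuples_replicate_nth)
  next
    case (add x y)
    show ?case
      by (rule mlin_cong[OF DV' mlin_add[OF scalars_vs add(3,4)]]) (simp_all add: tpow_def F)
  next
    case (smult c x)
    show ?case
      by (rule mlin_cong[OF DV' mlin_smult[OF scalars_vs smult(2), of c]]) (simp_all add: tpow_def F)
  qed
  define G where "G x = restrict (\<lambda>as. x (F as)) (vecs n (dual V))"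
    for x :: "(('a + 'k list) list \<Rightarrow> 'k) \<Rightarrow> 'k"
  have G: "G x \<in> multilinear_maps (replicate n (dual V)) scalars" if "x \<in> carrier ?X" for x
    unfolding G_def by (rule restrict_multilinear_maps[OF DV' mF[OF that]])
  have Gp: "tpow_pure (dual V) as (G x) = x (F as)" if "x \<in> carrier ?X" "as \<in> vecs n (dual V)" for x as
    using G[OF that(1)] that(2) by (simp add: tpow_pure_eq pure_def G_def)
  have lX: "lin ?X scalars (\<lambda>x. a (G x))" if a: "a \<in> carrier ?A" for a
    using tpow_vs tpow_gen a
  proof (induction rule: generates_induct)
    case zero
    show ?case
      by (rule lin_cong[OF tpow_vs lin_const_zero[OF scalars_vs]]) (simp add: tpow_def G[unfolded tpow_def])
  next
    case (base a)
    then obtain as where a: "a = tpow_pure (dual V) as" and as: "as \<in> vecs n (dual V)" by blast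
    show ?case
      by (rule lin_cong[OF tpow_vs eval_lin[OF F[OF as], folded tpow_def]]) (simp add: a Gp as)
  next
    case (add a b)
    show ?case
      by (rule lin_cong[OF tpow_vs lin_plus[OF scalars_vs add(3,4)]]) (simp add: tpow_def G[unfolded tpow_def])
  next
    case (smult c a)
    show ?case
      by (rule lin_cong[OF tpow_vs lin_scale[OF scalars_vs smult(2), of c]]) (simp add: tpow_def G[unfolded tpow_def])
  qed
  have bG: "bil ?A ?X scalars (\<lambda>a x. a (G x))"
    by (rule bilI) (simp_all add: lX eval_lin[OF G, folded tpow_def])
  define p where "p = restrict (\<lambda>xs. (xs ! 0) (G (xs ! 1))) (tuples [?A, ?X])"
  let ?P = "\<lambda>p. p \<in> multilinear_maps [?A, ?X] scalars \<and>
     (\<forall>as\<in>vecs n (dual V). \<forall>vs\<in>vecs n V.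
        p [tpow_pure (dual V) as, tpow_pure V vs] = (\<Prod>i<n. pairing V (as ! i) (vs ! i)))"
  have "p \<in> multilinear_maps [?A, ?X] scalars"
    unfolding p_def
    by (rule restrict_multilinear_maps) (use bG in \<open>auto simp: mlin_pair tpow_vs\<close>)
  then have Pp: "?P p"
    by (simp add: p_def tpow_pure_closed Gp Fv)
  have "q = p" if q: "?P q" for q
  proof (rule extensionalityI[of _ "tuples [?A, ?X]"])
    show "q \<in> extensional (tuples [?A, ?X])" "p \<in> extensional (tuples [?A, ?X])"
      using q Pp by (simp_all add: multilinear_maps_iff)
    fix xs assume "xs \<in> tuples [?A, ?X]"
    then obtain a x where xs: "xs = [a, x]" "a \<in> carrier ?A" "x \<in> carrier ?X" by (auto simp: tuples_Cons)
    have "bil ?A ?X scalars (\<lambda>a x. q [a, x])" "bil ?A ?X scalars (\<lambda>a x. p [a, x])"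
      using q Pp by (simp_all add: multilinear_maps_iff mlin_pair)
    from merge_eqI[OF dual_fd[OF V] V scalars_vs this _ xs(2,3)]
    show "q xs = p xs" using q Pp xs(1) by simp
  qed
  then have "\<exists>!p. ?P p" using Pp by blast
  from theI'[OF this] have P: "?P (tpow_pairing n V)" unfolding tpow_pairing_def .
  then show "bil ?A ?X scalars (\<lambda>a x. tpow_pairing n V [a, x])"
    by (simp add: multilinear_maps_iff mlin_pair)
  show "\<And>as vs. as \<in> vecs n (dual V) \<Longrightarrow> vs \<in> vecs n V \<Longrightarrow>
      tpow_pairing n V [tpow_pure (dual V) as, tpow_pure V vs] = (\<Prod>i<n. pairing V (as ! i) (vs ! i))"
    using P by blast
qed

text \<open>The product functionals of \<open>tpow_dual_basis\<close>, formed from pairings with vectors, are pairings with pure tensors.\<close>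

lemma tpow_pairing_perfect:
  fixes V :: "('k::field, 'a) cmod"
  assumes V: "fd_space V"
  shows "perfect (tpow n (dual V)) (tpow n V) (\<lambda>a x. tpow_pairing n V [a, x])"
proof -
  obtain D where D: "dual_pairs V D" using dual_pairs_exist[OF V] ..
  note b = tpow_pairing_bil[OF V, of n]
  have el: "b \<in> carrier V" "\<beta> \<in> carrier (dual V)" if "(b, \<beta>) \<in> set D" for b \<beta>
    using D that by (auto simp: dual_pairs_def)
  have "\<exists>E. dual_basis (tpow n V) E \<and> (\<forall>(x, f)\<in>set E. \<exists>a\<in>carrier (tpow n (dual V)). \<forall>y\<in>carrier (tpow n V). f y = tpow_pairing n V [a, y])"
  proof -
    let ?D = "map (\<lambda>(b, \<beta>). (b, pairing V \<beta>)) D"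
    have "dual_basis V ?D" using D by (simp add: dual_pairs_def)
    then obtain E where E: "dual_basis (tpow n V) E" and E': "\<forall>(t, f)\<in>set E. \<exists>bs \<phi>s. length bs = n \<and> length \<phi>s = n \<and>
      (\<forall>i<n. (bs ! i, \<phi>s ! i) \<in> set ?D) \<and> t = tpow_pure V bs \<and>
      (\<forall>vs\<in>vecs n V. f (tpow_pure V vs) = (\<Prod>i<n. (\<phi>s ! i) (vs ! i)))"
      using tpow_dual_basis[OF fd_space_vs[OF V]] by blast
    have "\<exists>a\<in>carrier (tpow n (dual V)). \<forall>y\<in>carrier (tpow n V). f y = tpow_pairing n V [a, y]" if tf: "(t, f) \<in> set E" for t f
    proof -
      obtain bs \<phi>s where *: "\<forall>i<n. (bs ! i, \<phi>s ! i) \<in> set ?D"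
        "\<forall>vs\<in>vecs n V. f (tpow_pure V vs) = (\<Prod>i<n. (\<phi>s ! i) (vs ! i))"
        using E' tf by blast
      have "\<forall>i<n. \<exists>\<beta>. \<beta> \<in> carrier (dual V) \<and> \<phi>s ! i = pairing V \<beta>"
        using *(1) el by fastforce
      then obtain \<beta> where \<beta>: "\<forall>i<n. \<beta> i \<in> carrier (dual V) \<and> \<phi>s ! i = pairing V (\<beta> i)"
        unfolding choice_iff' by blast
      let ?\<beta>s = "map \<beta> [0..<n]"
      have t: "?\<beta>s \<in> vecs n (dual V)" using \<beta> by (simp add: tuples_replicate_nth)
      note c = tpow_pure_closed[OF t]
      have "f y = tpow_pairing n V [tpow_pure (dual V) ?\<beta>s, y]" if "y \<in> carrier (tpow n V)" for y
        using dual_basis_closed[OF E tf]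
        by (intro tpow_eqI[OF scalars_vs _ bilD2[OF b c] _ that]) (simp_all add: tpow_pairing_pure[OF V t] * \<beta>)
      then show ?thesis using c by blast
    qed
    then show ?thesis using E by blast
  qed
  moreover have "\<exists>E. dual_basis (tpow n (dual V)) E \<and> (\<forall>(a, f)\<in>set E. \<exists>x\<in>carrier (tpow n V). \<forall>b\<in>carrier (tpow n (dual V)). f b = tpow_pairing n V [b, x])"
  proof -
    let ?D = "map (\<lambda>(b, \<beta>). (\<beta>, \<lambda>a. pairing V a b)) D"
    have "dual_basis (dual V) ?D" using D by (simp add: dual_pairs_def)
    then obtain E where E: "dual_basis (tpow n (dual V)) E" and E': "\<forall>(t, f)\<in>set E. \<exists>bs \<phi>s. length bs = n \<and> length \<phi>s = n \<and>
      (\<forall>i<n. (bs ! i, \<phi>s ! i) \<in> set ?D) \<and> t = tpow_pure (dual V) bs \<and>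
      (\<forall>vs\<in>vecs n (dual V). f (tpow_pure (dual V) vs) = (\<Prod>i<n. (\<phi>s ! i) (vs ! i)))"
      using tpow_dual_basis[OF fd_space_vs[OF dual_fd[OF V]]] by blast
    have "\<exists>x\<in>carrier (tpow n V). \<forall>b\<in>carrier (tpow n (dual V)). f b = tpow_pairing n V [b, x]" if tf: "(t, f) \<in> set E" for t f
    proof -
      obtain bs \<phi>s where *: "\<forall>i<n. (bs ! i, \<phi>s ! i) \<in> set ?D"
        "\<forall>vs\<in>vecs n (dual V). f (tpow_pure (dual V) vs) = (\<Prod>i<n. (\<phi>s ! i) (vs ! i))"
        using E' tf by blast
      have "\<forall>i<n. \<exists>v. v \<in> carrier V \<and> \<phi>s ! i = (\<lambda>a. pairing V a v)"
        using *(1) el by fastforce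
      then obtain v where v: "\<forall>i<n. v i \<in> carrier V \<and> \<phi>s ! i = (\<lambda>a. pairing V a (v i))"
        unfolding choice_iff' by blast
      let ?vs = "map v [0..<n]"
      have t: "?vs \<in> vecs n V" using v by (simp add: tuples_replicate_nth)
      note c = tpow_pure_closed[OF t]
      have "f y = tpow_pairing n V [y, tpow_pure V ?vs]" if "y \<in> carrier (tpow n (dual V))" for y
        using dual_basis_closed[OF E tf]
        by (intro tpow_eqI[OF scalars_vs _ bilD1[OF b c] _ that]) (simp_all add: tpow_pairing_pure[OF V _ t] * v)
      then show ?thesis using c by blast
    qed
    then show ?thesis using E by blast
  qed
  ultimately show ?thesis
    using b by (simp add: perfect_def tpow_vs)
qed

lemma
  fixes V :: "('k::field, 'a) cmod"
  assumes V: "fd_space V" and R: "R n \<in> lin_maps (tpow n V) (tpow n V)"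
  shows transpose_lin: "transpose_endo V R n \<in> lin_maps (tpow n (dual V)) (tpow n (dual V))"
    and transpose_pairing: "\<And>a x. a \<in> carrier (tpow n (dual V)) \<Longrightarrow> x \<in> carrier (tpow n V) \<Longrightarrow>
      tpow_pairing n V [transpose_endo V R n a, x] = tpow_pairing n V [a, R n x]"
  using perfect_transpose[OF tpow_pairing_perfect[OF V] tpow_pairing_perfect[OF V] lin_mapsD[OF R]]
  unfolding transpose_endo_def by blast+


section \<open>Objects and arrows\<close>

type_synonym ('k, 'a) cob = "('k, 'a + 'k list) eca_ob"

lemma eca_obsD:
  assumes "(V, R) \<in> eca_obs"
  shows "fd_space V" "R n \<in> lin_maps (tpow n V) (tpow n V)"
    "R 0 = zero_map (tpow 0 V) (tpow 0 V)" "R 1 = zero_map (tpow 1 V) (tpow 1 V)"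
  using assms by (simp_all add: eca_obs_def)

lemma eca_obsI:
  assumes "fd_space V" "\<And>n. R n \<in> lin_maps (tpow n V) (tpow n V)"
    and zero: "\<And>n. n = 0 \<or> n = 1 \<Longrightarrow> generates (G n) (tpow n V)"
    "\<And>n x. n = 0 \<or> n = 1 \<Longrightarrow> x \<in> G n \<Longrightarrow> R n x = \<zero>\<^bsub>tpow n V\<^esub>"
  shows "(V, R) \<in> eca_obs"
proof -
  have "R n = zero_map (tpow n V) (tpow n V)" if n: "n = 0 \<or> n = 1" for n
    by (rule lin_maps_eq_on_generators[OF tpow_vs tpow_vs zero(1)[OF n] assms(2) zero_map_lin_maps[OF tpow_vs tpow_vs]])
      (use zero[OF n] in \<open>auto simp: zero_map_def generates_def\<close>)
  then show ?thesis using assms(1,2) by (simp add: eca_obs_def)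
qed

lemma eca_obs_zero: "(V, R) \<in> eca_obs \<Longrightarrow> n = 0 \<or> n = 1 \<Longrightarrow> x \<in> carrier (tpow n V) \<Longrightarrow> R n x = \<zero>\<^bsub>tpow n V\<^esub>"
  using eca_obsD(3,4)[of V R] by (auto simp: zero_map_def)

lemma merge_zero:
  fixes V W :: "('k::field, 'a) cmod"
  assumes "fd_space V" "fd_space W"
  shows "y \<in> carrier (tpow n W) \<Longrightarrow> merge n V W \<zero>\<^bsub>tpow n V\<^esub> y = \<zero>\<^bsub>tpow n (tens V W)\<^esub>"
    and "x \<in> carrier (tpow n V) \<Longrightarrow> merge n V W x \<zero>\<^bsub>tpow n W\<^esub> = \<zero>\<^bsub>tpow n (tens V W)\<^esub>"
  using lin_zero[OF bilD1[OF merge_bil[OF assms]] tpow_vs tpow_vs]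
    lin_zero[OF bilD2[OF merge_bil[OF assms]] tpow_vs tpow_vs] by blast+

lemma
  fixes V W :: "('k::field, 'a) cmod"
  assumes A: "(V, R) \<in> eca_obs" and B: "(W, S) \<in> eca_obs"
  shows box_lin_ob: "box_endo (V, R) (W, S) n \<in> lin_maps (tpow n (tens V W)) (tpow n (tens V W))"
    and box_merge_ob: "\<And>x y. x \<in> carrier (tpow n V) \<Longrightarrow> y \<in> carrier (tpow n W) \<Longrightarrow>
      box_endo (V, R) (W, S) n (merge n V W x y) =
        merge n V W (R n x) y \<oplus>\<^bsub>tpow n (tens V W)\<^esub> merge n V W x (S n y)"
  using box_lin[where n = n, of V W R S] box_merge[where n = n, of V W R S] eca_obsD(1,2)[OF A] eca_obsD(1,2)[OF B]
  by blast+

lemma tensor_ob_eca: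
  fixes A B :: "('k::field, 'a) cob"
  assumes "A \<in> eca_obs" "B \<in> eca_obs"
  shows "eca_tensor_ob A B \<in> eca_obs"
proof -
  obtain V R W S where AB: "A = (V, R)" "B = (W, S)" by fastforce
  note A = assms(1)[unfolded AB] and B = assms(2)[unfolded AB]
  note V = eca_obsD(1)[OF A] and W = eca_obsD(1)[OF B]
  note R = eca_obsD(2)[OF A] and S = eca_obsD(2)[OF B]
  have "(tens V W, box_endo (V, R) (W, S)) \<in> eca_obs"
  proof (rule eca_obsI[where G = "\<lambda>n. (\<lambda>(x, y). merge n V W x y) ` (carrier (tpow n V) \<times> carrier (tpow n W))"])
    fix n :: nat and t
    assume n: "n = 0 \<or> n = 1" and t: "t \<in> (\<lambda>(x, y). merge n V W x y) ` (carrier (tpow n V) \<times> carrier (tpow n W))"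
    then obtain x y where "t = merge n V W x y" "x \<in> carrier (tpow n V)" "y \<in> carrier (tpow n W)" by auto
    then show "box_endo (V, R) (W, S) n t = \<zero>\<^bsub>tpow n (tens V W)\<^esub>"
      by (simp add: box_merge_ob[OF A B] eca_obs_zero[OF A n] eca_obs_zero[OF B n] merge_zero[OF V W]
          vs_lzero[OF tpow_vs] vs_zero[OF tpow_vs] del: tensor_simps)
  qed (rule tens_fd[OF V W] box_lin_ob[OF A B] tprod_gen[OF merge_tprod[OF V W]])+
  then show ?thesis by (simp add: AB eca_tensor_ob_def)
qed

lemma unit_ob_eca: "(eca_unit :: ('k::field, 'a) cob) \<in> eca_obs"
  unfolding eca_unit_def
  by (rule eca_obsI[OF unit_space_fd zero_map_lin_maps[OF tpow_vs tpow_vs] generates_carrier])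
    (simp add: zero_map_def)

lemma eca_ars_iff:
  "((V, R), l, (W, S)) \<in> eca_ars \<longleftrightarrow> (V, R) \<in> eca_obs \<and> (W, S) \<in> eca_obs \<and> l \<in> lin_maps V W \<and>
     (\<forall>n. \<forall>x\<in>carrier (tpow n V). tpow_map n V W l (R n x) = S n (tpow_map n V W l x))"
  by (simp add: eca_ars_def)

text \<open>Commutation with the endomorphisms is a linear condition on \<open>x\<close>, so it suffices to check it on generators; for a
  tensor product these are the elements \<open>merge n V W x y\<close>, on which the endomorphism is known.\<close>

lemma eca_arsI:
  assumes A: "(V, R) \<in> eca_obs" and B: "(W, S) \<in> eca_obs" and l: "l \<in> lin_maps V W"
    and G: "\<And>n. generates (G n) (tpow n V)"
    and eq: "\<And>n x. x \<in> G n \<Longrightarrow> tpow_map n V W l (R n x) = S n (tpow_map n V W l x)"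
  shows "((V, R), l, (W, S)) \<in> eca_ars"
  unfolding eca_ars_iff
proof (intro conjI allI ballI A B l)
  fix n x assume x: "x \<in> carrier (tpow n V)"
  note L = lin_mapsD[OF tpow_map_lin[OF eca_obsD(1)[OF A] eca_obsD(1)[OF B] lin_mapsD[OF l]], of n]
  note R = lin_mapsD[OF eca_obsD(2)[OF A], of n] and S = lin_mapsD[OF eca_obsD(2)[OF B], of n]
  show "tpow_map n V W l (R n x) = S n (tpow_map n V W l x)"
    by (rule lin_eq_on_generators[OF tpow_vs tpow_vs G lin_compose[OF R L] lin_compose[OF L S] eq x])
qed

lemma eca_id_ar:
  assumes "A \<in> eca_obs"
  shows "(A, id_map (fst A), A) \<in> eca_ars"
proof -
  obtain V R where A: "A = (V, R)" by fastforce
  note V = eca_obsD(1)[OF assms[unfolded A]] and R = eca_obsD(2)[OF assms[unfolded A]]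
  have "tpow_map n V V (id_map V) x = x" if "x \<in> carrier (tpow n V)" for n x
    by (rule tpow_map_ident[OF V lin_mapsD[OF id_map_lin_maps[OF fd_space_vs[OF V]]] _ that]) (simp add: id_map_def)
  then have "((V, R), id_map V, (V, R)) \<in> eca_ars"
    using assms id_map_lin_maps[OF fd_space_vs[OF V]] lin_closed[OF lin_mapsD[OF R]]
    by (simp add: A eca_ars_iff)
  then show ?thesis by (simp add: A)
qed

lemma eca_comp_ar:
  assumes f: "(A, l, B) \<in> eca_ars" and g: "(B, k, D) \<in> eca_ars"
  shows "(A, compose (carrier (fst A)) k l, D) \<in> eca_ars"
proof -
  obtain U Q V R W S where A: "A = (U, Q)" "B = (V, R)" "D = (W, S)" by (metis surj_pair)
  note f = f[unfolded A eca_ars_iff] and g = g[unfolded A eca_ars_iff]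
  have U: "fd_space U" and V: "fd_space V" and W: "fd_space W" using f g eca_obsD(1) by blast+
  have l: "lin U V l" and k: "lin V W k" using f g lin_mapsD by blast+
  let ?m = "compose (carrier U) k l"
  have m: "?m \<in> lin_maps U W" by (rule compose_lin_maps[OF fd_space_vs[OF U] l k])
  have eq: "tpow_map n U W ?m x = tpow_map n V W k (tpow_map n U V l x)" if "x \<in> carrier (tpow n U)" for n x
    by (rule tpow_map_comp[OF U V W l k lin_mapsD[OF m] _ that]) (simp add: compose_def)
  have Q: "lin (tpow n U) (tpow n U) (Q n)" for n using f eca_obsD(2) lin_mapsD by blast
  have "tpow_map n U W ?m (Q n x) = S n (tpow_map n U W ?m x)" if x: "x \<in> carrier (tpow n U)" for n x
    using x f g lin_closed[OF lin_mapsD[OF tpow_map_lin[OF U V l]] x] by (simp add: eq lin_closed[OF Q])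
  then have "((U, Q), ?m, (W, S)) \<in> eca_ars" using f g m by (simp add: eca_ars_iff)
  then show ?thesis by (simp add: A)
qed

text \<open>If \<open>l\<close> is bijective, the map it induces on a tensor power is inverted by the one induced by the inverse of \<open>l\<close>.\<close>

lemma eca_inverse_ar:
  assumes f: "(A, l, B) \<in> eca_ars" and iso: "lin_iso (fst A) (fst B) l"
  shows "(B, restrict (inv_into (carrier (fst A)) l) (carrier (fst B)), A) \<in> eca_ars"
proof -
  obtain V R W S where A: "A = (V, R)" "B = (W, S)" by fastforce
  note f = f[unfolded A eca_ars_iff] and iso = iso[unfolded A fst_conv]
  have V: "fd_space V" and W: "fd_space W" using f eca_obsD(1) by blast+
  note VV = fd_space_vs[OF V] and WW = fd_space_vs[OF W]
  have l: "lin V W l" using f lin_mapsD by blast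
  let ?g = "restrict (inv_into (carrier V) l) (carrier W)"
  have gm: "?g \<in> lin_maps W V" using lin_iso_flip[OF iso VV WW] by (simp add: lin_iso_def)
  note g = lin_mapsD[OF gm]
  note L = lin_mapsD[OF tpow_map_lin[OF V W l]] and G = lin_mapsD[OF tpow_map_lin[OF W V g]]
  have R: "lin (tpow n V) (tpow n V) (R n)" and S: "lin (tpow n W) (tpow n W) (S n)" for n
    using f eca_obsD(2) lin_mapsD by blast+
  have GL: "tpow_map n W V ?g (tpow_map n V W l x) = x" if x: "x \<in> carrier (tpow n V)" for n x
  proof -
    have "tpow_map n V V (\<lambda>x. x) x = tpow_map n W V ?g (tpow_map n V W l x)"
      by (rule tpow_map_comp[OF V W V l g lin_id _ x])
        (simp add: lin_iso_inv_into_left[OF iso] lin_closed[OF l])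
    then show ?thesis using tpow_map_ident[OF V lin_id _ x] by simp
  qed
  have LG: "tpow_map n V W l (tpow_map n W V ?g x) = x" if x: "x \<in> carrier (tpow n W)" for n x
  proof -
    have "tpow_map n W W (\<lambda>x. x) x = tpow_map n V W l (tpow_map n W V ?g x)"
      by (rule tpow_map_comp[OF W V W g l lin_id _ x]) (simp add: lin_iso_inv_into(2)[OF iso])
    then show ?thesis using tpow_map_ident[OF W lin_id _ x] by simp
  qed
  have "tpow_map n W V ?g (S n x) = R n (tpow_map n W V ?g x)" if x: "x \<in> carrier (tpow n W)" for n x
  proof -
    have gx: "tpow_map n W V ?g x \<in> carrier (tpow n V)" by (rule lin_closed[OF G x])
    have "tpow_map n V W l (R n (tpow_map n W V ?g x)) = S n x"
      using f gx LG[OF x] by simp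
    then show ?thesis using GL[OF lin_closed[OF R gx]] by simp
  qed
  then have "((W, S), ?g, (V, R)) \<in> eca_ars" using f gm by (simp add: eca_ars_iff)
  then show ?thesis by (simp add: A)
qed

lemma eca_tensor_ar_mem:
  fixes A B A' B' :: "('k::field, 'a) cob"
  assumes f: "(A, k, A') \<in> eca_ars" and g: "(B, l, B') \<in> eca_ars"
  shows "(eca_tensor_ob A B, tens_map (fst A) (fst A') (fst B) (fst B') k l, eca_tensor_ob A' B') \<in> eca_ars"
proof -
  obtain V R V' R' W S W' S' where A: "A = (V, R)" "A' = (V', R')" "B = (W, S)" "B' = (W', S')" by (metis surj_pair)
  note f = f[unfolded A eca_ars_iff] and g = g[unfolded A eca_ars_iff]
  have obs: "(V, R) \<in> eca_obs" "(W, S) \<in> eca_obs" "(V', R') \<in> eca_obs" "(W', S') \<in> eca_obs" using f g by auto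
  note V = eca_obsD(1)[OF obs(1)] and W = eca_obsD(1)[OF obs(2)] and V' = eca_obsD(1)[OF obs(3)] and W' = eca_obsD(1)[OF obs(4)]
  note R = eca_obsD(2)[OF obs(1)] and S = eca_obsD(2)[OF obs(2)] and R' = eca_obsD(2)[OF obs(3)] and S' = eca_obsD(2)[OF obs(4)]
  have k: "lin V V' k" and l: "lin W W' l" using f g lin_mapsD by blast+
  let ?m = "tens_map V V' W W' k l"
  have m: "?m \<in> lin_maps (tens V W) (tens V' W')" by (rule tens_map_lin[OF V W V' W' k l])
  note M = tpow_map_tens[OF V W V' W' k l] and L = lin_mapsD[OF tpow_map_lin[OF tens_fd[OF V W] tens_fd[OF V' W'] lin_mapsD[OF m]]]
  have "((tens V W, box_endo (V, R) (W, S)), ?m, (tens V' W', box_endo (V', R') (W', S'))) \<in> eca_ars"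
  proof (rule eca_arsI[OF _ _ m tprod_gen[OF merge_tprod[OF V W]]])
    show "(tens V W, box_endo (V, R) (W, S)) \<in> eca_obs" "(tens V' W', box_endo (V', R') (W', S')) \<in> eca_obs"
      using tensor_ob_eca[OF obs(1,2)] tensor_ob_eca[OF obs(3,4)] by (simp_all add: eca_tensor_ob_def)
    fix n t assume "t \<in> (\<lambda>(x, y). merge n V W x y) ` (carrier (tpow n V) \<times> carrier (tpow n W))"
    then obtain x y where t: "t = merge n V W x y" and x: "x \<in> carrier (tpow n V)" and y: "y \<in> carrier (tpow n W)" by auto
    note Rx = lin_closed[OF lin_mapsD[OF R] x] and Sy = lin_closed[OF lin_mapsD[OF S] y]
    note kx = lin_closed[OF lin_mapsD[OF tpow_map_lin[OF V V' k]] x] and ly = lin_closed[OF lin_mapsD[OF tpow_map_lin[OF W W' l]] y]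
    show "tpow_map n (tens V W) (tens V' W') ?m (box_endo (V, R) (W, S) n t) =
        box_endo (V', R') (W', S') n (tpow_map n (tens V W) (tens V' W') ?m t)"
      using f g x y
      by (simp add: t box_merge_ob[OF obs(1,2) x y] lin_add[OF L merge_closed[OF V W Rx y] merge_closed[OF V W x Sy]]
          M[OF x y] M[OF Rx y] M[OF x Sy] box_merge_ob[OF obs(3,4) kx ly] del: tensor_simps)
  qed
  then show ?thesis by (simp add: A eca_tensor_ob_def)
qed

text \<open>Applying the Leibniz rule twice turns both sides into the sum of the three terms in which one of the endomorphisms acts
  on its own factor.\<close>

lemma assoc_ar:
  fixes A B D :: "('k::field, 'a) cob"
  assumes "A \<in> eca_obs" "B \<in> eca_obs" "D \<in> eca_obs"
  shows "(eca_tensor_ob (eca_tensor_ob A B) D, assoc_map (fst A) (fst B) (fst D), eca_tensor_ob A (eca_tensor_ob B D)) \<in> eca_ars"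
proof -
  obtain U Q V R W S where A: "A = (U, Q)" "B = (V, R)" "D = (W, S)" by (metis surj_pair)
  note o1 = assms(1)[unfolded A] and o2 = assms(2)[unfolded A] and o3 = assms(3)[unfolded A]
  note U = eca_obsD(1)[OF o1] and V = eca_obsD(1)[OF o2] and W = eca_obsD(1)[OF o3]
  note Q = eca_obsD(2)[OF o1] and R = eca_obsD(2)[OF o2] and S = eca_obsD(2)[OF o3]
  note UV = tens_fd[OF U V] and VW = tens_fd[OF V W]
  note a = assoc_lin[OF U V W]
  note M = tpow_map_assoc[OF U V W] and L = lin_mapsD[OF tpow_map_lin[OF tens_fd[OF UV W] tens_fd[OF U VW] lin_mapsD[OF a]]]
  let ?QR = "box_endo (U, Q) (V, R)" and ?RS = "box_endo (V, R) (W, S)"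
  have obs: "(tens U V, ?QR) \<in> eca_obs" "(tens V W, ?RS) \<in> eca_obs"
    using tensor_ob_eca[OF o1 o2] tensor_ob_eca[OF o2 o3] by (simp_all add: eca_tensor_ob_def)
  have "((tens (tens U V) W, box_endo (tens U V, ?QR) (W, S)), assoc_map U V W, (tens U (tens V W), box_endo (U, Q) (tens V W, ?RS))) \<in> eca_ars"
  proof (rule eca_arsI[OF _ _ a tprod_generates[OF merge_tprod[OF UV W] tpow_vs tpow_vs tprod_gen[OF merge_tprod[OF U V]] generates_carrier]])
    show "(tens (tens U V) W, box_endo (tens U V, ?QR) (W, S)) \<in> eca_obs" "(tens U (tens V W), box_endo (U, Q) (tens V W, ?RS)) \<in> eca_obs"
      using tensor_ob_eca[OF obs(1) o3] tensor_ob_eca[OF o1 obs(2)] by (simp_all add: eca_tensor_ob_def)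
    fix n t assume "t \<in> (\<lambda>(s, z). merge n (tens U V) W s z) `
      (((\<lambda>(x, y). merge n U V x y) ` (carrier (tpow n U) \<times> carrier (tpow n V))) \<times> carrier (tpow n W))"
    then obtain x y z where t: "t = merge n (tens U V) W (merge n U V x y) z"
      and x: "x \<in> carrier (tpow n U)" and y: "y \<in> carrier (tpow n V)" and z: "z \<in> carrier (tpow n W)" by auto
    note Qx = lin_closed[OF lin_mapsD[OF Q] x] and Ry = lin_closed[OF lin_mapsD[OF R] y] and Sz = lin_closed[OF lin_mapsD[OF S] z]
    note c = merge_closed[OF U V] merge_closed[OF V W] merge_closed[OF UV W] merge_closed[OF U VW]
    have "box_endo (tens U V, ?QR) (W, S) n t =
        (merge n (tens U V) W (merge n U V (Q n x) y) z \<oplus>\<^bsub>tpow n (tens (tens U V) W)\<^esub>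
         merge n (tens U V) W (merge n U V x (R n y)) z) \<oplus>\<^bsub>tpow n (tens (tens U V) W)\<^esub>
         merge n (tens U V) W (merge n U V x y) (S n z)"
      using x y z Qx Ry
      by (simp add: t box_merge_ob[OF obs(1) o3] box_merge_ob[OF o1 o2] c
          lin_add[OF bilD1[OF merge_bil[OF UV W] z]] del: tensor_simps)
    then have "tpow_map n (tens (tens U V) W) (tens U (tens V W)) (assoc_map U V W) (box_endo (tens U V, ?QR) (W, S) n t) =
        (merge n U (tens V W) (Q n x) (merge n V W y z) \<oplus>\<^bsub>tpow n (tens U (tens V W))\<^esub>
         merge n U (tens V W) x (merge n V W (R n y) z)) \<oplus>\<^bsub>tpow n (tens U (tens V W))\<^esub>
         merge n U (tens V W) x (merge n V W y (S n z))"
      using x y z Qx Ry Sz by (simp add: lin_add[OF L] M c vs_add[OF tpow_vs] del: tensor_simps)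
    also have "\<dots> = box_endo (U, Q) (tens V W, ?RS) n (merge n U (tens V W) x (merge n V W y z))"
      using x y z Qx Ry Sz
      by (simp add: box_merge_ob[OF o1 obs(2)] box_merge_ob[OF o2 o3] c
          lin_add[OF bilD2[OF merge_bil[OF U VW] x]] vs_assoc[OF tpow_vs] del: tensor_simps)
    also have "merge n U (tens V W) x (merge n V W y z) =
        tpow_map n (tens (tens U V) W) (tens U (tens V W)) (assoc_map U V W) t"
      by (simp add: t M x y z)
    finally show "tpow_map n (tens (tens U V) W) (tens U (tens V W)) (assoc_map U V W) (box_endo (tens U V, ?QR) (W, S) n t) =
        box_endo (U, Q) (tens V W, ?RS) n (tpow_map n (tens (tens U V) W) (tens U (tens V W)) (assoc_map U V W) t)" .
  qed
  then show ?thesis by (simp add: A eca_tensor_ob_def)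
qed

lemma swap_ar:
  fixes A B :: "('k::field, 'a) cob"
  assumes "A \<in> eca_obs" "B \<in> eca_obs"
  shows "(eca_tensor_ob A B, swap_map (fst A) (fst B), eca_tensor_ob B A) \<in> eca_ars"
proof -
  obtain V R W S where A: "A = (V, R)" "B = (W, S)" by (metis surj_pair)
  note o1 = assms(1)[unfolded A] and o2 = assms(2)[unfolded A]
  note V = eca_obsD(1)[OF o1] and W = eca_obsD(1)[OF o2] and R = eca_obsD(2)[OF o1] and S = eca_obsD(2)[OF o2]
  note m = swap_lin[OF V W]
  note M = tpow_map_swap[OF V W] and L = lin_mapsD[OF tpow_map_lin[OF tens_fd[OF V W] tens_fd[OF W V] lin_mapsD[OF m]]]
  have "((tens V W, box_endo (V, R) (W, S)), swap_map V W, (tens W V, box_endo (W, S) (V, R))) \<in> eca_ars"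
  proof (rule eca_arsI[OF _ _ m tprod_gen[OF merge_tprod[OF V W]]])
    show "(tens V W, box_endo (V, R) (W, S)) \<in> eca_obs" "(tens W V, box_endo (W, S) (V, R)) \<in> eca_obs"
      using tensor_ob_eca[OF o1 o2] tensor_ob_eca[OF o2 o1] by (simp_all add: eca_tensor_ob_def)
    fix n t assume "t \<in> (\<lambda>(x, y). merge n V W x y) ` (carrier (tpow n V) \<times> carrier (tpow n W))"
    then obtain x y where t: "t = merge n V W x y" and x: "x \<in> carrier (tpow n V)" and y: "y \<in> carrier (tpow n W)" by auto
    note Rx = lin_closed[OF lin_mapsD[OF R] x] and Sy = lin_closed[OF lin_mapsD[OF S] y]
    show "tpow_map n (tens V W) (tens W V) (swap_map V W) (box_endo (V, R) (W, S) n t) =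
        box_endo (W, S) (V, R) n (tpow_map n (tens V W) (tens W V) (swap_map V W) t)"
      by (simp add: t box_merge_ob[OF o1 o2 x y] lin_add[OF L merge_closed[OF V W Rx y] merge_closed[OF V W x Sy]]
          M[OF x y] M[OF Rx y] M[OF x Sy] box_merge_ob[OF o2 o1 y x]
          vs_comm[OF tpow_vs merge_closed[OF W V y Rx] merge_closed[OF W V Sy x]] del: tensor_simps)
  qed
  then show ?thesis by (simp add: A eca_tensor_ob_def)
qed

lemma
  fixes A :: "('k::field, 'a) cob"
  assumes "A \<in> eca_obs"
  shows lunit_ar: "(eca_tensor_ob eca_unit A, lunit_map (fst A), A) \<in> eca_ars"
    and runit_ar: "(eca_tensor_ob A eca_unit, runit_map (fst A), A) \<in> eca_ars"
proof -
  obtain V R where A: "A = (V, R)" by (metis surj_pair)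
  note o1 = assms(1)[unfolded A]
  note V = eca_obsD(1)[OF o1] and R = eca_obsD(2)[OF o1]
  let ?U = "unit_space :: ('k, 'a) cmod" and ?Z = "\<lambda>n. zero_map (tpow n (unit_space :: ('k, 'a) cmod)) (tpow n (unit_space :: ('k, 'a) cmod))"
  have U: "fd_space ?U" by (rule unit_space_fd)
  have o2: "(?U, ?Z) \<in> eca_obs" using unit_ob_eca[where 'a = 'a and 'k = 'k] by (simp add: eca_unit_def)
  note e = tpow_one_closed[where 'a = 'a and 'k = 'k]
  have Ze: "?Z n (tpow_one n) = \<zero>\<^bsub>tpow n ?U\<^esub>" for n by (simp add: zero_map_def e)
  have "((tens ?U V, box_endo (?U, ?Z) (V, R)), lunit_map V, (V, R)) \<in> eca_ars"
  proof (rule eca_arsI[OF _ o1 lunit_lin[OF V] tprod_generates[OF merge_tprod[OF U V] tpow_vs tpow_vs tpow_one_gen generates_carrier]])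
    show "(tens ?U V, box_endo (?U, ?Z) (V, R)) \<in> eca_obs"
      using tensor_ob_eca[OF o2 o1] by (simp add: eca_tensor_ob_def)
    fix n t assume "t \<in> (\<lambda>(x, y). merge n ?U V x y) ` ({tpow_one n} \<times> carrier (tpow n V))"
    then obtain y where t: "t = merge n ?U V (tpow_one n) y" and y: "y \<in> carrier (tpow n V)" by auto
    note Ry = lin_closed[OF lin_mapsD[OF R] y]
    show "tpow_map n (tens ?U V) V (lunit_map V) (box_endo (?U, ?Z) (V, R) n t) =
        R n (tpow_map n (tens ?U V) V (lunit_map V) t)"
      using box_merge_ob[OF o2 o1 e y] Ze[of n] merge_zero(1)[OF U V y] y Ry e
      by (simp add: t tpow_map_lunit[OF V] vs_lzero[OF tpow_vs] merge_closed[OF U V] del: tensor_simps)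
  qed
  then show "(eca_tensor_ob eca_unit A, lunit_map (fst A), A) \<in> eca_ars"
    by (simp add: A eca_tensor_ob_def eca_unit_def)
  have "((tens V ?U, box_endo (V, R) (?U, ?Z)), runit_map V, (V, R)) \<in> eca_ars"
  proof (rule eca_arsI[OF _ o1 runit_lin[OF V] tprod_generates[OF merge_tprod[OF V U] tpow_vs tpow_vs generates_carrier tpow_one_gen]])
    show "(tens V ?U, box_endo (V, R) (?U, ?Z)) \<in> eca_obs"
      using tensor_ob_eca[OF o1 o2] by (simp add: eca_tensor_ob_def)
    fix n t assume "t \<in> (\<lambda>(x, y). merge n V ?U x y) ` (carrier (tpow n V) \<times> {tpow_one n})"
    then obtain y where t: "t = merge n V ?U y (tpow_one n)" and y: "y \<in> carrier (tpow n V)" by auto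
    note Ry = lin_closed[OF lin_mapsD[OF R] y]
    show "tpow_map n (tens V ?U) V (runit_map V) (box_endo (V, R) (?U, ?Z) n t) =
        R n (tpow_map n (tens V ?U) V (runit_map V) t)"
      using box_merge_ob[OF o1 o2 y e] Ze[of n] merge_zero(2)[OF V U y] y Ry e
      by (simp add: t tpow_map_runit[OF V] vs_rzero[OF tpow_vs] merge_closed[OF V U] del: tensor_simps)
  qed
  then show "(eca_tensor_ob A eca_unit, runit_map (fst A), A) \<in> eca_ars"
    by (simp add: A eca_tensor_ob_def eca_unit_def)
qed


section \<open>Duality\<close>

definition dagger_endo :: "('k::field, 'a) cmod \<Rightarrow> ('k, 'a + 'k list) graded_endo \<Rightarrow> ('k, 'a + 'k list) graded_endo" where
  "dagger_endo V R = (\<lambda>n. \<lambda>a\<in>carrier (tpow n (dual V)). \<ominus>\<^bsub>tpow n (dual V)\<^esub> transpose_endo V R n a)"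

lemma dagger_ob_pair: "dagger_ob (V, R) = (dual V, dagger_endo V R)"
  by (simp add: dagger_ob_def dagger_endo_def)

lemma
  fixes V :: "('k::field, 'a) cmod"
  assumes A: "(V, R) \<in> eca_obs"
  shows dagger_lin: "dagger_endo V R n \<in> lin_maps (tpow n (dual V)) (tpow n (dual V))"
    and dagger_pairing: "\<And>a x. a \<in> carrier (tpow n (dual V)) \<Longrightarrow> x \<in> carrier (tpow n V) \<Longrightarrow>
      tpow_pairing n V [dagger_endo V R n a, x] = - tpow_pairing n V [a, R n x]"
proof -
  note V = eca_obsD(1)[OF A] and R = eca_obsD(2)[OF A, of n]
  note t = transpose_lin[where n = n and R = R, OF V R] and b = tpow_pairing_bil[OF V, of n]
  show "dagger_endo V R n \<in> lin_maps (tpow n (dual V)) (tpow n (dual V))"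
    unfolding dagger_endo_def
    by (rule restrict_lin_maps[OF tpow_vs lin_neg[OF tpow_vs tpow_vs lin_mapsD[OF t]]])
  fix a x assume a: "a \<in> carrier (tpow n (dual V))" and x: "x \<in> carrier (tpow n V)"
  note ta = lin_closed[OF lin_mapsD[OF t] a]
  have "tpow_pairing n V [\<ominus>\<^bsub>tpow n (dual V)\<^esub> transpose_endo V R n a, x] = - tpow_pairing n V [transpose_endo V R n a, x]"
    using lin_smult[OF bilD1[OF b x] ta, of "-1"] by (simp add: vs_uminus_eq[OF tpow_vs ta])
  then show "tpow_pairing n V [dagger_endo V R n a, x] = - tpow_pairing n V [a, R n x]"
    by (simp add: dagger_endo_def a transpose_pairing[where n = n and R = R, OF V R a x])
qed

lemma dagger_ob_eca:
  fixes A :: "('k::field, 'a) cob"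
  assumes "A \<in> eca_obs"
  shows "dagger_ob A \<in> eca_obs"
proof -
  obtain V R where A: "A = (V, R)" by (metis surj_pair)
  note o1 = assms[unfolded A]
  note V = eca_obsD(1)[OF o1]
  have "(dual V, dagger_endo V R) \<in> eca_obs"
  proof (rule eca_obsI[OF dual_fd[OF V] dagger_lin[OF o1] generates_carrier])
    fix n :: nat and a assume n: "n = 0 \<or> n = 1" and a: "a \<in> carrier (tpow n (dual V))"
    note b = tpow_pairing_bil[OF V, of n]
    show "dagger_endo V R n a = \<zero>\<^bsub>tpow n (dual V)\<^esub>"
    proof (rule perfect_separates1[OF tpow_pairing_perfect[OF V] lin_closed[OF lin_mapsD[OF dagger_lin[OF o1]] a] vs_zero[OF tpow_vs]])
      fix x assume x: "x \<in> carrier (tpow n V)"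
      show "tpow_pairing n V [dagger_endo V R n a, x] = tpow_pairing n V [\<zero>\<^bsub>tpow n (dual V)\<^esub>, x]"
        using lin_zero[OF bilD1[OF b x] tpow_vs scalars_vs] lin_zero[OF bilD2[OF b a] tpow_vs scalars_vs]
        by (simp add: dagger_pairing[OF o1 a x] eca_obs_zero[OF o1 n x])
    qed
  qed
  then show ?thesis by (simp add: A dagger_ob_pair)
qed

lemma tpow_pairing_dual_map:
  fixes V W :: "('k::field, 'a) cmod"
  assumes V: "fd_space V" and W: "fd_space W" and l: "lin V W l"
    and b: "b \<in> carrier (tpow n (dual W))" and x: "x \<in> carrier (tpow n V)"
  shows "tpow_pairing n V [tpow_map n (dual W) (dual V) (dual_map V W l) b, x] = tpow_pairing n W [b, tpow_map n V W l x]"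
proof -
  note d = lin_mapsD[OF dual_map_lin[OF V W l]]
  note D = lin_mapsD[OF tpow_map_lin[OF dual_fd[OF W] dual_fd[OF V] d]] and L = lin_mapsD[OF tpow_map_lin[OF V W l]]
  show ?thesis
  proof (rule merge_eqI[OF dual_fd[OF W] V scalars_vs _ _ _ b x])
    show "bil (tpow n (dual W)) (tpow n V) scalars (\<lambda>b x. tpow_pairing n V [tpow_map n (dual W) (dual V) (dual_map V W l) b, x])"
      by (rule bil_precompose[OF tpow_pairing_bil[OF V] D lin_id])
    show "bil (tpow n (dual W)) (tpow n V) scalars (\<lambda>b x. tpow_pairing n W [b, tpow_map n V W l x])"
      by (rule bil_precompose[OF tpow_pairing_bil[OF W] lin_id L])
    fix bs vs assume bs: "bs \<in> vecs n (dual W)" and vs: "vs \<in> vecs n V"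
    then show "tpow_pairing n V [tpow_map n (dual W) (dual V) (dual_map V W l) (tpow_pure (dual W) bs), tpow_pure V vs] =
        tpow_pairing n W [tpow_pure (dual W) bs, tpow_map n V W l (tpow_pure V vs)]"
      using map_tuples[OF d bs] map_tuples[OF l vs]
      by (simp add: tpow_map_pure[OF dual_fd[OF W] dual_fd[OF V] d] tpow_map_pure[OF V W l]
          tpow_pairing_pure[OF V] tpow_pairing_pure[OF W]) (simp add: tuples_replicate_nth dual_map_pairing[OF V W l])
  qed
qed

lemma dagger_ar_mem:
  fixes A B :: "('k::field, 'a) cob"
  assumes "(A, l, B) \<in> eca_ars"
  shows "(dagger_ob B, dual_map (fst A) (fst B) l, dagger_ob A) \<in> eca_ars"
proof -
  obtain V R W S where A: "A = (V, R)" "B = (W, S)" by (metis surj_pair)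
  note f = assms[unfolded A eca_ars_iff]
  have o1: "(V, R) \<in> eca_obs" and o2: "(W, S) \<in> eca_obs" and l: "lin V W l" using f lin_mapsD by blast+
  note V = eca_obsD(1)[OF o1] and W = eca_obsD(1)[OF o2] and R = eca_obsD(2)[OF o1] and S = eca_obsD(2)[OF o2]
  note d = dual_map_lin[OF V W l] and p = tpow_pairing_dual_map[OF V W l]
  note D = lin_mapsD[OF tpow_map_lin[OF dual_fd[OF W] dual_fd[OF V] lin_mapsD[OF d]]]
    and L = lin_mapsD[OF tpow_map_lin[OF V W l]]
  have "((dual W, dagger_endo W S), dual_map V W l, (dual V, dagger_endo V R)) \<in> eca_ars"
  proof (rule eca_arsI[OF _ _ d generates_carrier])
    show "(dual W, dagger_endo W S) \<in> eca_obs" "(dual V, dagger_endo V R) \<in> eca_obs"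
      using dagger_ob_eca[OF o1] dagger_ob_eca[OF o2] by (simp_all add: dagger_ob_pair)
    fix n b assume b: "b \<in> carrier (tpow n (dual W))"
    note Sb = lin_closed[OF lin_mapsD[OF dagger_lin[OF o2]] b]
    note Db = lin_closed[OF D b]
    show "tpow_map n (dual W) (dual V) (dual_map V W l) (dagger_endo W S n b) =
        dagger_endo V R n (tpow_map n (dual W) (dual V) (dual_map V W l) b)"
    proof (rule perfect_separates1[OF tpow_pairing_perfect[OF V] lin_closed[OF D Sb] lin_closed[OF lin_mapsD[OF dagger_lin[OF o1]] Db]])
      fix x assume x: "x \<in> carrier (tpow n V)"
      note Rx = lin_closed[OF lin_mapsD[OF R] x]
      show "tpow_pairing n V [tpow_map n (dual W) (dual V) (dual_map V W l) (dagger_endo W S n b), x] =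
          tpow_pairing n V [dagger_endo V R n (tpow_map n (dual W) (dual V) (dual_map V W l) b), x]"
        using f x by (simp add: p[OF Sb x] dagger_pairing[OF o2 b lin_closed[OF L x]] dagger_pairing[OF o1 Db x] p[OF b Rx])
    qed
  qed
  then show ?thesis by (simp add: A dagger_ob_pair)
qed

lemma tpow_map_ev:
  fixes V :: "('k::field, 'a) cmod"
  assumes V: "fd_space V" and a: "a \<in> carrier (tpow n (dual V))" and x: "x \<in> carrier (tpow n V)"
  shows "tpow_map n (tens (dual V) V) unit_space (ev_map V) (merge n (dual V) V a x) =
    tpow_pairing n V [a, x] \<odot>\<^bsub>tpow n (unit_space :: ('k, 'a) cmod)\<^esub> tpow_one n"
proof -
  let ?U = "unit_space :: ('k, 'a) cmod"
  have U: "fd_space ?U" by (rule unit_space_fd)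
  note DV = dual_fd[OF V]
  note T = tens_fd[OF DV V] and e = lin_mapsD[OF ev_lin[OF V]]
  have one: "lin scalars (tpow n ?U) (\<lambda>c. c \<odot>\<^bsub>tpow n ?U\<^esub> tpow_one n)"
    by (rule linI)
      (simp_all add: vs_smult[OF tpow_vs] tpow_one_closed vs_add_smult[OF tpow_vs] vs_smult_smult[OF tpow_vs] del: tensor_simps)
  show ?thesis
  proof (rule merge_eqI[OF DV V tpow_vs _ _ _ a x])
    show "bil (tpow n (dual V)) (tpow n V) (tpow n ?U) (\<lambda>a x. tpow_map n (tens (dual V) V) unit_space (ev_map V) (merge n (dual V) V a x))"
      by (rule bil_compose[OF merge_bil[OF DV V] lin_mapsD[OF tpow_map_lin[OF T U e]]])
    show "bil (tpow n (dual V)) (tpow n V) (tpow n ?U) (\<lambda>a x. tpow_pairing n V [a, x] \<odot>\<^bsub>tpow n ?U\<^esub> tpow_one n)"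
      by (rule bil_compose[OF tpow_pairing_bil[OF V] one])
    fix as vs assume as: "as \<in> vecs n (dual V)" and vs: "vs \<in> vecs n V"
    have len: "length as = n" "length vs = n" using as vs by (simp_all add: tuples_replicate)
    let ?cs = "map2 (pairing V) as vs"
    have "map (ev_map V) (map2 (tens_vec (dual V) V) as vs) = map unit_vec ?cs"
      using as vs by (intro nth_equalityI) (simp_all add: tuples_replicate_nth ev_vec[OF V])
    moreover have "prod_list ?cs = (\<Prod>i<n. pairing V (as ! i) (vs ! i))"
      by (simp add: prod.list_conv_set_nth atLeast0LessThan len)
    ultimately show "tpow_map n (tens (dual V) V) ?U (ev_map V) (merge n (dual V) V (tpow_pure (dual V) as) (tpow_pure V vs)) =
        tpow_pairing n V [tpow_pure (dual V) as, tpow_pure V vs] \<odot>\<^bsub>tpow n ?U\<^esub> tpow_one n"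
      using tpow_pure_unit[of ?cs, where 'a = 'a] map2_tens_tuples[OF DV V as vs]
      by (simp add: merge_pure[OF DV V as vs] tpow_map_pure[OF T U e] tpow_pairing_pure[OF V as vs] len del: map_map tensor_simps)
  qed
qed

lemma ev_ar:
  fixes A :: "('k::field, 'a) cob"
  assumes "A \<in> eca_obs"
  shows "(eca_tensor_ob (dagger_ob A) A, ev_map (fst A), eca_unit) \<in> eca_ars"
proof -
  obtain V R where A: "A = (V, R)" by (metis surj_pair)
  note o1 = assms[unfolded A]
  note V = eca_obsD(1)[OF o1] and R = eca_obsD(2)[OF o1]
  note DV = dual_fd[OF V] and D = dagger_lin[OF o1]
  have o2: "(dual V, dagger_endo V R) \<in> eca_obs" using dagger_ob_eca[OF o1] by (simp add: dagger_ob_pair)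
  let ?U = "unit_space :: ('k, 'a) cmod" and ?Z = "\<lambda>n. zero_map (tpow n (unit_space :: ('k, 'a) cmod)) (tpow n (unit_space :: ('k, 'a) cmod))"
  have U: "fd_space ?U" by (rule unit_space_fd)
  note L = lin_mapsD[OF tpow_map_lin[OF tens_fd[OF DV V] U lin_mapsD[OF ev_lin[OF V]]]]
  have "((tens (dual V) V, box_endo (dual V, dagger_endo V R) (V, R)), ev_map V, (?U, ?Z)) \<in> eca_ars"
  proof (rule eca_arsI[OF _ _ ev_lin[OF V] tprod_gen[OF merge_tprod[OF DV V]]])
    show "(tens (dual V) V, box_endo (dual V, dagger_endo V R) (V, R)) \<in> eca_obs" "(?U, ?Z) \<in> eca_obs"
      using tensor_ob_eca[OF o2 o1] unit_ob_eca[where 'a = 'a and 'k = 'k] by (simp_all add: eca_tensor_ob_def eca_unit_def)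
    fix n t assume "t \<in> (\<lambda>(a, x). merge n (dual V) V a x) ` (carrier (tpow n (dual V)) \<times> carrier (tpow n V))"
    then obtain a x where t: "t = merge n (dual V) V a x" and a: "a \<in> carrier (tpow n (dual V))" and x: "x \<in> carrier (tpow n V)" by auto
    note Da = lin_closed[OF lin_mapsD[OF D] a] and Rx = lin_closed[OF lin_mapsD[OF R] x]
    note e = tpow_one_closed[of n, where 'a = 'a and 'k = 'k]
    have "tpow_map n (tens (dual V) V) ?U (ev_map V) (box_endo (dual V, dagger_endo V R) (V, R) n t) =
        (tpow_pairing n V [dagger_endo V R n a, x] + tpow_pairing n V [a, R n x]) \<odot>\<^bsub>tpow n ?U\<^esub> tpow_one n"
      using merge_closed[OF DV V Da x] merge_closed[OF DV V a Rx]
      by (simp add: t box_merge_ob[OF o2 o1 a x] lin_add[OF L] tpow_map_ev[OF V Da x] tpow_map_ev[OF V a Rx] vs_add_smult[OF tpow_vs e] del: tensor_simps)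
    also have "\<dots> = \<zero>\<^bsub>tpow n ?U\<^esub>"
      using vs_zero_smult[OF tpow_vs e] by (simp add: dagger_pairing[OF o1 a x] del: tensor_simps)
    also have "\<dots> = ?Z n (tpow_map n (tens (dual V) V) ?U (ev_map V) t)"
      using lin_closed[OF L merge_closed[OF DV V a x]] by (simp add: zero_map_def t del: tensor_simps)
    finally show "tpow_map n (tens (dual V) V) ?U (ev_map V) (box_endo (dual V, dagger_endo V R) (V, R) n t) =
        ?Z n (tpow_map n (tens (dual V) V) ?U (ev_map V) t)" .
  qed
  then show ?thesis by (simp add: A eca_tensor_ob_def dagger_ob_pair eca_unit_def)
qed

lemma vs_add_eq_self:
  assumes V: "is_vs V" and x: "x \<in> carrier V" and y: "y \<in> carrier V" and eq: "x \<oplus>\<^bsub>V\<^esub> y = y"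
  shows "x = \<zero>\<^bsub>V\<^esub>"
proof -
  have ny: "(- 1) \<odot>\<^bsub>V\<^esub> y \<in> carrier V" by (rule vs_smult[OF V y])
  have y0: "y \<oplus>\<^bsub>V\<^esub> (- 1) \<odot>\<^bsub>V\<^esub> y = \<zero>\<^bsub>V\<^esub>"
    using vs_add_smult[OF V y, of 1 "- 1"] vs_one_smult[OF V y] vs_zero_smult[OF V y] by simp
  have "x = x \<oplus>\<^bsub>V\<^esub> (y \<oplus>\<^bsub>V\<^esub> (- 1) \<odot>\<^bsub>V\<^esub> y)" by (simp add: y0 vs_rzero[OF V x])
  also have "\<dots> = (x \<oplus>\<^bsub>V\<^esub> y) \<oplus>\<^bsub>V\<^esub> (- 1) \<odot>\<^bsub>V\<^esub> y" by (simp add: vs_assoc[OF V x y ny])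
  also have "\<dots> = \<zero>\<^bsub>V\<^esub>" by (simp add: eq y0)
  finally show ?thesis .
qed

text \<open>The contraction \<open>E\<close> views \<open>(V \<otimes> V\<^sup>*)\<^sup>\<otimes>\<^sup>n\<close> as a space of endomorphisms of
  \<open>V\<^sup>\<otimes>\<^sup>n\<close>: \<open>y \<otimes> b\<close> acts as \<open>x \<mapsto> \<langle>b, x\<rangle> y\<close>.\<close>

lemma contraction:
  fixes V :: "('k::field, 'a) cmod"
  assumes V: "fd_space V"
  shows "\<exists>E. bil (tpow n (tens V (dual V))) (tpow n V) (tpow n V) E \<and>
      (\<forall>y\<in>carrier (tpow n V). \<forall>b\<in>carrier (tpow n (dual V)). \<forall>x\<in>carrier (tpow n V).
        E (merge n V (dual V) y b) x = tpow_pairing n V [b, x] \<odot>\<^bsub>tpow n V\<^esub> y)"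
proof (rule trilinear_lift[OF merge_tprod[OF V dual_fd[OF V]] tpow_vs tpow_fd[OF V]])
  note p = tpow_pairing_bil[OF V, of n]
  have s: "bil scalars (tpow n V) (tpow n V) (\<lambda>c y. c \<odot>\<^bsub>tpow n V\<^esub> y)"
    by (rule bilI; rule linI)
      (simp_all add: vs_smult[OF tpow_vs] vs_add_smult[OF tpow_vs] vs_smult_smult[OF tpow_vs] vs_smult_add[OF tpow_vs] mult.commute del: tensor_simps)
  show "bil (tpow n V) (tpow n (dual V)) (tpow n V) (\<lambda>y b. tpow_pairing n V [b, x] \<odot>\<^bsub>tpow n V\<^esub> y)"
    if "x \<in> carrier (tpow n V)" for x
    by (rule bil_flip[OF bil_precompose[OF s bilD1[OF p that] lin_id]])
  show "lin (tpow n V) (tpow n V) (\<lambda>x. tpow_pairing n V [b, x] \<odot>\<^bsub>tpow n V\<^esub> y)"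
    if "y \<in> carrier (tpow n V)" "b \<in> carrier (tpow n (dual V))" for y b
    by (rule lin_compose[OF bilD2[OF p that(2)] bilD1[OF s that(1)]])
qed

text \<open>A dual basis of \<open>(V \<otimes> V\<^sup>*)\<^sup>\<otimes>\<^sup>n\<close> can be chosen from functionals \<open>y \<otimes> b \<mapsto> \<phi>(y) \<langle>b, x\<rangle>\<close>, each of
  which is \<open>\<phi>\<close> applied to the contraction with some \<open>x\<close>.\<close>

lemma contraction_separates:
  fixes V :: "('k::field, 'a) cmod"
  assumes V: "fd_space V" and E: "bil (tpow n (tens V (dual V))) (tpow n V) (tpow n V) E"
    and Em: "\<forall>y\<in>carrier (tpow n V). \<forall>b\<in>carrier (tpow n (dual V)). \<forall>x\<in>carrier (tpow n V).
        E (merge n V (dual V) y b) x = tpow_pairing n V [b, x] \<odot>\<^bsub>tpow n V\<^esub> y"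
    and t: "t \<in> carrier (tpow n (tens V (dual V)))" and zero: "\<And>x. x \<in> carrier (tpow n V) \<Longrightarrow> E t x = \<zero>\<^bsub>tpow n V\<^esub>"
  shows "t = \<zero>\<^bsub>tpow n (tens V (dual V))\<^esub>"
proof -
  note DV = dual_fd[OF V]
  note T = merge_tprod[OF V DV, of n]
  obtain D1 where D1: "dual_basis (tpow n V) D1" using fd_space_dual_basis[OF tpow_fd[OF V]] ..
  obtain D2 where D2: "dual_basis (tpow n (dual V)) D2"
    and D2': "\<forall>(a, f)\<in>set D2. \<exists>x\<in>carrier (tpow n V). \<forall>b\<in>carrier (tpow n (dual V)). f b = tpow_pairing n V [b, x]"
    using perfect_dual_basis1[OF tpow_pairing_perfect[OF V, of n]] by blast
  obtain D where D: "dual_basis (tpow n (tens V (dual V))) D" and D': "\<forall>(t, f)\<in>set D. \<exists>b \<phi> c \<psi>. (b, \<phi>) \<in> set D1 \<and> (c, \<psi>) \<in> set D2 \<and> t = merge n V (dual V) b c \<and>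
      (\<forall>y\<in>carrier (tpow n V). \<forall>b\<in>carrier (tpow n (dual V)). f (merge n V (dual V) y b) = \<phi> y * \<psi> b)"
    using tprod_dual_basis[OF T tpow_vs tpow_vs D1 D2] by blast
  show ?thesis
  proof (rule dual_basis_separates[OF D t vs_zero[OF tpow_vs]])
    fix s f assume sf: "(s, f) \<in> set D"
    then obtain b \<phi> c \<psi> where bc: "(b, \<phi>) \<in> set D1" "(c, \<psi>) \<in> set D2"
      and f: "\<forall>y\<in>carrier (tpow n V). \<forall>b\<in>carrier (tpow n (dual V)). f (merge n V (dual V) y b) = \<phi> y * \<psi> b"
      using D' by blast
    obtain x where x: "x \<in> carrier (tpow n V)" and \<psi>: "\<forall>b\<in>carrier (tpow n (dual V)). \<psi> b = tpow_pairing n V [b, x]"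
      using D2' bc(2) by blast
    have fl: "lin (tpow n (tens V (dual V))) scalars f" using dual_basis_closed[OF D sf] by simp
    have \<phi>: "lin (tpow n V) scalars \<phi>" using dual_basis_closed[OF D1 bc(1)] by simp
    have "f t = \<phi> (E t x)"
    proof (rule tprod_eqI[OF T scalars_vs fl lin_compose[OF bilD1[OF E x] \<phi>] _ t])
      fix y b assume y: "y \<in> carrier (tpow n V)" and b: "b \<in> carrier (tpow n (dual V))"
      show "f (merge n V (dual V) y b) = \<phi> (E (merge n V (dual V) y b) x)"
        using f Em y b x \<psi> lin_smult[OF \<phi> y] by (simp add: mult.commute)
    qed
    also have "\<dots> = 0" using zero[OF x] lin_zero[OF \<phi> tpow_vs scalars_vs] by simp
    also have "0 = f \<zero>\<^bsub>tpow n (tens V (dual V))\<^esub>" using lin_zero[OF fl tpow_vs scalars_vs] by simp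
    finally show "f t = f \<zero>\<^bsub>tpow n (tens V (dual V))\<^esub>" .
  qed
qed

text \<open>The tensor power of the canonical element acts as the identity. For a pure tensor \<open>x = x\<^sub>1 \<otimes> \<dots> \<otimes> x\<^sub>n\<close> the contraction
  with \<open>x\<close> is the tensor product of the contractions with the \<open>x\<^sub>i\<close> in the single factors, and each of these sends the
  canonical element to \<open>x\<^sub>i\<close>.\<close>

lemma contraction_coev:
  fixes V :: "('k::field, 'a) cmod"
  assumes V: "fd_space V" and E: "bil (tpow n (tens V (dual V))) (tpow n V) (tpow n V) E"
    and Em: "\<forall>y\<in>carrier (tpow n V). \<forall>b\<in>carrier (tpow n (dual V)). \<forall>x\<in>carrier (tpow n V).
        E (merge n V (dual V) y b) x = tpow_pairing n V [b, x] \<odot>\<^bsub>tpow n V\<^esub> y"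
    and x: "x \<in> carrier (tpow n V)"
  shows "E (tpow_pure (tens V (dual V)) (replicate n (coev_vec V))) x = x"
proof -
  note DV = dual_fd[OF V] and VV = fd_space_vs[OF V]
  note T = tens_fd[OF V DV]
  let ?T = "tens V (dual V)" and ?\<kappa> = "replicate n (coev_vec V)"
  have \<kappa>: "?\<kappa> \<in> vecs n ?T" using coev_vec_closed[OF V] by (simp add: tuples_replicate_nth)
  note K = tpow_pure_closed[OF \<kappa>]
  show ?thesis
  proof (rule tpow_eqI[OF tpow_vs bilD2[OF E K] lin_id _ x])
    fix xs assume xs: "xs \<in> vecs n V"
    then have len: "length xs = n" and xi: "\<And>i. i < n \<Longrightarrow> xs ! i \<in> carrier V" by (auto simp: tuples_replicate_nth)
    have b1: "bil V (dual V) V (\<lambda>v b. pairing V b w \<odot>\<^bsub>V\<^esub> v)" if w: "w \<in> carrier V" for w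
    proof (rule bilI)
      show "lin V V (\<lambda>v. pairing V b w \<odot>\<^bsub>V\<^esub> v)" for b by (rule lin_scale[OF VV lin_id])
      show "lin (dual V) V (\<lambda>b. pairing V b w \<odot>\<^bsub>V\<^esub> v)" if v: "v \<in> carrier V" for v
        by (intro linI) (simp_all add: vs_smult[OF VV v] lin_add[OF bilD1[OF pairing_bil[OF V] w]]
            lin_smult[OF bilD1[OF pairing_bil[OF V] w]] vs_add_smult[OF VV v] vs_smult_smult[OF VV v])
    qed
    have "\<forall>i<n. \<exists>c. lin ?T V c \<and> (\<forall>v\<in>carrier V. \<forall>b\<in>carrier (dual V). c (tens_vec V (dual V) v b) = pairing V b (xs ! i) \<odot>\<^bsub>V\<^esub> v)"
      using tprod_lift[OF tens_tprod[OF V DV] V b1[OF xi]] lin_mapsD by blast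
    then obtain c where c: "\<And>i. i < n \<Longrightarrow> lin ?T V (c i)"
      and cv: "\<And>i v b. i < n \<Longrightarrow> v \<in> carrier V \<Longrightarrow> b \<in> carrier (dual V) \<Longrightarrow> c i (tens_vec V (dual V) v b) = pairing V b (xs ! i) \<odot>\<^bsub>V\<^esub> v"
      unfolding choice_iff' by blast
    let ?cs = "map c [0..<n]"
    (* the i-th single contraction of the canonical element returns x_i *)
    have c\<kappa>: "c i (coev_vec V) = xs ! i" if i: "i < n" for i
      by (rule coev_vec_left[OF V VV c[OF i] lin_id xi[OF i] cv[OF i]])
    let ?M = "tensor_map (replicate n ?T) (replicate n V) ?cs"
    have fdT: "\<And>X. X \<in> set (replicate n ?T) \<Longrightarrow> fd_space X" and fdV: "\<And>X. X \<in> set (replicate n V) \<Longrightarrow> fd_space X"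
      using T V by auto
    have ci: "lin (replicate n ?T ! i) (replicate n V ! i) (?cs ! i)" if "i < n" for i using c that by simp
    have lens: "length (replicate n ?T) = n" "length (replicate n V) = n" "length ?cs = n" by simp_all
    have M: "lin (tpow n ?T) (tpow n V) ?M"
      unfolding tpow_def by (rule lin_mapsD[OF tensor_map_lin[OF fdT fdV lens ci]])
    have Mp: "?M (tpow_pure ?T ts) = tpow_pure V (map2 (\<lambda>f v. f v) ?cs ts)" if ts: "ts \<in> vecs n ?T" for ts
      using tensor_map_pure[OF fdT fdV lens ci ts] ts by (simp add: tpow_pure_def tuples_replicate)
    note X = tpow_pure_closed[OF xs]
    have "E t (tpow_pure V xs) = ?M t" if t: "t \<in> carrier (tpow n ?T)" for t
    proof (rule lin_eq_on_generators[OF tpow_vs tpow_vs regroup_gen1[OF V DV] bilD1[OF E X] M _ t])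
      fix t assume "t \<in> (\<lambda>(vs, ws). tpow_pure ?T (map2 (tens_vec V (dual V)) vs ws)) ` simple_pairs n V (dual V)"
      then obtain vs bs where t: "t = tpow_pure ?T (map2 (tens_vec V (dual V)) vs bs)"
        and vs: "vs \<in> vecs n V" and bs: "bs \<in> vecs n (dual V)"
        by (auto simp: simple_pairs_def)
      have lv: "length vs = n" "length bs = n" using vs bs by (simp_all add: tuples_replicate)
      let ?ps = "map2 (pairing V) bs xs"
      have "E t (tpow_pure V xs) = tpow_pairing n V [tpow_pure (dual V) bs, tpow_pure V xs] \<odot>\<^bsub>tpow n V\<^esub> tpow_pure V vs"
        using Em tpow_pure_closed[OF vs] tpow_pure_closed[OF bs] X by (simp add: t merge_pure[OF V DV vs bs, symmetric])
      also have "tpow_pairing n V [tpow_pure (dual V) bs, tpow_pure V xs] = prod_list ?ps"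
        by (simp add: tpow_pairing_pure[OF V bs xs] prod.list_conv_set_nth atLeast0LessThan lv len)
      also have "prod_list ?ps \<odot>\<^bsub>tpow n V\<^esub> tpow_pure V vs = pure (replicate n V) (map2 (\<lambda>c v. c \<odot>\<^bsub>V\<^esub> v) ?ps vs)"
        using mlin_scale[OF tensor_vs pure_mlin vs _ VV, of ?ps] lv len by (simp add: tpow_def tpow_pure_eq[OF vs])
      also have "map2 (\<lambda>c v. c \<odot>\<^bsub>V\<^esub> v) ?ps vs = map2 (\<lambda>f v. f v) ?cs (map2 (tens_vec V (dual V)) vs bs)"
        using vs bs by (intro nth_equalityI) (simp_all add: lv len cv tuples_replicate_nth)
      also have "pure (replicate n V) \<dots> = ?M t"
        using Mp[OF map2_tens_tuples[OF V DV vs bs]] by (simp add: t tpow_pure_def lv)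
      finally show "E t (tpow_pure V xs) = ?M t" .
    qed
    from this[OF K] have "E (tpow_pure ?T ?\<kappa>) (tpow_pure V xs) = tpow_pure V (map2 (\<lambda>f v. f v) ?cs ?\<kappa>)"
      by (simp add: Mp[OF \<kappa>])
    also have "map2 (\<lambda>f v. f v) ?cs ?\<kappa> = xs"
      by (rule nth_equalityI) (simp_all add: len c\<kappa>)
    finally show "E (tpow_pure ?T ?\<kappa>) (tpow_pure V xs) = tpow_pure V xs" .
  qed
qed

text \<open>Under the contraction, \<open>R \<otimes> id - id \<otimes> R\<^sup>*\<close> becomes the commutator with \<open>R\<close>, and the canonical element is the identity.\<close>

lemma box_coev_zero:
  fixes V :: "('k::field, 'a) cmod"
  assumes o1: "(V, R) \<in> eca_obs"
  shows "box_endo (V, R) (dual V, dagger_endo V R) n (tpow_pure (tens V (dual V)) (replicate n (coev_vec V)))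
    = \<zero>\<^bsub>tpow n (tens V (dual V))\<^esub>"
proof -
  note V = eca_obsD(1)[OF o1] and R = lin_mapsD[OF eca_obsD(2)[OF o1, of n]]
  note DV = dual_fd[OF V] and D = lin_mapsD[OF dagger_lin[OF o1, of n]]
  have o2: "(dual V, dagger_endo V R) \<in> eca_obs" using dagger_ob_eca[OF o1] by (simp add: dagger_ob_pair)
  let ?T = "tens V (dual V)" and ?b = "box_endo (V, R) (dual V, dagger_endo V R) n"
  let ?c = "tpow_pure (tens V (dual V)) (replicate n (coev_vec V))"
  note X = tpow_vs[of n V] and b = lin_mapsD[OF box_lin_ob[OF o1 o2, of n]] and p = tpow_pairing_bil[OF V, of n]
  have c: "?c \<in> carrier (tpow n ?T)"
    by (rule tpow_pure_closed) (use coev_vec_closed[OF V] in \<open>simp add: tuples_replicate_nth\<close>)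
  obtain E where E: "bil (tpow n (tens V (dual V))) (tpow n V) (tpow n V) E"
    and Em: "\<forall>y\<in>carrier (tpow n V). \<forall>b\<in>carrier (tpow n (dual V)). \<forall>x\<in>carrier (tpow n V).
        E (merge n V (dual V) y b) x = tpow_pairing n V [b, x] \<odot>\<^bsub>tpow n V\<^esub> y"
    using contraction[OF V] by blast
  note Ec = contraction_coev[OF V E Em]
  (* the commutator identity E (box t) x = R (E t x) - E t (R x), checked on t = merge y a *)
  have key: "E (?b t) x \<oplus>\<^bsub>tpow n V\<^esub> E t (R n x) = R n (E t x)"
    if t: "t \<in> carrier (tpow n ?T)" and x: "x \<in> carrier (tpow n V)" for t x
  proof (rule tprod_eqI[OF merge_tprod[OF V DV] X _ _ _ t])
    note Rx = lin_closed[OF R x]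
    show "lin (tpow n ?T) (tpow n V) (\<lambda>t. E (?b t) x \<oplus>\<^bsub>tpow n V\<^esub> E t (R n x))"
      by (rule lin_plus[OF X lin_compose[OF b bilD1[OF E x]] bilD1[OF E Rx]])
    show "lin (tpow n ?T) (tpow n V) (\<lambda>t. R n (E t x))"
      by (rule lin_compose[OF bilD1[OF E x] R])
    fix y a assume y: "y \<in> carrier (tpow n V)" and a: "a \<in> carrier (tpow n (dual V))"
    note Ry = lin_closed[OF R y] and Da = lin_closed[OF D a]
    have "E (?b (merge n V (dual V) y a)) x =
        tpow_pairing n V [a, x] \<odot>\<^bsub>tpow n V\<^esub> R n y \<oplus>\<^bsub>tpow n V\<^esub> tpow_pairing n V [dagger_endo V R n a, x] \<odot>\<^bsub>tpow n V\<^esub> y"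
      using Em x y a Ry Da
      by (simp add: box_merge_ob[OF o1 o2 y a] lin_add[OF bilD1[OF E x] merge_closed[OF V DV Ry a] merge_closed[OF V DV y Da]] del: tensor_simps)
    then have "E (?b (merge n V (dual V) y a)) x \<oplus>\<^bsub>tpow n V\<^esub> E (merge n V (dual V) y a) (R n x) =
        tpow_pairing n V [a, x] \<odot>\<^bsub>tpow n V\<^esub> R n y \<oplus>\<^bsub>tpow n V\<^esub>
          ((- tpow_pairing n V [a, R n x]) \<odot>\<^bsub>tpow n V\<^esub> y \<oplus>\<^bsub>tpow n V\<^esub> tpow_pairing n V [a, R n x] \<odot>\<^bsub>tpow n V\<^esub> y)"
      using Em Rx y a by (simp add: dagger_pairing[OF o1 a x] vs_assoc[OF X] vs_smult[OF X] Ry y del: tensor_simps)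
    also have "\<dots> = tpow_pairing n V [a, x] \<odot>\<^bsub>tpow n V\<^esub> R n y"
      using vs_add_smult[OF X y, of "- tpow_pairing n V [a, R n x]" "tpow_pairing n V [a, R n x]", symmetric]
      by (simp add: vs_zero_smult[OF X y] vs_rzero[OF X] vs_smult[OF X] Ry del: tensor_simps)
    also have "\<dots> = R n (E (merge n V (dual V) y a) x)"
      using Em x y a by (simp add: lin_smult[OF R y])
    finally show "E (?b (merge n V (dual V) y a)) x \<oplus>\<^bsub>tpow n V\<^esub> E (merge n V (dual V) y a) (R n x) = R n (E (merge n V (dual V) y a) x)" .
  qed
  show ?thesis
  proof (rule contraction_separates[OF V E Em lin_closed[OF b c]])
    fix x assume x: "x \<in> carrier (tpow n V)"
    have "E (?b ?c) x \<oplus>\<^bsub>tpow n V\<^esub> R n x = R n x"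
      using key[OF c x] Ec[OF x] Ec[OF lin_closed[OF R x]] by simp
    then show "E (?b ?c) x = \<zero>\<^bsub>tpow n V\<^esub>"
      by (rule vs_add_eq_self[OF X bil_closed[OF E lin_closed[OF b c] x] lin_closed[OF R x]])
  qed
qed

lemma coev_ar:
  fixes A :: "('k::field, 'a) cob"
  assumes "A \<in> eca_obs"
  shows "(eca_unit, coev_map (fst A), eca_tensor_ob A (dagger_ob A)) \<in> eca_ars"
proof -
  obtain V R where A: "A = (V, R)" by (metis surj_pair)
  note o1 = assms[unfolded A]
  note V = eca_obsD(1)[OF o1] and DV = dual_fd[OF eca_obsD(1)[OF o1]]
  have o2: "(dual V, dagger_endo V R) \<in> eca_obs" using dagger_ob_eca[OF o1] by (simp add: dagger_ob_pair)
  let ?U = "unit_space :: ('k, 'a) cmod" and ?Z = "\<lambda>n. zero_map (tpow n (unit_space :: ('k, 'a) cmod)) (tpow n (unit_space :: ('k, 'a) cmod))"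
  have U: "fd_space ?U" by (rule unit_space_fd)
  note L = lin_mapsD[OF tpow_map_lin[OF U tens_fd[OF V DV] lin_mapsD[OF coev_lin[OF V]]]]
  have "((?U, ?Z), coev_map V, (tens V (dual V), box_endo (V, R) (dual V, dagger_endo V R))) \<in> eca_ars"
  proof (rule eca_arsI[OF _ _ coev_lin[OF V] tpow_one_gen])
    show "(tens V (dual V), box_endo (V, R) (dual V, dagger_endo V R)) \<in> eca_obs" "(?U, ?Z) \<in> eca_obs"
      using tensor_ob_eca[OF o1 o2] unit_ob_eca[where 'a = 'a and 'k = 'k] by (simp_all add: eca_tensor_ob_def eca_unit_def)
    fix n x assume x: "x \<in> {tpow_one n :: (('a + 'k list) list \<Rightarrow> 'k) \<Rightarrow> 'k}"
    have "tpow_map n ?U (tens V (dual V)) (coev_map V) (tpow_one n) = tpow_pure (tens V (dual V)) (replicate n (coev_vec V))"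
      using tpow_map_pure[OF U tens_fd[OF V DV] lin_mapsD[OF coev_lin[OF V]] unit_ones_tuple[of n, where 'a = 'a and 'k = 'k]]
      by (simp add: tpow_one_def coev_one[OF V])
    then show "tpow_map n ?U (tens V (dual V)) (coev_map V) (?Z n x) =
        box_endo (V, R) (dual V, dagger_endo V R) n (tpow_map n ?U (tens V (dual V)) (coev_map V) x)"
      using x lin_zero[OF L tpow_vs tpow_vs] tpow_one_closed[of n, where 'a = 'a and 'k = 'k]
      by (simp add: box_coev_zero[OF o1] zero_map_def del: tensor_simps)
  qed
  then show ?thesis by (simp add: A eca_tensor_ob_def dagger_ob_pair eca_unit_def)
qed


section \<open>The monoidal category\<close>

lemma ECA_simps [simp]:
  "Ob ECA = eca_obs" "Ar ECA = eca_ars" "Dom ECA (A, l, B) = A" "Cod ECA (A, l, B) = B"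
  "Ident ECA A = (A, id_map (fst A), A)"
  "Comp ECA (B', k, D) (A, l, B) = (A, compose (carrier (fst A)) k l, D)"
  "TensorOb ECA = eca_tensor_ob"
  "TensorAr ECA (A, l, B) (A', k, B') =
    (eca_tensor_ob A A', tens_map (fst A) (fst B) (fst A') (fst B') l k, eca_tensor_ob B B')"
  "UnitOb ECA = eca_unit"
  "Assoc ECA A B D = (eca_tensor_ob (eca_tensor_ob A B) D, assoc_map (fst A) (fst B) (fst D),
      eca_tensor_ob A (eca_tensor_ob B D))"
  "LUnit ECA A = (eca_tensor_ob eca_unit A, lunit_map (fst A), A)"
  "RUnit ECA A = (eca_tensor_ob A eca_unit, runit_map (fst A), A)"
  "Braid ECA A B = (eca_tensor_ob A B, swap_map (fst A) (fst B), eca_tensor_ob B A)"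
  by (simp_all add: ECA_def eca_id_def eca_comp_def eca_tensor_ar_def)

lemma fst_simps [simp]:
  "fst (eca_tensor_ob A B) = tens (fst A) (fst B)" "fst eca_unit = unit_space" "fst (dagger_ob A) = dual (fst A)"
  by (simp_all add: eca_tensor_ob_def eca_unit_def dagger_ob_def case_prod_unfold)

lemma ob_fd: "A \<in> eca_obs \<Longrightarrow> fd_space (fst A)"
  by (cases A) (simp add: eca_obsD(1))

lemma eca_arsE:
  assumes "f \<in> eca_ars"
  obtains A l B where "f = (A, l, B)" "A \<in> eca_obs" "B \<in> eca_obs" "l \<in> lin_maps (fst A) (fst B)" "(A, l, B) \<in> eca_ars"
  using assms by (auto simp: eca_ars_def)

lemma eca_arsD:
  assumes "(A, l, B) \<in> eca_ars"
  shows "A \<in> eca_obs" "B \<in> eca_obs" "l \<in> lin_maps (fst A) (fst B)" "lin (fst A) (fst B) l"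
    "fd_space (fst A)" "fd_space (fst B)"
  using assms by (auto simp: eca_ars_def lin_mapsD eca_obsD(1))

lemma arrows_ECA: "f \<in> arrows ECA A B \<longleftrightarrow> (\<exists>l. f = (A, l, B) \<and> (A, l, B) \<in> eca_ars)"
  by (cases f) (auto simp: arrows_def)

lemma category_ECA: "category (ECA :: (('k::field, 'a) cob, ('k, 'a + 'k list) eca_ar) monoidal_data)"
proof (rule category.intro)
  fix f g h :: "('k, 'a + 'k list) eca_ar" and A :: "('k, 'a) cob"
  show "Ident ECA A \<in> arrows ECA A A" if "A \<in> Ob ECA"
    using that by (simp add: arrows_ECA eca_id_ar)
  assume f: "f \<in> Ar ECA"
  then obtain A l B where fe: "f = (A, l, B)" and fa: "(A, l, B) \<in> eca_ars" by (auto elim: eca_arsE)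
  note l = eca_arsD[OF fa]
  show "Dom ECA f \<in> Ob ECA" "Cod ECA f \<in> Ob ECA" using l by (simp_all add: fe)
  show "Comp ECA f (Ident ECA (Dom ECA f)) = f" "Comp ECA (Ident ECA (Cod ECA f)) f = f"
    using l(3) lin_closed[OF l(4)]
    by (auto simp: fe lin_maps_iff compose_def id_map_def extensional_def fun_eq_iff restrict_def)
  assume "g \<in> Ar ECA" "Dom ECA g = Cod ECA f"
  then obtain k D where ge: "g = (B, k, D)" and ga: "(B, k, D) \<in> eca_ars" by (auto simp: fe elim: eca_arsE)
  show "Comp ECA g f \<in> arrows ECA (Dom ECA f) (Cod ECA g)"
    using eca_comp_ar[OF fa ga] by (simp add: fe ge arrows_ECA)
  assume "h \<in> Ar ECA" "Dom ECA h = Cod ECA g"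
  then obtain m D' where he: "h = (D, m, D')" by (auto simp: ge elim: eca_arsE)
  show "Comp ECA (Comp ECA h g) f = Comp ECA h (Comp ECA g f)"
    using lin_closed[OF l(4)] by (auto simp: fe ge he compose_def fun_eq_iff)
qed

lemma lin_iso_inverse_arrows:
  fixes A B :: "('k::field, 'a) cob"
  assumes f: "(A, l, B) \<in> eca_ars" and iso: "lin_iso (fst A) (fst B) l"
  shows "inverse_arrows ECA (A, l, B) (B, restrict (inv_into (carrier (fst A)) l) (carrier (fst B)), A)"
proof -
  note l = eca_arsD[OF f]
  have "compose (carrier (fst A)) (restrict (inv_into (carrier (fst A)) l) (carrier (fst B))) l = id_map (fst A)"
    using lin_closed[OF l(4)] lin_iso_inv_into_left[OF iso] by (auto simp: compose_def id_map_def fun_eq_iff)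
  moreover have "compose (carrier (fst B)) l (restrict (inv_into (carrier (fst A)) l) (carrier (fst B))) = id_map (fst B)"
    using lin_iso_inv_into(2)[OF iso] by (auto simp: compose_def id_map_def fun_eq_iff)
  ultimately show ?thesis
    using f eca_inverse_ar[OF f iso] by (simp add: inverse_arrows_def arrows_ECA)
qed

lemma lin_iso_arrow:
  fixes A B :: "('k::field, 'a) cob"
  assumes "(A, l, B) \<in> eca_ars" "lin_iso (fst A) (fst B) l"
  shows "iso_arrow ECA (A, l, B)"
  using lin_iso_inverse_arrows[OF assms] unfolding iso_arrow_def by blast

lemma inverse_arrow_ECA:
  fixes A B :: "('k::field, 'a) cob"
  assumes f: "(A, l, B) \<in> eca_ars" and iso: "lin_iso (fst A) (fst B) l"
  shows "inverse_arrow ECA (A, l, B) = (B, restrict (inv_into (carrier (fst A)) l) (carrier (fst B)), A)"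
  unfolding inverse_arrow_def
proof (rule the_equality)
  interpret category "ECA :: (('k, 'a) cob, ('k, 'a + 'k list) eca_ar) monoidal_data" by (rule category_ECA)
  let ?f = "(A, l, B)" and ?g = "(B, restrict (inv_into (carrier (fst A)) l) (carrier (fst B)), A)"
  show g: "inverse_arrows ECA ?f ?g" by (rule lin_iso_inverse_arrows[OF assms])
  fix h :: "('k, 'a + 'k list) eca_ar" assume h: "inverse_arrows ECA ?f h"
  note h' = h[unfolded inverse_arrows_def arrows_def] and g' = g[unfolded inverse_arrows_def arrows_def]
  have "h = Comp ECA h (Ident ECA (Dom ECA h))" using h' id_right[of h] by auto
  also have "Ident ECA (Dom ECA h) = Comp ECA ?f ?g" using h' g' by auto
  also have "Comp ECA h (Comp ECA ?f ?g) = Comp ECA (Comp ECA h ?f) ?g"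
    using h' g' by (intro comp_assoc[symmetric]) auto
  also have "Comp ECA h ?f = Ident ECA (Cod ECA ?g)" using h' g' by auto
  also have "Comp ECA (Ident ECA (Cod ECA ?g)) ?g = ?g" using g' id_left[of ?g] by auto
  finally show "h = ?g" .
qed


subsection \<open>Identities between structural maps\<close>

lemma id_map_apply: "v \<in> carrier V \<Longrightarrow> id_map V v = v"
  by (simp add: id_map_def)

lemma tens_map_id:
  fixes V W :: "('k::field, 'a) cmod"
  assumes V: "fd_space V" and W: "fd_space W"
  shows "tens_map V V W W (id_map V) (id_map W) = id_map (tens V W)" (is "?l = ?r")
proof (rule lin_maps_eq_on_generators[OF tens_vs[OF V W] tens_vs[OF V W] tprod_gen[OF tens_tprod[OF V W]]])
  note i = lin_mapsD[OF id_map_lin_maps[OF fd_space_vs[OF V]]] lin_mapsD[OF id_map_lin_maps[OF fd_space_vs[OF W]]]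
  show "?l \<in> lin_maps (tens V W) (tens V W)"
    by (rule tens_map_lin[OF V W V W i])
  show "?r \<in> lin_maps (tens V W) (tens V W)"
    by (rule id_map_lin_maps[OF tens_vs[OF V W]])
  fix t assume "t \<in> (\<lambda>(v, w). tens_vec V W v w) ` (carrier V \<times> carrier W)"
  then show "?l t = ?r t"
    using tens_vec_closed[OF V W] by (auto simp: tens_map_vec[OF V W V W i]) (simp add: id_map_def)
qed

lemma tens_map_compose:
  fixes V W V' W' V'' W'' :: "('k::field, 'a) cmod"
  assumes fd: "fd_space V" "fd_space W" "fd_space V'" "fd_space W'" "fd_space V''" "fd_space W''"
    and k: "lin V V' k" and k': "lin V' V'' k'" and l: "lin W W' l" and l': "lin W' W'' l'"
  shows "tens_map V V'' W W'' (compose (carrier V) k' k) (compose (carrier W) l' l) =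
    compose (carrier (tens V W)) (tens_map V' V'' W' W'' k' l') (tens_map V V' W W' k l)" (is "?l = ?r")
proof (rule lin_maps_eq_on_generators[OF tens_vs[OF fd(1,2)] tens_vs[OF fd(5,6)] tprod_gen[OF tens_tprod[OF fd(1,2)]]])
  note c = lin_mapsD[OF compose_lin_maps[OF fd_space_vs[OF fd(1)] k k']] lin_mapsD[OF compose_lin_maps[OF fd_space_vs[OF fd(2)] l l']]
  note T = tens_map_lin[OF fd(1,2,3,4) k l] and T' = tens_map_lin[OF fd(3,4,5,6) k' l']
  show "?l \<in> lin_maps (tens V W) (tens V'' W'')"
    by (rule tens_map_lin[OF fd(1,2,5,6) c])
  show "?r \<in> lin_maps (tens V W) (tens V'' W'')"
    by (rule compose_lin_maps[OF tens_vs[OF fd(1,2)] lin_mapsD[OF T] lin_mapsD[OF T']])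
  fix t assume "t \<in> (\<lambda>(v, w). tens_vec V W v w) ` (carrier V \<times> carrier W)"
  then obtain v w where t: "t = tens_vec V W v w" and v: "v \<in> carrier V" and w: "w \<in> carrier W" by auto
  show "?l t = ?r t"
    using v w tens_vec_closed[OF fd(1,2) v w]
    by (simp add: t tens_map_vec[OF fd(1,2,5,6) c] tens_map_vec[OF fd(1,2,3,4) k l] tens_map_vec[OF fd(3,4,5,6) k' l']
        compose_eq lin_closed[OF k] lin_closed[OF l])
qed

lemma assoc_map_natural:
  fixes U V W U' V' W' :: "('k::field, 'a) cmod"
  assumes fd: "fd_space U" "fd_space V" "fd_space W" "fd_space U'" "fd_space V'" "fd_space W'"
    and f: "lin U U' f" and g: "lin V V' g" and h: "lin W W' h"
  shows "compose (carrier (tens (tens U V) W)) (assoc_map U' V' W') (tens_map (tens U V) (tens U' V') W W' (tens_map U U' V V' f g) h) =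
    compose (carrier (tens (tens U V) W)) (tens_map U U' (tens V W) (tens V' W') f (tens_map V V' W W' g h)) (assoc_map U V W)" (is "?l = ?r")
proof -
  note UV = tens_fd[OF fd(1,2)] and VW = tens_fd[OF fd(2,3)] and UV' = tens_fd[OF fd(4,5)] and VW' = tens_fd[OF fd(5,6)]
  note X = tens_vs[OF UV fd(3)]
  note fg = lin_mapsD[OF tens_map_lin[OF fd(1,2,4,5) f g]] and gh = lin_mapsD[OF tens_map_lin[OF fd(2,3,5,6) g h]]
  note a = lin_mapsD[OF assoc_lin[OF fd(1,2,3)]] and a' = lin_mapsD[OF assoc_lin[OF fd(4,5,6)]]
  note L = lin_mapsD[OF tens_map_lin[OF UV fd(3) UV' fd(6) fg h]] and R = lin_mapsD[OF tens_map_lin[OF fd(1) VW fd(4) VW' f gh]]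
  show ?thesis
  proof (rule lin_maps_eq_on_generators[OF X tens_vs[OF fd(4) VW'] tens_assoc_gen[OF fd(1,2,3)] compose_lin_maps[OF X L a'] compose_lin_maps[OF X a R]])
    fix t assume "t \<in> (\<lambda>(t, w). tens_vec (tens U V) W t w) ` (((\<lambda>(u, v). tens_vec U V u v) ` (carrier U \<times> carrier V)) \<times> carrier W)"
    then obtain u v w where t: "t = tens_vec (tens U V) W (tens_vec U V u v) w" and u: "u \<in> carrier U" and v: "v \<in> carrier V" and w: "w \<in> carrier W" by auto
    note c = tens_vec_closed[OF UV fd(3) tens_vec_closed[OF fd(1,2) u v] w] tens_vec_closed[OF fd(1,2) u v] tens_vec_closed[OF fd(2,3) v w]
    show "?l t = ?r t"
      by (simp add: t compose_eq c u v w tens_map_vec[OF UV fd(3) UV' fd(6) fg h] tens_map_vec[OF fd(1,2,4,5) f g]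
          tens_map_vec[OF fd(1) VW fd(4) VW' f gh] tens_map_vec[OF fd(2,3,5,6) g h] assoc_vec[OF fd(1,2,3)] assoc_vec[OF fd(4,5,6)]
          lin_closed[OF f] lin_closed[OF g] lin_closed[OF h])
  qed
qed

lemma
  fixes V W :: "('k::field, 'a) cmod"
  assumes V: "fd_space V" and W: "fd_space W" and f: "lin V W f"
  shows lunit_map_natural: "compose (carrier (tens unit_space V)) (lunit_map W) (tens_map unit_space unit_space V W (id_map (unit_space :: ('k, 'a) cmod)) f) =
      compose (carrier (tens unit_space V)) f (lunit_map V)"
    and runit_map_natural: "compose (carrier (tens V unit_space)) (runit_map W) (tens_map V W unit_space unit_space f (id_map (unit_space :: ('k, 'a) cmod))) =
      compose (carrier (tens V unit_space)) f (runit_map V)"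
proof -
  let ?U = "unit_space :: ('k, 'a) cmod"
  have U: "fd_space ?U" by (rule unit_space_fd)
  note VV = fd_space_vs[OF V] and UU = fd_space_vs[OF U] and WW = fd_space_vs[OF W]
  note i = lin_mapsD[OF id_map_lin_maps[OF UU]]
  have e: "unit_vec (1 :: 'k) \<in> carrier ?U" by simp
  have ie: "id_map ?U (unit_vec (1 :: 'k)) = unit_vec (1 :: 'k)" by (simp add: id_map_def)
  note L = lin_mapsD[OF tens_map_lin[OF U V U W i f]] and R = lin_mapsD[OF tens_map_lin[OF V U W U f i]]
  note lu = lin_mapsD[OF lunit_lin[OF V]] lin_mapsD[OF lunit_lin[OF W]] and ru = lin_mapsD[OF runit_lin[OF V]] lin_mapsD[OF runit_lin[OF W]]
  note X = tens_vs[OF U V] and Y = tens_vs[OF V U]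
  show "compose (carrier (tens ?U V)) (lunit_map W) (tens_map ?U ?U V W (id_map ?U) f) = compose (carrier (tens ?U V)) f (lunit_map V)"
  proof (rule lin_maps_eq_on_generators[OF X WW tprod_generates[OF tens_tprod[OF U V] UU VV unit_space_gen generates_carrier]
        compose_lin_maps[OF X L lu(2)] compose_lin_maps[OF X lu(1) f]])
    fix t assume "t \<in> (\<lambda>(u, v). tens_vec ?U V u v) ` ({unit_vec (1 :: 'k)} \<times> carrier V)"
    then obtain v where t: "t = tens_vec ?U V (unit_vec (1 :: 'k)) v" and v: "v \<in> carrier V" by auto
    show "compose (carrier (tens ?U V)) (lunit_map W) (tens_map ?U ?U V W (id_map ?U) f) t = compose (carrier (tens ?U V)) f (lunit_map V) t"
      by (simp add: t compose_eq tens_vec_closed[OF U V e v] tens_map_vec[OF U V U W i f e v] ie lunit_vec[OF V v] lunit_vec[OF W lin_closed[OF f v]]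
          vs_one_smult[OF VV v] vs_one_smult[OF WW lin_closed[OF f v]])
  qed
  show "compose (carrier (tens V ?U)) (runit_map W) (tens_map V W ?U ?U f (id_map ?U)) = compose (carrier (tens V ?U)) f (runit_map V)"
  proof (rule lin_maps_eq_on_generators[OF Y WW tprod_generates[OF tens_tprod[OF V U] VV UU generates_carrier unit_space_gen]
        compose_lin_maps[OF Y R ru(2)] compose_lin_maps[OF Y ru(1) f]])
    fix t assume "t \<in> (\<lambda>(v, u). tens_vec V ?U v u) ` (carrier V \<times> {unit_vec (1 :: 'k)})"
    then obtain v where t: "t = tens_vec V ?U v (unit_vec (1 :: 'k))" and v: "v \<in> carrier V" by auto
    show "compose (carrier (tens V ?U)) (runit_map W) (tens_map V W ?U ?U f (id_map ?U)) t = compose (carrier (tens V ?U)) f (runit_map V) t"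
      by (simp add: t compose_eq tens_vec_closed[OF V U v e] tens_map_vec[OF V U W U f i v e] ie runit_vec[OF V v] runit_vec[OF W lin_closed[OF f v]]
          vs_one_smult[OF VV v] vs_one_smult[OF WW lin_closed[OF f v]])
  qed
qed

lemma pentagon_maps:
  fixes U V W X :: "('k::field, 'a) cmod"
  assumes U: "fd_space U" and V: "fd_space V" and W: "fd_space W" and X: "fd_space X"
  defines "T \<equiv> tens (tens (tens U V) W) X"
  shows "compose (carrier T) (tens_map U U (tens (tens V W) X) (tens V (tens W X)) (id_map U) (assoc_map V W X))
      (compose (carrier T) (assoc_map U (tens V W) X) (tens_map (tens (tens U V) W) (tens U (tens V W)) X X (assoc_map U V W) (id_map X))) =
    compose (carrier T) (assoc_map U V (tens W X)) (assoc_map (tens U V) W X)" (is "?l = ?r")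
proof -
  note UV = tens_fd[OF U V] and VW = tens_fd[OF V W] and WX = tens_fd[OF W X]
  note UVW = tens_fd[OF UV W] and UVW' = tens_fd[OF U VW] and VWX = tens_fd[OF VW X] and VWX' = tens_fd[OF V WX]
  note iU = lin_mapsD[OF id_map_lin_maps[OF fd_space_vs[OF U]]] and iX = lin_mapsD[OF id_map_lin_maps[OF fd_space_vs[OF X]]]
  note a1 = lin_mapsD[OF assoc_lin[OF U V W]] and a2 = lin_mapsD[OF assoc_lin[OF V W X]] and a3 = lin_mapsD[OF assoc_lin[OF U VW X]]
    and a4 = lin_mapsD[OF assoc_lin[OF U V WX]] and a5 = lin_mapsD[OF assoc_lin[OF UV W X]]
  note m1 = lin_mapsD[OF tens_map_lin[OF UVW X UVW' X a1 iX]] and m2 = lin_mapsD[OF tens_map_lin[OF U VWX U VWX' iU a2]]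
  have T: "is_vs T" unfolding T_def by (rule tens_vs[OF UVW X])
  have gen: "generates ((\<lambda>(t, x). tens_vec (tens (tens U V) W) X t x) ` (((\<lambda>(t, w). tens_vec (tens U V) W t w) `
      (((\<lambda>(u, v). tens_vec U V u v) ` (carrier U \<times> carrier V)) \<times> carrier W)) \<times> carrier X)) T"
    unfolding T_def
    by (rule tprod_generates[OF tens_tprod[OF UVW X] fd_space_vs[OF UVW] fd_space_vs[OF X] tens_assoc_gen[OF U V W] generates_carrier])
  show ?thesis
  proof (rule lin_maps_eq_on_generators[OF T tens_vs[OF U VWX'] gen])
    show "?l \<in> lin_maps T (tens U (tens V (tens W X)))"
      by (rule compose_lin_maps[OF T lin_mapsD[OF compose_lin_maps[OF T m1[folded T_def] a3]] m2])
    show "?r \<in> lin_maps T (tens U (tens V (tens W X)))"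
      by (rule compose_lin_maps[OF T a5[folded T_def] a4])
    fix t assume "t \<in> (\<lambda>(t, x). tens_vec (tens (tens U V) W) X t x) ` (((\<lambda>(t, w). tens_vec (tens U V) W t w) `
      (((\<lambda>(u, v). tens_vec U V u v) ` (carrier U \<times> carrier V)) \<times> carrier W)) \<times> carrier X)"
    then obtain u v w x where t: "t = tens_vec (tens (tens U V) W) X (tens_vec (tens U V) W (tens_vec U V u v) w) x"
      and u: "u \<in> carrier U" and v: "v \<in> carrier V" and w: "w \<in> carrier W" and x: "x \<in> carrier X" by auto
    note c = tens_vec_closed[OF U V u v] tens_vec_closed[OF V W v w] tens_vec_closed[OF W X w x]
    note c2 = tens_vec_closed[OF UV W c(1) w] tens_vec_closed[OF VW X c(2) x]
    note c3 = tens_vec_closed[OF UVW X c2(1) x, folded T_def]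
    show "?l t = ?r t"
      using c c2 c3 u v w x
      by (simp add: t compose_eq tens_map_vec[OF UVW X UVW' X a1 iX] tens_map_vec[OF U VWX U VWX' iU a2]
          assoc_vec[OF U V W] assoc_vec[OF V W X] assoc_vec[OF U VW X] assoc_vec[OF U V WX] assoc_vec[OF UV W X] id_map_apply)
  qed
qed

lemma triangle_maps:
  fixes V W :: "('k::field, 'a) cmod"
  assumes V: "fd_space V" and W: "fd_space W"
  shows "compose (carrier (tens (tens V unit_space) W)) (tens_map V V (tens unit_space W) W (id_map V) (lunit_map W)) (assoc_map V unit_space W) =
    tens_map (tens V unit_space) V W W (runit_map V) (id_map W)"
proof -
  let ?U = "unit_space :: ('k, 'a) cmod"
  have U: "fd_space ?U" by (rule unit_space_fd)
  note VU = tens_fd[OF V U] and UW = tens_fd[OF U W]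
  note iV = lin_mapsD[OF id_map_lin_maps[OF fd_space_vs[OF V]]] and iW = lin_mapsD[OF id_map_lin_maps[OF fd_space_vs[OF W]]]
  note l = lin_mapsD[OF lunit_lin[OF W]] and r = lin_mapsD[OF runit_lin[OF V]] and a = lin_mapsD[OF assoc_lin[OF V U W]]
  note X = tens_vs[OF VU W]
  show ?thesis
  proof (rule lin_maps_eq_on_generators[OF X tens_vs[OF V W] tens_assoc_gen[OF V U W]
        compose_lin_maps[OF X a lin_mapsD[OF tens_map_lin[OF V UW V W iV l]]] tens_map_lin[OF VU W V W r iW]])
    fix t assume "t \<in> (\<lambda>(t, w). tens_vec (tens V ?U) W t w) ` (((\<lambda>(u, v). tens_vec V ?U u v) ` (carrier V \<times> carrier ?U)) \<times> carrier W)"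
    then obtain v u w where t: "t = tens_vec (tens V ?U) W (tens_vec V ?U v u) w" and v: "v \<in> carrier V" and u: "u \<in> carrier ?U" and w: "w \<in> carrier W" by auto
    define c where "c = unit_val u"
    have uc: "u = unit_vec c" using unit_vec_val[OF u] by (simp add: c_def)
    note cl = tens_vec_closed[OF V U v u] tens_vec_closed[OF U W u w]
    have lw: "lunit_map W (tens_vec ?U W u w) = c \<odot>\<^bsub>W\<^esub> w" and rv: "runit_map V (tens_vec V ?U v u) = c \<odot>\<^bsub>V\<^esub> v"
      by (simp_all add: uc lunit_vec[OF W w] runit_vec[OF V v])
    have "tens_vec V W v (c \<odot>\<^bsub>W\<^esub> w) = tens_vec V W (c \<odot>\<^bsub>V\<^esub> v) w"
      using lin_smult[OF bilD2[OF tens_vec_bil[OF V W] v] w] lin_smult[OF bilD1[OF tens_vec_bil[OF V W] w] v] by simp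
    then show "compose (carrier (tens (tens V ?U) W)) (tens_map V V (tens ?U W) W (id_map V) (lunit_map W)) (assoc_map V ?U W) t =
        tens_map (tens V ?U) V W W (runit_map V) (id_map W) t"
      using cl v u w tens_vec_closed[OF VU W cl(1) w]
      by (simp add: t compose_eq assoc_vec[OF V U W] tens_map_vec[OF V UW V W iV l] tens_map_vec[OF VU W V W r iW] lw rv) (simp add: id_map_def)
  qed
qed

lemma swap_map_natural:
  fixes V W V' W' :: "('k::field, 'a) cmod"
  assumes V: "fd_space V" and W: "fd_space W" and V': "fd_space V'" and W': "fd_space W'"
    and f: "lin V V' f" and g: "lin W W' g"
  shows "compose (carrier (tens V W)) (swap_map V' W') (tens_map V V' W W' f g) =
    compose (carrier (tens V W)) (tens_map W W' V V' g f) (swap_map V W)" (is "?l = ?r")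
proof -
  note X = tens_vs[OF V W]
  note s = lin_mapsD[OF swap_lin[OF V W]] and s' = lin_mapsD[OF swap_lin[OF V' W']]
  note L = lin_mapsD[OF tens_map_lin[OF V W V' W' f g]] and R = lin_mapsD[OF tens_map_lin[OF W V W' V' g f]]
  show ?thesis
  proof (rule lin_maps_eq_on_generators[OF X tens_vs[OF W' V'] tprod_gen[OF tens_tprod[OF V W]] compose_lin_maps[OF X L s'] compose_lin_maps[OF X s R]])
    fix t assume "t \<in> (\<lambda>(v, w). tens_vec V W v w) ` (carrier V \<times> carrier W)"
    then obtain v w where t: "t = tens_vec V W v w" and v: "v \<in> carrier V" and w: "w \<in> carrier W" by auto
    show "?l t = ?r t"
      by (simp add: t compose_eq tens_vec_closed[OF V W v w] v w tens_map_vec[OF V W V' W' f g] tens_map_vec[OF W V W' V' g f]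
          swap_vec[OF V W] swap_vec[OF V' W'] lin_closed[OF f] lin_closed[OF g])
  qed
qed

lemma swap_map_involutive:
  fixes V W :: "('k::field, 'a) cmod"
  assumes V: "fd_space V" and W: "fd_space W"
  shows "compose (carrier (tens V W)) (swap_map W V) (swap_map V W) = id_map (tens V W)" (is "?l = ?r")
proof -
  note X = tens_vs[OF V W]
  show ?thesis
  proof (rule lin_maps_eq_on_generators[OF X X tprod_gen[OF tens_tprod[OF V W]]
        compose_lin_maps[OF X lin_mapsD[OF swap_lin[OF V W]] lin_mapsD[OF swap_lin[OF W V]]] id_map_lin_maps[OF X]])
    fix t assume "t \<in> (\<lambda>(v, w). tens_vec V W v w) ` (carrier V \<times> carrier W)"
    then show "?l t = ?r t"
      using tens_vec_closed[OF V W] by (auto simp: compose_eq swap_vec[OF V W] swap_vec[OF W V] id_map_def)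
  qed
qed

lemma hexagon_maps:
  fixes U V W :: "('k::field, 'a) cmod"
  assumes U: "fd_space U" and V: "fd_space V" and W: "fd_space W"
  defines "T \<equiv> tens (tens U V) W"
  shows "compose (carrier T) (assoc_map V W U) (compose (carrier T) (swap_map U (tens V W)) (assoc_map U V W)) =
    compose (carrier T) (tens_map V V (tens U W) (tens W U) (id_map V) (swap_map U W))
      (compose (carrier T) (assoc_map V U W) (tens_map (tens U V) (tens V U) W W (swap_map U V) (id_map W)))" (is "?l = ?r")
proof -
  note UV = tens_fd[OF U V] and VW = tens_fd[OF V W] and VU = tens_fd[OF V U] and UW = tens_fd[OF U W] and WU = tens_fd[OF W U]
  note iV = lin_mapsD[OF id_map_lin_maps[OF fd_space_vs[OF V]]] and iW = lin_mapsD[OF id_map_lin_maps[OF fd_space_vs[OF W]]]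
  note a1 = lin_mapsD[OF assoc_lin[OF U V W]] and a2 = lin_mapsD[OF assoc_lin[OF V W U]] and a3 = lin_mapsD[OF assoc_lin[OF V U W]]
  note s1 = lin_mapsD[OF swap_lin[OF U VW]] and s2 = lin_mapsD[OF swap_lin[OF U W]] and s3 = lin_mapsD[OF swap_lin[OF U V]]
  note m1 = lin_mapsD[OF tens_map_lin[OF UV W VU W s3 iW]] and m2 = lin_mapsD[OF tens_map_lin[OF V UW V WU iV s2]]
  have T: "is_vs T" unfolding T_def by (rule tens_vs[OF UV W])
  show ?thesis
  proof (rule lin_maps_eq_on_generators[OF T tens_vs[OF V WU] tens_assoc_gen[OF U V W, folded T_def]
        compose_lin_maps[OF T lin_mapsD[OF compose_lin_maps[OF T a1[folded T_def] s1]] a2]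
        compose_lin_maps[OF T lin_mapsD[OF compose_lin_maps[OF T m1[folded T_def] a3]] m2]])
    fix t assume "t \<in> (\<lambda>(t, w). tens_vec (tens U V) W t w) ` (((\<lambda>(u, v). tens_vec U V u v) ` (carrier U \<times> carrier V)) \<times> carrier W)"
    then obtain u v w where t: "t = tens_vec (tens U V) W (tens_vec U V u v) w" and u: "u \<in> carrier U" and v: "v \<in> carrier V" and w: "w \<in> carrier W" by auto
    note c = tens_vec_closed[OF U V u v] tens_vec_closed[OF V W v w] tens_vec_closed[OF U W u w] tens_vec_closed[OF V U v u]
    note c2 = tens_vec_closed[OF UV W c(1) w, folded T_def]
    show "?l t = ?r t"
      using c c2 u v w
      by (simp add: t compose_eq assoc_vec[OF U V W] assoc_vec[OF V W U] assoc_vec[OF V U W] swap_vec[OF U VW] swap_vec[OF U W] swap_vec[OF U V]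
          tens_map_vec[OF UV W VU W s3 iW] tens_map_vec[OF V UW V WU iV s2] id_map_apply)
  qed
qed

lemma monoidal_category_ECA:
  "monoidal_category (ECA :: (('k::field, 'a) cob, ('k, 'a + 'k list) eca_ar) monoidal_data)"
proof (intro monoidal_category.intro category_ECA monoidal_category_axioms.intro)
  fix X Y Z W X' Y' Z' :: "('k, 'a) cob" and f g h k :: "('k, 'a + 'k list) eca_ar"
  show "UnitOb ECA \<in> Ob (ECA :: (('k, 'a) cob, ('k, 'a + 'k list) eca_ar) monoidal_data)"
    by (simp add: unit_ob_eca)
  show "TensorOb ECA X Y \<in> Ob ECA" if "X \<in> Ob ECA" "Y \<in> Ob ECA"
    using that by (simp add: tensor_ob_eca)
  show "TensorAr ECA f g \<in> arrows ECA (TensorOb ECA (Dom ECA f) (Dom ECA g)) (TensorOb ECA (Cod ECA f) (Cod ECA g))"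
    if fg: "f \<in> Ar ECA" "g \<in> Ar ECA"
  proof -
    obtain A l B where f: "f = (A, l, B)" "(A, l, B) \<in> eca_ars" using fg(1) by (auto elim: eca_arsE)
    obtain A' m B' where g: "g = (A', m, B')" "(A', m, B') \<in> eca_ars" using fg(2) by (auto elim: eca_arsE)
    show ?thesis using eca_tensor_ar_mem[OF f(2) g(2)] by (simp add: f(1) g(1) arrows_ECA)
  qed
  show "TensorAr ECA (Ident ECA X) (Ident ECA Y) = Ident ECA (TensorOb ECA X Y)" if "X \<in> Ob ECA" "Y \<in> Ob ECA"
    using that by (simp add: tens_map_id ob_fd)
  show "TensorAr ECA (Comp ECA g f) (Comp ECA k h) = Comp ECA (TensorAr ECA g k) (TensorAr ECA f h)"
    if fghk: "f \<in> Ar ECA" "g \<in> Ar ECA" "h \<in> Ar ECA" "k \<in> Ar ECA" "Dom ECA g = Cod ECA f" "Dom ECA k = Cod ECA h"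
  proof -
    obtain A l B where f: "f = (A, l, B)" "(A, l, B) \<in> eca_ars" using fghk(1) by (auto elim: eca_arsE)
    obtain D l' where g: "g = (B, l', D)" "(B, l', D) \<in> eca_ars" using fghk(2,5) by (auto elim: eca_arsE simp: f)
    obtain A' m B' where h: "h = (A', m, B')" "(A', m, B') \<in> eca_ars" using fghk(3) by (auto elim: eca_arsE)
    obtain D' m' where k: "k = (B', m', D')" "(B', m', D') \<in> eca_ars" using fghk(4,6) by (auto elim: eca_arsE simp: h)
    show ?thesis
      using eca_arsD(4-6)[OF f(2)] eca_arsD(4-6)[OF g(2)] eca_arsD(4-6)[OF h(2)] eca_arsD(4-6)[OF k(2)]
      by (simp add: f(1) g(1) h(1) k(1) tens_map_compose)
  qed
  show "Assoc ECA X Y Z \<in> arrows ECA (TensorOb ECA (TensorOb ECA X Y) Z) (TensorOb ECA X (TensorOb ECA Y Z)) \<and>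
      iso_arrow ECA (Assoc ECA X Y Z)" if "X \<in> Ob ECA" "Y \<in> Ob ECA" "Z \<in> Ob ECA"
    using that assoc_ar[of X Y Z] lin_iso_arrow[OF assoc_ar[of X Y Z]] assoc_iso[OF ob_fd ob_fd ob_fd, of X Y Z]
    by (simp add: arrows_ECA)
  show "Comp ECA (Assoc ECA X' Y' Z') (TensorAr ECA (TensorAr ECA f g) h) =
      Comp ECA (TensorAr ECA f (TensorAr ECA g h)) (Assoc ECA X Y Z)"
    if fgh: "f \<in> arrows ECA X X'" "g \<in> arrows ECA Y Y'" "h \<in> arrows ECA Z Z'"
  proof -
    obtain a b c where f: "f = (X, a, X')" "(X, a, X') \<in> eca_ars" and g: "g = (Y, b, Y')" "(Y, b, Y') \<in> eca_ars"
      and h: "h = (Z, c, Z')" "(Z, c, Z') \<in> eca_ars" using fgh by (auto simp: arrows_ECA)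
    show ?thesis
      using assoc_map_natural[OF eca_arsD(5)[OF f(2)] eca_arsD(5)[OF g(2)] eca_arsD(5)[OF h(2)] eca_arsD(6)[OF f(2)]
          eca_arsD(6)[OF g(2)] eca_arsD(6)[OF h(2)] eca_arsD(4)[OF f(2)] eca_arsD(4)[OF g(2)] eca_arsD(4)[OF h(2)]]
      by (simp add: f(1) g(1) h(1))
  qed
  show "LUnit ECA X \<in> arrows ECA (TensorOb ECA (UnitOb ECA) X) X \<and> iso_arrow ECA (LUnit ECA X)" if "X \<in> Ob ECA"
    using that lunit_ar[of X] lin_iso_arrow[OF lunit_ar[of X]] lunit_iso[OF ob_fd, of X] by (simp add: arrows_ECA)
  show "RUnit ECA X \<in> arrows ECA (TensorOb ECA X (UnitOb ECA)) X \<and> iso_arrow ECA (RUnit ECA X)" if "X \<in> Ob ECA"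
    using that runit_ar[of X] lin_iso_arrow[OF runit_ar[of X]] runit_iso[OF ob_fd, of X] by (simp add: arrows_ECA)
  show "Comp ECA (LUnit ECA Y) (TensorAr ECA (Ident ECA (UnitOb ECA)) f) = Comp ECA f (LUnit ECA X)"
    "Comp ECA (RUnit ECA Y) (TensorAr ECA f (Ident ECA (UnitOb ECA))) = Comp ECA f (RUnit ECA X)"
    if f: "f \<in> arrows ECA X Y"
  proof -
    obtain a where f: "f = (X, a, Y)" "(X, a, Y) \<in> eca_ars" using f by (auto simp: arrows_ECA)
    show "Comp ECA (LUnit ECA Y) (TensorAr ECA (Ident ECA (UnitOb ECA)) f) = Comp ECA f (LUnit ECA X)"
      "Comp ECA (RUnit ECA Y) (TensorAr ECA f (Ident ECA (UnitOb ECA))) = Comp ECA f (RUnit ECA X)"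
      using lunit_map_natural[OF eca_arsD(5,6,4)[OF f(2)]] runit_map_natural[OF eca_arsD(5,6,4)[OF f(2)]]
      by (simp_all add: f(1))
  qed
  show "Comp ECA (TensorAr ECA (Ident ECA W) (Assoc ECA X Y Z)) (Comp ECA (Assoc ECA W (TensorOb ECA X Y) Z)
      (TensorAr ECA (Assoc ECA W X Y) (Ident ECA Z))) =
    Comp ECA (Assoc ECA W X (TensorOb ECA Y Z)) (Assoc ECA (TensorOb ECA W X) Y Z)"
    if "W \<in> Ob ECA" "X \<in> Ob ECA" "Y \<in> Ob ECA" "Z \<in> Ob ECA"
    using that by (simp add: pentagon_maps ob_fd)
  show "Comp ECA (TensorAr ECA (Ident ECA X) (LUnit ECA Y)) (Assoc ECA X (UnitOb ECA) Y) = TensorAr ECA (RUnit ECA X) (Ident ECA Y)"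
    if "X \<in> Ob ECA" "Y \<in> Ob ECA"
    using that by (simp add: triangle_maps ob_fd)
qed

lemma symmetric_monoidal_category_ECA:
  "symmetric_monoidal_category (ECA :: (('k::field, 'a) cob, ('k, 'a + 'k list) eca_ar) monoidal_data)"
proof (intro symmetric_monoidal_category.intro monoidal_category_ECA symmetric_monoidal_category_axioms.intro)
  fix X Y Z X' Y' :: "('k, 'a) cob" and f g :: "('k, 'a + 'k list) eca_ar"
  show "Braid ECA X Y \<in> arrows ECA (TensorOb ECA X Y) (TensorOb ECA Y X)" if "X \<in> Ob ECA" "Y \<in> Ob ECA"
    using that by (simp add: arrows_ECA swap_ar)
  show "Comp ECA (Braid ECA X' Y') (TensorAr ECA f g) = Comp ECA (TensorAr ECA g f) (Braid ECA X Y)"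
    if fg: "f \<in> arrows ECA X X'" "g \<in> arrows ECA Y Y'"
  proof -
    obtain a b where f: "f = (X, a, X')" "(X, a, X') \<in> eca_ars" and g: "g = (Y, b, Y')" "(Y, b, Y') \<in> eca_ars"
      using fg by (auto simp: arrows_ECA)
    show ?thesis
      using swap_map_natural[OF eca_arsD(5)[OF f(2)] eca_arsD(5)[OF g(2)] eca_arsD(6)[OF f(2)] eca_arsD(6)[OF g(2)]
          eca_arsD(4)[OF f(2)] eca_arsD(4)[OF g(2)]]
      by (simp add: f(1) g(1))
  qed
  show "Comp ECA (Braid ECA Y X) (Braid ECA X Y) = Ident ECA (TensorOb ECA X Y)" if "X \<in> Ob ECA" "Y \<in> Ob ECA"
    using that by (simp add: swap_map_involutive ob_fd)
  show "Comp ECA (Assoc ECA Y Z X) (Comp ECA (Braid ECA X (TensorOb ECA Y Z)) (Assoc ECA X Y Z)) =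
      Comp ECA (TensorAr ECA (Ident ECA Y) (Braid ECA X Z)) (Comp ECA (Assoc ECA Y X Z) (TensorAr ECA (Braid ECA X Y) (Ident ECA Z)))"
    if "X \<in> Ob ECA" "Y \<in> Ob ECA" "Z \<in> Ob ECA"
    using that by (simp add: hexagon_maps ob_fd)
qed


section \<open>Rigidity\<close>

lemma dagger_ar_apply [simp]:
  "dagger_ar (A, l, B) = (dagger_ob B, dual_map (fst A) (fst B) l, dagger_ob A)"
  by (simp add: dagger_ar_def)

lemma dual_map_eqI:
  fixes V W :: "('k::field, 'a) cmod"
  assumes V: "fd_space V" and W: "fd_space W" and h: "h \<in> lin_maps (dual W) (dual V)" and l: "lin V W l"
    and eq: "\<And>b v. b \<in> carrier (dual W) \<Longrightarrow> v \<in> carrier V \<Longrightarrow> pairing V (h b) v = pairing W b (l v)"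
  shows "dual_map V W l = h"
proof (rule lin_maps_eqI[OF dual_map_lin[OF V W l] h])
  fix b assume b: "b \<in> carrier (dual W)"
  show "dual_map V W l b = h b"
    by (rule perfect_separates1[OF pairing_perfect[OF V]])
      (simp_all add: b lin_closed[OF lin_mapsD[OF dual_map_lin[OF V W l]]] lin_closed[OF lin_mapsD[OF h]]
        dual_map_pairing[OF V W l] eq)
qed

lemma dual_map_id:
  fixes V :: "('k::field, 'a) cmod"
  assumes V: "fd_space V"
  shows "dual_map V V (id_map V) = id_map (dual V)"
  by (rule dual_map_eqI[OF V V id_map_lin_maps[OF fd_space_vs[OF dual_fd[OF V]]] lin_mapsD[OF id_map_lin_maps[OF fd_space_vs[OF V]]]])
    (simp add: id_map_apply)

lemma dual_map_compose:
  fixes U V W :: "('k::field, 'a) cmod"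
  assumes U: "fd_space U" and V: "fd_space V" and W: "fd_space W" and l: "lin U V l" and k: "lin V W k"
  shows "dual_map U W (compose (carrier U) k l) = compose (carrier (dual W)) (dual_map U V l) (dual_map V W k)"
proof (rule dual_map_eqI[OF U W])
  note L = lin_mapsD[OF dual_map_lin[OF U V l]] and K = lin_mapsD[OF dual_map_lin[OF V W k]]
  show "compose (carrier (dual W)) (dual_map U V l) (dual_map V W k) \<in> lin_maps (dual W) (dual U)"
    by (rule compose_lin_maps[OF fd_space_vs[OF dual_fd[OF W]] K L])
  show "lin U W (compose (carrier U) k l)"
    by (rule lin_mapsD[OF compose_lin_maps[OF fd_space_vs[OF U] l k]])
  fix b v assume "b \<in> carrier (dual W)" "v \<in> carrier U"
  then show "pairing U (compose (carrier (dual W)) (dual_map U V l) (dual_map V W k) b) v = pairing W b (compose (carrier U) k l v)"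
    by (simp add: compose_eq lin_closed[OF K] lin_closed[OF l] dual_map_pairing[OF U V l] dual_map_pairing[OF V W k])
qed

lemma contravariant_functor_ECA:
  "contravariant_functor (ECA :: (('k::field, 'a) cob, ('k, 'a + 'k list) eca_ar) monoidal_data) dagger_ob dagger_ar"
proof (intro contravariant_functor.intro category_ECA contravariant_functor_axioms.intro)
  fix A B :: "('k, 'a) cob" and f g :: "('k, 'a + 'k list) eca_ar"
  show "dagger_ob A \<in> Ob ECA" if "A \<in> Ob ECA" using that by (simp add: dagger_ob_eca)
  show "dagger_ar f \<in> arrows ECA (dagger_ob B) (dagger_ob A)" if "f \<in> arrows ECA A B"
    using that dagger_ar_mem[of A _ B] unfolding arrows_ECA by force
  show "dagger_ar (Ident ECA A) = Ident ECA (dagger_ob A)" if "A \<in> Ob ECA"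
    using that by (simp add: dual_map_id ob_fd)
  show "dagger_ar (Comp ECA g f) = Comp ECA (dagger_ar f) (dagger_ar g)"
    if fg: "f \<in> Ar ECA" "g \<in> Ar ECA" "Dom ECA g = Cod ECA f"
  proof -
    obtain A l B where f: "f = (A, l, B)" "(A, l, B) \<in> eca_ars" using fg(1) by (auto elim: eca_arsE)
    obtain D k where g: "g = (B, k, D)" "(B, k, D) \<in> eca_ars" using fg(2,3) by (auto elim: eca_arsE simp: f)
    show ?thesis
      using dual_map_compose[OF eca_arsD(5,6)[OF f(2)] eca_arsD(6)[OF g(2)] eca_arsD(4)[OF f(2)] eca_arsD(4)[OF g(2)]]
      by (simp add: f(1) g(1))
  qed
qed

lemma
  fixes V :: "('k::field, 'a) cmod"
  assumes V: "fd_space V" and v: "v \<in> carrier V"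
  shows lunit_inv: "inv_into (carrier (tens unit_space V)) (lunit_map V) v = tens_vec unit_space V (unit_vec (1 :: 'k)) v"
    and runit_inv: "inv_into (carrier (tens V unit_space)) (runit_map V) v = tens_vec V unit_space v (unit_vec (1 :: 'k))"
proof -
  have U: "fd_space (unit_space :: ('k, 'a) cmod)" by (rule unit_space_fd)
  have e: "unit_vec (1 :: 'k) \<in> carrier (unit_space :: ('k, 'a) cmod)" by simp
  show "inv_into (carrier (tens unit_space V)) (lunit_map V) v = tens_vec unit_space V (unit_vec (1 :: 'k)) v"
    using lin_iso_inv_into_left[OF lunit_iso[OF V] tens_vec_closed[OF U V e v]]
    by (simp add: lunit_vec[OF V v] vs_one_smult[OF fd_space_vs[OF V] v])
  show "inv_into (carrier (tens V unit_space)) (runit_map V) v = tens_vec V unit_space v (unit_vec (1 :: 'k))"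
    using lin_iso_inv_into_left[OF runit_iso[OF V] tens_vec_closed[OF V U v e]]
    by (simp add: runit_vec[OF V v] vs_one_smult[OF fd_space_vs[OF V] v])
qed

lemma assoc_inv:
  fixes U V W :: "('k::field, 'a) cmod"
  assumes fd: "fd_space U" "fd_space V" "fd_space W" and u: "u \<in> carrier U" and v: "v \<in> carrier V" and w: "w \<in> carrier W"
  shows "inv_into (carrier (tens (tens U V) W)) (assoc_map U V W) (tens_vec U (tens V W) u (tens_vec V W v w)) =
    tens_vec (tens U V) W (tens_vec U V u v) w"
  using lin_iso_inv_into_left[OF assoc_iso[OF fd] tens_vec_closed[OF tens_fd[OF fd(1,2)] fd(3) tens_vec_closed[OF fd(1,2) u v] w]]
  by (simp add: assoc_vec[OF fd u v w])

text \<open>As a function of the element of \<open>V \<otimes> V\<^sup>*\<close> put in place of the canonical one, the composite contracts the factor \<open>V\<^sup>*\<close>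
  with \<open>v\<close>, so \<open>coev_vec_left\<close> applies with the identity for \<open>g\<close>.\<close>

lemma zigzag_left:
  fixes V :: "('k::field, 'a) cmod"
  assumes V: "fd_space V" and v: "v \<in> carrier V"
  shows "runit_map V (tens_map V V (tens (dual V) V) unit_space (id_map V) (ev_map V)
    (assoc_map V (dual V) V (tens_vec (tens V (dual V)) V (coev_vec V) v))) = v"
proof -
  have U: "fd_space (unit_space :: ('k, 'a) cmod)" by (rule unit_space_fd)
  note VV = fd_space_vs[OF V] and DV = dual_fd[OF V]
  note T = tens_fd[OF V DV] and T' = tens_fd[OF DV V]
  note i = lin_mapsD[OF id_map_lin_maps[OF VV]] and e = lin_mapsD[OF ev_lin[OF V]]
  note m = lin_mapsD[OF tens_map_lin[OF V T' V U i e]]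
  let ?h = "\<lambda>t. runit_map V (tens_map V V (tens (dual V) V) unit_space (id_map V) (ev_map V)
    (assoc_map V (dual V) V (tens_vec (tens V (dual V)) V t v)))"
  have "?h (coev_vec V) = v"
  proof (rule coev_vec_left[OF V VV _ lin_id v])
    show "lin (tens V (dual V)) V ?h"
      by (rule lin_compose[OF lin_compose[OF lin_compose[OF bilD1[OF tens_vec_bil[OF T V] v] lin_mapsD[OF assoc_lin[OF V DV V]]] m]
            lin_mapsD[OF runit_lin[OF V]]])
    fix w a assume w: "w \<in> carrier V" and a: "a \<in> carrier (dual V)"
    show "?h (tens_vec V (dual V) w a) = pairing V a v \<odot>\<^bsub>V\<^esub> w"
      by (simp add: assoc_vec[OF V DV V w a v] tens_map_vec[OF V T' V U i e w tens_vec_closed[OF DV V a v]] id_map_apply w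
          ev_vec[OF V a v] runit_vec[OF V w])
  qed
  then show ?thesis .
qed

text \<open>With \<open>m = l \<otimes> id\<close> this is the dual of \<open>l\<close> induced by evaluation and coevaluation; with \<open>l\<close> and \<open>m\<close> identities it is
  the second zig-zag identity.\<close>

lemma zigzag_right:
  fixes V W :: "('k::field, 'a) cmod"
  assumes V: "fd_space V" and W: "fd_space W" and b: "b \<in> carrier (dual W)" and l: "lin V W l"
    and m: "lin (tens V (dual V)) (tens W (dual V)) m"
    and mv: "\<And>v a. v \<in> carrier V \<Longrightarrow> a \<in> carrier (dual V) \<Longrightarrow> m (tens_vec V (dual V) v a) = tens_vec W (dual V) (l v) a"
  shows "lunit_map (dual V) (tens_map (tens (dual W) W) unit_space (dual V) (dual V) (ev_map W) (id_map (dual V))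
    (inv_into (carrier (tens (tens (dual W) W) (dual V))) (assoc_map (dual W) W (dual V))
      (tens_vec (dual W) (tens W (dual V)) b (m (coev_vec V))))) = dual_map V W l b"
proof -
  have U: "fd_space (unit_space :: ('k, 'a) cmod)" by (rule unit_space_fd)
  note DV = dual_fd[OF V] and DW = dual_fd[OF W]
  note DVV = fd_space_vs[OF DV]
  note T = tens_fd[OF W DV] and T' = tens_fd[OF DW W]
  note i = lin_mapsD[OF id_map_lin_maps[OF DVV]] and e = lin_mapsD[OF ev_lin[OF W]]
  note n = lin_mapsD[OF tens_map_lin[OF T' DV U DV e i]]
  note j = lin_iso_inverse[OF assoc_iso[OF DW W DV] tens_vs[OF T' DV]]
  let ?h = "\<lambda>t. lunit_map (dual V) (tens_map (tens (dual W) W) unit_space (dual V) (dual V) (ev_map W) (id_map (dual V))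
    (inv_into (carrier (tens (tens (dual W) W) (dual V))) (assoc_map (dual W) W (dual V))
      (tens_vec (dual W) (tens W (dual V)) b (m t))))"
  note d = lin_closed[OF lin_mapsD[OF dual_map_lin[OF V W l]] b]
  have "?h (coev_vec V) = dual_map V W l b"
  proof (rule coev_vec_right[OF V DVV _ lin_id d])
    show "lin (tens V (dual V)) (dual V) ?h"
      by (rule lin_compose[OF lin_compose[OF lin_compose[OF lin_compose[OF m bilD2[OF tens_vec_bil[OF DW T] b]] j] n]
            lin_mapsD[OF lunit_lin[OF DV]]])
    fix v a assume v: "v \<in> carrier V" and a: "a \<in> carrier (dual V)"
    note lv = lin_closed[OF l v]
    show "?h (tens_vec V (dual V) v a) = pairing V (dual_map V W l b) v \<odot>\<^bsub>dual V\<^esub> a"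
      by (simp add: mv[OF v a] assoc_inv[OF DW W DV b lv a] tens_map_vec[OF T' DV U DV e i tens_vec_closed[OF DW W b lv] a] id_map_apply a
          ev_vec[OF W b lv] lunit_vec[OF DV a] dual_map_pairing[OF V W l b v])
  qed
  then show ?thesis .
qed

definition eca_ev :: "('k::field, 'a) cob \<Rightarrow> ('k, 'a + 'k list) eca_ar" where
  "eca_ev A = (eca_tensor_ob (dagger_ob A) A, ev_map (fst A), eca_unit)"

definition eca_coev :: "('k::field, 'a) cob \<Rightarrow> ('k, 'a + 'k list) eca_ar" where
  "eca_coev A = (eca_unit, coev_map (fst A), eca_tensor_ob A (dagger_ob A))"

lemma
  fixes A B D :: "('k::field, 'a) cob"
  shows inverse_lunit: "A \<in> eca_obs \<Longrightarrow> inverse_arrow ECA (eca_tensor_ob eca_unit A, lunit_map (fst A), A) =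
      (A, restrict (inv_into (carrier (tens unit_space (fst A))) (lunit_map (fst A))) (carrier (fst A)), eca_tensor_ob eca_unit A)"
    and inverse_runit: "A \<in> eca_obs \<Longrightarrow> inverse_arrow ECA (eca_tensor_ob A eca_unit, runit_map (fst A), A) =
      (A, restrict (inv_into (carrier (tens (fst A) unit_space)) (runit_map (fst A))) (carrier (fst A)), eca_tensor_ob A eca_unit)"
    and inverse_assoc: "A \<in> eca_obs \<Longrightarrow> B \<in> eca_obs \<Longrightarrow> D \<in> eca_obs \<Longrightarrow> inverse_arrow ECA (eca_tensor_ob (eca_tensor_ob A B) D,
       assoc_map (fst A) (fst B) (fst D), eca_tensor_ob A (eca_tensor_ob B D)) =
      (eca_tensor_ob A (eca_tensor_ob B D),
       restrict (inv_into (carrier (tens (tens (fst A) (fst B)) (fst D))) (assoc_map (fst A) (fst B) (fst D)))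
         (carrier (tens (fst A) (tens (fst B) (fst D)))), eca_tensor_ob (eca_tensor_ob A B) D)"
  using inverse_arrow_ECA[OF lunit_ar, of A] inverse_arrow_ECA[OF runit_ar, of A] inverse_arrow_ECA[OF assoc_ar, of A B D]
    lunit_iso[of "fst A"] runit_iso[of "fst A"] assoc_iso[of "fst A" "fst B" "fst D"]
  by (simp_all add: ob_fd)

lemma is_dual_ECA:
  fixes A :: "('k::field, 'a) cob"
  assumes A: "A \<in> eca_obs"
  shows "is_dual ECA A (dagger_ob A) (eca_ev A) (eca_coev A)"
proof -
  have U: "fd_space (unit_space :: ('k, 'a) cmod)" by (rule unit_space_fd)
  have e1: "unit_vec (1 :: 'k) \<in> carrier (unit_space :: ('k, 'a) cmod)" by simp
  note D = dagger_ob_eca[OF A]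
  let ?V = "fst A"
  note V = ob_fd[OF A]
  note VV = fd_space_vs[OF V] and DV = dual_fd[OF V]
  note DVV = fd_space_vs[OF DV]
  note T = tens_fd[OF V DV] and T' = tens_fd[OF DV V]
  note i = lin_mapsD[OF id_map_lin_maps[OF VV]] and i' = lin_mapsD[OF id_map_lin_maps[OF DVV]]
  note e = lin_mapsD[OF ev_lin[OF V]] and c = lin_mapsD[OF coev_lin[OF V]]
  note \<kappa> = coev_vec_closed[OF V]
  have z1: "Comp ECA (RUnit ECA A) (Comp ECA (TensorAr ECA (Ident ECA A) (eca_ev A)) (Comp ECA (Assoc ECA A (dagger_ob A) A)
      (Comp ECA (TensorAr ECA (eca_coev A) (Ident ECA A)) (inverse_arrow ECA (LUnit ECA A))))) = Ident ECA A"
    (is "?l = _")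
  proof -
    have "fst (snd ?l) v = id_map ?V v" for v
    proof (cases "v \<in> carrier ?V")
      case v: True
      show ?thesis
        by (simp add: eca_ev_def eca_coev_def inverse_lunit[OF A] compose_def v lunit_inv[OF V v]
            tens_map_vec[OF U V T V c i e1 v] coev_one[OF V] id_map_apply zigzag_left[OF V v])
    next
      case False
      then show ?thesis by (simp add: eca_ev_def eca_coev_def inverse_lunit[OF A] compose_def id_map_def)
    qed
    then have "fst (snd ?l) = id_map ?V" ..
    then show ?thesis by (simp add: eca_ev_def eca_coev_def inverse_lunit[OF A])
  qed
  have z2: "Comp ECA (LUnit ECA (dagger_ob A)) (Comp ECA (TensorAr ECA (eca_ev A) (Ident ECA (dagger_ob A)))
      (Comp ECA (inverse_arrow ECA (Assoc ECA (dagger_ob A) A (dagger_ob A)))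
      (Comp ECA (TensorAr ECA (Ident ECA (dagger_ob A)) (eca_coev A)) (inverse_arrow ECA (RUnit ECA (dagger_ob A)))))) = Ident ECA (dagger_ob A)"
    (is "?l = _")
  proof -
    have "fst (snd ?l) b = id_map (dual ?V) b" for b
    proof (cases "b \<in> carrier (dual ?V)")
      case b: True
      have "dual_map ?V ?V (\<lambda>v. v) b = b"
        by (rule perfect_separates1[OF pairing_perfect[OF V]])
          (simp_all add: b lin_closed[OF lin_mapsD[OF dual_map_lin[OF V V lin_id]]] dual_map_pairing[OF V V lin_id])
      then show ?thesis
        using zigzag_right[OF V V b lin_id lin_id]
        by (simp add: eca_ev_def eca_coev_def inverse_runit[OF D, simplified fst_simps] inverse_assoc[OF D A D, simplified fst_simps] compose_def b runit_inv[OF DV b]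
            tens_map_vec[OF DV U DV T i' c b e1] coev_one[OF V] id_map_apply tens_vec_closed[OF DV T b \<kappa>])
    next
      case False
      then show ?thesis by (simp add: eca_ev_def eca_coev_def inverse_runit[OF D, simplified fst_simps] inverse_assoc[OF D A D, simplified fst_simps] compose_def id_map_def)
    qed
    then have "fst (snd ?l) = id_map (dual ?V)" ..
    then show ?thesis by (simp add: eca_ev_def eca_coev_def inverse_runit[OF D, simplified fst_simps] inverse_assoc[OF D A D, simplified fst_simps])
  qed
  show ?thesis
    unfolding is_dual_def
    using z1 z2 ev_ar[OF A] coev_ar[OF A] by (simp add: arrows_ECA eca_ev_def eca_coev_def)
qed

lemma induced_dual_ECA:
  fixes A B :: "('k::field, 'a) cob"
  assumes f: "(A, l, B) \<in> eca_ars"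
  shows "induced_dual ECA (dagger_ob A) (dagger_ob B) (eca_coev A) (eca_ev B) (A, l, B) = dagger_ar (A, l, B)"
proof -
  have U: "fd_space (unit_space :: ('k, 'a) cmod)" by (rule unit_space_fd)
  have e1: "unit_vec (1 :: 'k) \<in> carrier (unit_space :: ('k, 'a) cmod)" by simp
  note A = eca_arsD(1)[OF f] and B = eca_arsD(2)[OF f] and l = eca_arsD(4)[OF f]
  note D = dagger_ob_eca[OF A] and E = dagger_ob_eca[OF B]
  let ?V = "fst A" and ?W = "fst B"
  note V = ob_fd[OF A] and W = ob_fd[OF B]
  note DV = dual_fd[OF V] and DW = dual_fd[OF W]
  note T = tens_fd[OF V DV] and T' = tens_fd[OF W DV]
  note i = lin_mapsD[OF id_map_lin_maps[OF fd_space_vs[OF DV]]] and i' = lin_mapsD[OF id_map_lin_maps[OF fd_space_vs[OF DW]]]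
  note c = lin_mapsD[OF coev_lin[OF V]]
  note \<kappa> = coev_vec_closed[OF V]
  note m = lin_mapsD[OF tens_map_lin[OF V DV W DV l i]]
  note m\<kappa> = lin_closed[OF m \<kappa>]
  have mv: "tens_map ?V ?W (dual ?V) (dual ?V) l (id_map (dual ?V)) (tens_vec ?V (dual ?V) v a) = tens_vec ?W (dual ?V) (l v) a"
    if "v \<in> carrier ?V" "a \<in> carrier (dual ?V)" for v a
    by (simp add: tens_map_vec[OF V DV W DV l i that] id_map_apply that)
  let ?l = "induced_dual ECA (dagger_ob A) (dagger_ob B) (eca_coev A) (eca_ev B) (A, l, B)"
  note defs = induced_dual_def eca_ev_def eca_coev_def inverse_runit[OF E, simplified fst_simps] inverse_assoc[OF E B D, simplified fst_simps]
  have "fst (snd ?l) b = dual_map ?V ?W l b" for b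
  proof (cases "b \<in> carrier (dual ?W)")
    case b: True
    show ?thesis
      using zigzag_right[OF V W b l m mv]
      by (simp add: defs compose_def b runit_inv[OF DW b] tens_map_vec[OF DW U DW T i' c b e1] coev_one[OF V] id_map_apply
          tens_map_vec[OF DW T DW T' i' m b \<kappa>] tens_vec_closed[OF DW T' b m\<kappa>])
  next
    (* outside the carrier both maps take the default value of extensional functions *)
    case False
    then show ?thesis
      using dual_map_lin[OF V W l] by (simp add: defs compose_def lin_maps_iff extensional_def)
  qed
  then have "fst (snd ?l) = dual_map ?V ?W l" ..
  then show ?thesis by (simp add: defs)
qed

lemma rigid_category_ECA:
  "rigid_category (ECA :: (('k::field, 'a) cob, ('k, 'a + 'k list) eca_ar) monoidal_data) dagger_ob dagger_ar"
proof (intro rigid_category.intro symmetric_monoidal_category_ECA contravariant_functor_ECA rigid_category_axioms.intro)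
  let ?C = "ECA :: (('k, 'a) cob, ('k, 'a + 'k list) eca_ar) monoidal_data"
  have "\<forall>f\<in>Ar ?C. induced_dual ?C (dagger_ob (Dom ?C f)) (dagger_ob (Cod ?C f)) (eca_coev (Dom ?C f)) (eca_ev (Cod ?C f)) f = dagger_ar f"
  proof
    fix f :: "('k, 'a + 'k list) eca_ar" assume "f \<in> Ar ?C"
    then obtain A l B where f: "f = (A, l, B)" "(A, l, B) \<in> eca_ars" by (auto elim: eca_arsE)
    then show "induced_dual ?C (dagger_ob (Dom ?C f)) (dagger_ob (Cod ?C f)) (eca_coev (Dom ?C f)) (eca_ev (Cod ?C f)) f = dagger_ar f"
      using induced_dual_ECA[OF f(2)] by simp
  qed
  moreover have "\<forall>A\<in>Ob ?C. is_dual ?C A (dagger_ob A) (eca_ev A) (eca_coev A)"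
    by (simp add: is_dual_ECA)
  ultimately show "\<exists>ev coev.
    (\<forall>A\<in>Ob ?C. is_dual ?C A (dagger_ob A) (ev A) (coev A)) \<and>
    (\<forall>f\<in>Ar ?C. induced_dual ?C (dagger_ob (Dom ?C f)) (dagger_ob (Cod ?C f)) (coev (Dom ?C f)) (ev (Cod ?C f)) f = dagger_ar f)"
    by blast
qed

theorem theorem5:
  shows "rigid_category (ECA :: ((real, 'a + real list) eca_ob, (real, 'a + real list) eca_ar) monoidal_data)
           dagger_ob dagger_ar \<and>
         rigid_category (ECA :: ((complex, 'b + complex list) eca_ob, (complex, 'b + complex list) eca_ar) monoidal_data)
           dagger_ob dagger_ar"
  by (intro conjI rigid_category_ECA)

end
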